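(* Let $(\mathbb{C},p:\dot{\mathcal{U}}\to\mathcal{U})$ be a natural model and let $\mathbb{U}=\mathbb{S}(p)$ be its associated full internal subcategory of $\widehat{\mathbb{C}}$. If $(\mathbb{C},p)$ admits a unit type, dependent sum types and dependent product types, then $\mathbb{U}$ is internally cartesian closed.
   Context: Write $\widehat{\mathbb{C}}=\mathbf{Set}^{\mathbb{C}^{\mathrm{op}}}$ and $\mathsf{y}$ for the Yoneda embedding; elements $x\in P(\Gamma)$ are identified with maps $\mathsf{y}(\Gamma)\to P$. A natural model $(\mathbb{C},p)$ consists of a small category $\mathbb{C}$ with a distinguished terminal object $\diamond$, presheaves $\mathcal{U},\dot{\mathcal{U}}$, a natural transformation $p:\dot{\mathcal{U}}\to\mathcal{U}$ and, for each $\Gamma$ and $A\in\mathcal{U}(\Gamma)$, a chosen object $\Gamma\cdot A$, morphism $\mathsf{p}_A:\Gamma\cdot A\to\Gamma$ and element $\mathsf{q}_A\in\dot{\mathcal{U}}(\Gamma\cdot A)$ such that the square with top $\mathsf{q}_A$, right $p$, left $\mathsf{y}(\mathsf{p}_A)$, bottom $A$ is a pullback. In the internal language of the locally cartesian closed category $\widehat{\mathbb{C}}$, $[A]$ denotes the fibre of $p$ over $A\in\mathcal{U}$. $(\mathbb{C},p)$ **admits a unit type** if there are $\widehat{\mathbb{1}}:1\to\mathcal{U}$, $\widehat\star:1\to\dot{\mathcal{U}}$ exhibiting $\mathrm{id}_1$ as a pullback of $p$; **admits dependent sum types** if there are $\widehat\Sigma:\sum_{A:\mathcal{U}}\mathcal{U}^{[A]}\to\mathcal{U}$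 and $\widehat{\mathsf{pair}}:\sum_{A:\mathcal{U}}\sum_{B:\mathcal{U}^{[A]}}\sum_{a:[A]}[B(a)]\to\dot{\mathcal{U}}$ exhibiting the projection $(A,B,a,b)\mapsto(A,B)$ as a pullback of $p$; **admits dependent product types** if there are $\widehat\Pi:\sum_{A:\mathcal{U}}\mathcal{U}^{[A]}\to\mathcal{U}$ and $\widehat\lambda:\sum_{A:\mathcal{U}}\dot{\mathcal{U}}^{[A]}\to\dot{\mathcal{U}}$ exhibiting $\sum_{A:\mathcal{U}}p^{[A]}$ as a pullback of $p$. **Full internal subcategory.** For $f:B\to A$ in a locally cartesian closed category $\mathcal{E}$, $\mathbb{S}(f)$ is the internal category of $\mathcal{E}$ with object of objects $A$, object of morphisms $\sum_{a,a'\in A}B_{a'}^{B_a}$ (the exponential $(\pi_2^*f)^{(\pi_1^*f)}$ in $\mathcal{E}/(A\times A)$), identities $a\mapsto(a,a,\mathrm{id}_{B_a})$, and composition given by internal composition. So $\mathbb{U}_0=\mathcal{U}$ and $\mathbb{U}_1=\sum_{A,B\in\mathcal{U}}[B]^{[A]}$; concretely $\mathbb{U}_1(\Gamma)$ is the set of triples $(A,B,h)$ with $A,B\in\mathcal{U}(\Gamma)$ and $h:\Gamma\cdot A\to\Gamma\cdot B$ over $\Gamma$. **Internal cartesian closure.** For an object $X$ let $|X|$ be the discrete internal category on $X$. An internal category $\mathbb{A}$ of $\mathcal{E}$ has an internal terminal object if the internal functor $\mathbb{A}\to|1|$ has an internal right adjoint; has internal binary products if the diagonal $\mathbb{A}\to\mathbb{A}\times\mathbb{A}$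 has an internal right adjoint $\dot\times$; and, having internal binary products, has internal exponentials if the internal functor $\mathsf{prod}:|\mathbb{A}_0|\times\mathbb{A}\to|\mathbb{A}_0|\times\mathbb{A}$, given on objects by $(A,B)\mapsto(A,A\dot\times B)$ and on morphisms by $(A,f)\mapsto(A,\mathrm{id}_A\dot\times f)$, has an internal right adjoint. $\mathbb{A}$ is internally cartesian closed if it has all three. *)

theory Defs
  imports "HOL-Library.FuncSet"
begin

section \<open>Small categories and presheaves\<close>

record ('o, 'm) category =
  Obj :: "'o set"
  Arr :: "'m set"
  Dom :: "'m \<Rightarrow> 'o"
  Cod :: "'m \<Rightarrow> 'o"
  Id :: "'o \<Rightarrow> 'm"
  Comp :: "'m \<Rightarrow> 'm \<Rightarrow> 'm"

text \<open>Composition is in the order of function composition: \<open>Comp C g f\<close> is \<open>g\<close> after \<open>f\<close>.\<close>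

definition hom :: "('o, 'm) category \<Rightarrow> 'o \<Rightarrow> 'o \<Rightarrow> 'm set" where
  "hom C X Y = {f \<in> Arr C. Dom C f = X \<and> Cod C f = Y}"

definition is_category :: "('o, 'm) category \<Rightarrow> bool" where
  "is_category C \<longleftrightarrow>
     (\<forall>f \<in> Arr C. Dom C f \<in> Obj C \<and> Cod C f \<in> Obj C) \<and>
     (\<forall>X \<in> Obj C. Id C X \<in> hom C X X) \<and>
     (\<forall>f \<in> Arr C. \<forall>g \<in> Arr C. Dom C g = Cod C f \<longrightarrow>
        Comp C g f \<in> hom C (Dom C f) (Cod C g)) \<and>
     (\<forall>f \<in> Arr C. Comp C f (Id C (Dom C f)) = f \<and> Comp C (Id C (Cod C f)) f = f) \<and>
     (\<forall>f \<in> Arr C. \<forall>g \<in> Arr C. \<forall>h \<in> Arr C. Dom C g = Cod C f \<longrightarrow> Dom C h = Cod C g \<longrightarrow>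
        Comp C h (Comp C g f) = Comp C (Comp C h g) f)"

definition is_terminal_object :: "('o, 'm) category \<Rightarrow> 'o \<Rightarrow> bool" where
  "is_terminal_object C t \<longleftrightarrow> t \<in> Obj C \<and> (\<forall>X \<in> Obj C. \<exists>!f. f \<in> hom C X t)"

record ('o, 'm, 'a) presheaf =
  sect :: "'o \<Rightarrow> 'a set"
  restr :: "'m \<Rightarrow> 'a \<Rightarrow> 'a"

definition is_presheaf :: "('o, 'm) category \<Rightarrow> ('o, 'm, 'a) presheaf \<Rightarrow> bool" where
  "is_presheaf C P \<longleftrightarrow>
     (\<forall>f \<in> Arr C. \<forall>x \<in> sect P (Cod C f). restr P f x \<in> sect P (Dom C f)) \<and>
     (\<forall>X \<in> Obj C. \<forall>x \<in> sect P X. restr P (Id C X) x = x) \<and>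
     (\<forall>f \<in> Arr C. \<forall>g \<in> Arr C. Dom C g = Cod C f \<longrightarrow>
        (\<forall>x \<in> sect P (Cod C g). restr P (Comp C g f) x = restr P f (restr P g x)))"

text \<open>
  A natural transformation is a family of functions indexed by the objects. Only its values on
  sections are meaningful, so equality of natural transformations always means equality on sections.
\<close>

definition nat_trans ::
  "('o, 'm) category \<Rightarrow> ('o, 'm, 'a) presheaf \<Rightarrow> ('o, 'm, 'b) presheaf \<Rightarrow> ('o \<Rightarrow> 'a \<Rightarrow> 'b) \<Rightarrow> bool"
where
  "nat_trans C P Q \<alpha> \<longleftrightarrow>
     (\<forall>X \<in> Obj C. \<forall>x \<in> sect P X. \<alpha> X x \<in> sect Q X) \<and>
     (\<forall>f \<in> Arr C. \<forall>x \<in> sect P (Cod C f). \<alpha> (Dom C f) (restr P f x) = restr Q f (\<alpha> (Cod C f) x))"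

definition nat_iso ::
  "('o, 'm) category \<Rightarrow> ('o, 'm, 'a) presheaf \<Rightarrow> ('o, 'm, 'b) presheaf \<Rightarrow> ('o \<Rightarrow> 'a \<Rightarrow> 'b) \<Rightarrow> bool"
where
  "nat_iso C P Q \<alpha> \<longleftrightarrow> nat_trans C P Q \<alpha> \<and>
     (\<exists>\<beta>. nat_trans C Q P \<beta> \<and>
        (\<forall>X \<in> Obj C. (\<forall>x \<in> sect P X. \<beta> X (\<alpha> X x) = x) \<and> (\<forall>y \<in> sect Q X. \<alpha> X (\<beta> X y) = y)))"

definition terminal_psh :: "('o, 'm, unit) presheaf" where
  "terminal_psh = \<lparr>sect = (\<lambda>X. {()}), restr = (\<lambda>f x. x)\<rparr>"

definition prod_psh ::
  "('o, 'm, 'a) presheaf \<Rightarrow> ('o, 'm, 'b) presheaf \<Rightarrow> ('o, 'm, 'a \<times> 'b) presheaf" where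
  "prod_psh P Q =
     \<lparr>sect = (\<lambda>X. sect P X \<times> sect Q X), restr = (\<lambda>f. map_prod (restr P f) (restr Q f))\<rparr>"

definition pb_psh ::
  "('o, 'm, 'a) presheaf \<Rightarrow> ('o, 'm, 'b) presheaf \<Rightarrow> ('o \<Rightarrow> 'a \<Rightarrow> 'c) \<Rightarrow> ('o \<Rightarrow> 'b \<Rightarrow> 'c)
    \<Rightarrow> ('o, 'm, 'a \<times> 'b) presheaf" where
  "pb_psh P Q f g =
     \<lparr>sect = (\<lambda>X. {(x, y). x \<in> sect P X \<and> y \<in> sect Q X \<and> f X x = g X y}),
      restr = (\<lambda>\<sigma>. map_prod (restr P \<sigma>) (restr Q \<sigma>))\<rparr>"

text \<open>
  \<open>is_pullback C W P Q R t l r b\<close> concerns the square with top \<open>t : W \<rightarrow> Q\<close>, left \<open>l : W \<rightarrow> P\<close>,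
  right \<open>r : Q \<rightarrow> R\<close> and bottom \<open>b : P \<rightarrow> R\<close>. It is a pullback if it commutes and the comparison
  map to the pointwise pullback is an isomorphism; see \<open>is_pullback_universal\<close> and
  \<open>is_pullback_if_universal\<close> below for the universal property.
\<close>

definition is_pullback ::
  "('o, 'm) category \<Rightarrow> ('o, 'm, 'w) presheaf \<Rightarrow> ('o, 'm, 'a) presheaf \<Rightarrow> ('o, 'm, 'b) presheaf \<Rightarrow>
   ('o, 'm, 'c) presheaf \<Rightarrow> ('o \<Rightarrow> 'w \<Rightarrow> 'b) \<Rightarrow> ('o \<Rightarrow> 'w \<Rightarrow> 'a) \<Rightarrow> ('o \<Rightarrow> 'b \<Rightarrow> 'c) \<Rightarrow> ('o \<Rightarrow> 'a \<Rightarrow> 'c) \<Rightarrow> bool"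
where
  "is_pullback C W P Q R t l r b \<longleftrightarrow>
     nat_trans C W Q t \<and> nat_trans C W P l \<and> nat_trans C Q R r \<and> nat_trans C P R b \<and>
     (\<forall>X \<in> Obj C. \<forall>w \<in> sect W X. b X (l X w) = r X (t X w)) \<and>
     nat_iso C W (pb_psh P Q b r) (\<lambda>X w. (l X w, t X w))"

definition yo :: "('o, 'm) category \<Rightarrow> 'o \<Rightarrow> ('o, 'm, 'm) presheaf" where
  "yo C Y = \<lparr>sect = (\<lambda>X. hom C X Y), restr = (\<lambda>f g. Comp C g f)\<rparr>"

definition yo_map :: "('o, 'm) category \<Rightarrow> 'm \<Rightarrow> 'o \<Rightarrow> 'm \<Rightarrow> 'm" where
  "yo_map C f = (\<lambda>X g. Comp C f g)"

text \<open>The map \<open>yo C Y \<rightarrow> P\<close> that corresponds to a section of \<open>P\<close> over \<open>Y\<close>.\<close>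

definition yo_elem :: "('o, 'm, 'a) presheaf \<Rightarrow> 'a \<Rightarrow> 'o \<Rightarrow> 'm \<Rightarrow> 'a" where
  "yo_elem P x = (\<lambda>X g. restr P g x)"


section \<open>Local exponentials of presheaves\<close>

text \<open>
  Fix \<open>f : B \<rightarrow> A\<close> and \<open>a\<close> a section of \<open>A\<close> over \<open>\<Gamma>\<close>. The fibre \<open>B\<^sub>a\<close> is the pullback of
  \<open>f\<close> along \<open>a : yo \<Gamma> \<rightarrow> A\<close>. Its sections over \<open>\<Delta>\<close> are the pairs \<open>(\<sigma>, b)\<close> with
  \<open>\<sigma> : \<Delta> \<rightarrow> \<Gamma>\<close>, \<open>b\<close> in \<open>B(\<Delta>)\<close> and \<open>f b = a\<sigma>\<close>; as \<open>\<Delta>\<close> is the domain of \<open>\<sigma>\<close>, all of them can be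
  collected in one set. A section over \<open>\<Gamma>\<close> of the exponential \<open>X^B\<^sub>a\<close> is a natural transformation
  from this pullback to \<open>X\<close>, represented by an extensional function on this set.
\<close>

definition fibre ::
  "('o, 'm) category \<Rightarrow> ('o, 'm, 'b) presheaf \<Rightarrow> ('o, 'm, 'a) presheaf \<Rightarrow> ('o \<Rightarrow> 'b \<Rightarrow> 'a)
    \<Rightarrow> 'o \<Rightarrow> 'a \<Rightarrow> ('m \<times> 'b) set" where
  "fibre C B A f \<Gamma> a =
     {(\<sigma>, b). \<sigma> \<in> Arr C \<and> Cod C \<sigma> = \<Gamma> \<and> b \<in> sect B (Dom C \<sigma>) \<and> f (Dom C \<sigma>) b = restr A \<sigma> a}"

definition fibre_maps ::
  "('o, 'm) category \<Rightarrow> ('o, 'm, 'b) presheaf \<Rightarrow> ('o, 'm, 'a) presheaf \<Rightarrow> ('o \<Rightarrow> 'b \<Rightarrow> 'a)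
    \<Rightarrow> ('o, 'm, 'x) presheaf \<Rightarrow> 'o \<Rightarrow> 'a \<Rightarrow> ('m \<times> 'b \<Rightarrow> 'x) set" where
  "fibre_maps C B A f X \<Gamma> a =
     {\<phi> \<in> extensional (fibre C B A f \<Gamma> a).
        \<forall>(\<sigma>, b) \<in> fibre C B A f \<Gamma> a.
          \<phi> (\<sigma>, b) \<in> sect X (Dom C \<sigma>) \<and>
          (\<forall>\<tau> \<in> Arr C. Cod C \<tau> = Dom C \<sigma> \<longrightarrow>
             \<phi> (Comp C \<sigma> \<tau>, restr B \<tau> b) = restr X \<tau> (\<phi> (\<sigma>, b)))}"

definition fibre_map_restr ::
  "('o, 'm) category \<Rightarrow> ('o, 'm, 'b) presheaf \<Rightarrow> ('o, 'm, 'a) presheaf \<Rightarrow> ('o \<Rightarrow> 'b \<Rightarrow> 'a)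
    \<Rightarrow> 'm \<Rightarrow> 'a \<Rightarrow> ('m \<times> 'b \<Rightarrow> 'x) \<Rightarrow> ('m \<times> 'b \<Rightarrow> 'x)" where
  "fibre_map_restr C B A f \<tau> a \<phi> =
     restrict (\<lambda>(\<sigma>, b). \<phi> (Comp C \<tau> \<sigma>, b)) (fibre C B A f (Dom C \<tau>) (restr A \<tau> a))"

text \<open>The presheaf of pairs \<open>(a, \<phi>)\<close> with \<open>a\<close> in \<open>A\<close> and \<open>\<phi>\<close> in \<open>X^B\<^sub>a\<close>.\<close>

definition poly_psh ::
  "('o, 'm) category \<Rightarrow> ('o, 'm, 'b) presheaf \<Rightarrow> ('o, 'm, 'a) presheaf \<Rightarrow> ('o \<Rightarrow> 'b \<Rightarrow> 'a)
    \<Rightarrow> ('o, 'm, 'x) presheaf \<Rightarrow> ('o, 'm, 'a \<times> ('m \<times> 'b \<Rightarrow> 'x)) presheaf" where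
  "poly_psh C B A f X =
     \<lparr>sect = (\<lambda>\<Gamma>. {(a, \<phi>). a \<in> sect A \<Gamma> \<and> \<phi> \<in> fibre_maps C B A f X \<Gamma> a}),
      restr = (\<lambda>\<tau> (a, \<phi>). (restr A \<tau> a, fibre_map_restr C B A f \<tau> a \<phi>))\<rparr>"

text \<open>
  The presheaf of triples \<open>(a, a', \<phi>)\<close> with \<open>\<phi>\<close> in \<open>B\<^sub>a\<^sub>'^B\<^sub>a\<close>. It is the exponential, in the slice
  over \<open>A \<times> A\<close>, of the pullbacks of \<open>f\<close> along the two projections; its universal property is
  \<open>fibre_hom_universal\<close> below.
\<close>

definition fibre_hom_psh ::
  "('o, 'm) category \<Rightarrow> ('o, 'm, 'b) presheaf \<Rightarrow> ('o, 'm, 'a) presheaf \<Rightarrow> ('o \<Rightarrow> 'b \<Rightarrow> 'a)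
    \<Rightarrow> ('o, 'm, 'a \<times> 'a \<times> ('m \<times> 'b \<Rightarrow> 'b)) presheaf" where
  "fibre_hom_psh C B A f =
     \<lparr>sect = (\<lambda>\<Gamma>. {(a, a', \<phi>). a \<in> sect A \<Gamma> \<and> a' \<in> sect A \<Gamma> \<and> \<phi> \<in> fibre_maps C B A f B \<Gamma> a \<and>
                (\<forall>(\<sigma>, b) \<in> fibre C B A f \<Gamma> a. f (Dom C \<sigma>) (\<phi> (\<sigma>, b)) = restr A \<sigma> a')}),
      restr = (\<lambda>\<tau> (a, a', \<phi>). (restr A \<tau> a, restr A \<tau> a', fibre_map_restr C B A f \<tau> a \<phi>))\<rparr>"


section \<open>Internal categories in presheaves\<close>

record ('o, 'm, 'a, 'b) icategory =
  iob :: "('o, 'm, 'a) presheaf"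
  imor :: "('o, 'm, 'b) presheaf"
  idom :: "'o \<Rightarrow> 'b \<Rightarrow> 'a"
  icod :: "'o \<Rightarrow> 'b \<Rightarrow> 'a"
  iid :: "'o \<Rightarrow> 'a \<Rightarrow> 'b"
  icomp :: "'o \<Rightarrow> 'b \<times> 'b \<Rightarrow> 'b"

text \<open>A composable pair is written \<open>(g, f)\<close> with \<open>idom g = icod f\<close>.\<close>

definition composable :: "('o, 'm, 'a, 'b) icategory \<Rightarrow> ('o, 'm, 'b \<times> 'b) presheaf" where
  "composable A = pb_psh (imor A) (imor A) (idom A) (icod A)"

definition internal_category :: "('o, 'm) category \<Rightarrow> ('o, 'm, 'a, 'b) icategory \<Rightarrow> bool" where
  "internal_category C A \<longleftrightarrow>
     is_presheaf C (iob A) \<and> is_presheaf C (imor A) \<and>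
     nat_trans C (imor A) (iob A) (idom A) \<and> nat_trans C (imor A) (iob A) (icod A) \<and>
     nat_trans C (iob A) (imor A) (iid A) \<and> nat_trans C (composable A) (imor A) (icomp A) \<and>
     (\<forall>\<Gamma> \<in> Obj C.
        (\<forall>a \<in> sect (iob A) \<Gamma>. idom A \<Gamma> (iid A \<Gamma> a) = a \<and> icod A \<Gamma> (iid A \<Gamma> a) = a) \<and>
        (\<forall>(g, f) \<in> sect (composable A) \<Gamma>.
           idom A \<Gamma> (icomp A \<Gamma> (g, f)) = idom A \<Gamma> f \<and> icod A \<Gamma> (icomp A \<Gamma> (g, f)) = icod A \<Gamma> g) \<and>
        (\<forall>f \<in> sect (imor A) \<Gamma>.
           icomp A \<Gamma> (f, iid A \<Gamma> (idom A \<Gamma> f)) = f \<and> icomp A \<Gamma> (iid A \<Gamma> (icod A \<Gamma> f), f) = f) \<and>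
        (\<forall>h g f. (h, g) \<in> sect (composable A) \<Gamma> \<longrightarrow> (g, f) \<in> sect (composable A) \<Gamma> \<longrightarrow>
           icomp A \<Gamma> (h, icomp A \<Gamma> (g, f)) = icomp A \<Gamma> (icomp A \<Gamma> (h, g), f)))"

record ('o, 'a, 'b, 'c, 'd) ifunctor =
  fob :: "'o \<Rightarrow> 'a \<Rightarrow> 'c"
  fmor :: "'o \<Rightarrow> 'b \<Rightarrow> 'd"

definition internal_functor ::
  "('o, 'm) category \<Rightarrow> ('o, 'm, 'a, 'b) icategory \<Rightarrow> ('o, 'm, 'c, 'd) icategory
    \<Rightarrow> ('o, 'a, 'b, 'c, 'd) ifunctor \<Rightarrow> bool" where
  "internal_functor C A B F \<longleftrightarrow>
     internal_category C A \<and> internal_category C B \<and>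
     nat_trans C (iob A) (iob B) (fob F) \<and> nat_trans C (imor A) (imor B) (fmor F) \<and>
     (\<forall>\<Gamma> \<in> Obj C.
        (\<forall>f \<in> sect (imor A) \<Gamma>.
           idom B \<Gamma> (fmor F \<Gamma> f) = fob F \<Gamma> (idom A \<Gamma> f) \<and>
           icod B \<Gamma> (fmor F \<Gamma> f) = fob F \<Gamma> (icod A \<Gamma> f)) \<and>
        (\<forall>a \<in> sect (iob A) \<Gamma>. fmor F \<Gamma> (iid A \<Gamma> a) = iid B \<Gamma> (fob F \<Gamma> a)) \<and>
        (\<forall>(g, f) \<in> sect (composable A) \<Gamma>.
           fmor F \<Gamma> (icomp A \<Gamma> (g, f)) = icomp B \<Gamma> (fmor F \<Gamma> g, fmor F \<Gamma> f)))"

definition id_functor :: "('o, 'a, 'b, 'a, 'b) ifunctor" where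
  "id_functor = \<lparr>fob = (\<lambda>\<Gamma> x. x), fmor = (\<lambda>\<Gamma> f. f)\<rparr>"

definition comp_functor ::
  "('o, 'c, 'd, 'e, 'f) ifunctor \<Rightarrow> ('o, 'a, 'b, 'c, 'd) ifunctor \<Rightarrow> ('o, 'a, 'b, 'e, 'f) ifunctor" where
  "comp_functor G F =
     \<lparr>fob = (\<lambda>\<Gamma> x. fob G \<Gamma> (fob F \<Gamma> x)), fmor = (\<lambda>\<Gamma> f. fmor G \<Gamma> (fmor F \<Gamma> f))\<rparr>"

definition internal_nat_trans ::
  "('o, 'm) category \<Rightarrow> ('o, 'm, 'a, 'b) icategory \<Rightarrow> ('o, 'm, 'c, 'd) icategory
    \<Rightarrow> ('o, 'a, 'b, 'c, 'd) ifunctor \<Rightarrow> ('o, 'a, 'b, 'c, 'd) ifunctor \<Rightarrow> ('o \<Rightarrow> 'a \<Rightarrow> 'd) \<Rightarrow> bool" where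
  "internal_nat_trans C A B F G \<eta> \<longleftrightarrow>
     nat_trans C (iob A) (imor B) \<eta> \<and>
     (\<forall>\<Gamma> \<in> Obj C.
        (\<forall>a \<in> sect (iob A) \<Gamma>. idom B \<Gamma> (\<eta> \<Gamma> a) = fob F \<Gamma> a \<and> icod B \<Gamma> (\<eta> \<Gamma> a) = fob G \<Gamma> a) \<and>
        (\<forall>f \<in> sect (imor A) \<Gamma>.
           icomp B \<Gamma> (\<eta> \<Gamma> (icod A \<Gamma> f), fmor F \<Gamma> f) = icomp B \<Gamma> (fmor G \<Gamma> f, \<eta> \<Gamma> (idom A \<Gamma> f))))"

text \<open>\<open>F : A \<rightarrow> B\<close> is left adjoint to \<open>G : B \<rightarrow> A\<close>, with unit \<open>\<eta>\<close> and counit \<open>\<epsilon>\<close>.\<close>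

definition internal_adjunction ::
  "('o, 'm) category \<Rightarrow> ('o, 'm, 'a, 'b) icategory \<Rightarrow> ('o, 'm, 'c, 'd) icategory
    \<Rightarrow> ('o, 'a, 'b, 'c, 'd) ifunctor \<Rightarrow> ('o, 'c, 'd, 'a, 'b) ifunctor
    \<Rightarrow> ('o \<Rightarrow> 'a \<Rightarrow> 'b) \<Rightarrow> ('o \<Rightarrow> 'c \<Rightarrow> 'd) \<Rightarrow> bool" where
  "internal_adjunction C A B F G \<eta> \<epsilon> \<longleftrightarrow>
     internal_functor C A B F \<and> internal_functor C B A G \<and>
     internal_nat_trans C A A id_functor (comp_functor G F) \<eta> \<and>
     internal_nat_trans C B B (comp_functor F G) id_functor \<epsilon> \<and>
     (\<forall>\<Gamma> \<in> Obj C.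
        (\<forall>a \<in> sect (iob A) \<Gamma>.
           icomp B \<Gamma> (\<epsilon> \<Gamma> (fob F \<Gamma> a), fmor F \<Gamma> (\<eta> \<Gamma> a)) = iid B \<Gamma> (fob F \<Gamma> a)) \<and>
        (\<forall>b \<in> sect (iob B) \<Gamma>.
           icomp A \<Gamma> (fmor G \<Gamma> (\<epsilon> \<Gamma> b), \<eta> \<Gamma> (fob G \<Gamma> b)) = iid A \<Gamma> (fob G \<Gamma> b)))"

definition internal_right_adjoint ::
  "('o, 'm) category \<Rightarrow> ('o, 'm, 'a, 'b) icategory \<Rightarrow> ('o, 'm, 'c, 'd) icategory
    \<Rightarrow> ('o, 'a, 'b, 'c, 'd) ifunctor \<Rightarrow> ('o, 'c, 'd, 'a, 'b) ifunctor \<Rightarrow> bool" where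
  "internal_right_adjoint C A B F G \<longleftrightarrow> (\<exists>\<eta> \<epsilon>. internal_adjunction C A B F G \<eta> \<epsilon>)"


section \<open>Internal cartesian closure\<close>

definition discrete_icat :: "('o, 'm, 'a) presheaf \<Rightarrow> ('o, 'm, 'a, 'a) icategory" where
  "discrete_icat X =
     \<lparr>iob = X, imor = X, idom = (\<lambda>\<Gamma> x. x), icod = (\<lambda>\<Gamma> x. x), iid = (\<lambda>\<Gamma> x. x),
      icomp = (\<lambda>\<Gamma> (y, x). x)\<rparr>"

definition prod_icat ::
  "('o, 'm, 'a, 'b) icategory \<Rightarrow> ('o, 'm, 'c, 'd) icategory \<Rightarrow> ('o, 'm, 'a \<times> 'c, 'b \<times> 'd) icategory"
where
  "prod_icat A B =
     \<lparr>iob = prod_psh (iob A) (iob B), imor = prod_psh (imor A) (imor B),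
      idom = (\<lambda>\<Gamma>. map_prod (idom A \<Gamma>) (idom B \<Gamma>)), icod = (\<lambda>\<Gamma>. map_prod (icod A \<Gamma>) (icod B \<Gamma>)),
      iid = (\<lambda>\<Gamma>. map_prod (iid A \<Gamma>) (iid B \<Gamma>)),
      icomp = (\<lambda>\<Gamma> ((g, g'), (f, f')). (icomp A \<Gamma> (g, f), icomp B \<Gamma> (g', f')))\<rparr>"

definition bang_functor :: "('o, 'a, 'b, unit, unit) ifunctor" where
  "bang_functor = \<lparr>fob = (\<lambda>\<Gamma> x. ()), fmor = (\<lambda>\<Gamma> f. ())\<rparr>"

definition diag_functor :: "('o, 'a, 'b, 'a \<times> 'a, 'b \<times> 'b) ifunctor" where
  "diag_functor = \<lparr>fob = (\<lambda>\<Gamma> x. (x, x)), fmor = (\<lambda>\<Gamma> f. (f, f))\<rparr>"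

definition has_internal_terminal :: "('o, 'm) category \<Rightarrow> ('o, 'm, 'a, 'b) icategory \<Rightarrow> bool" where
  "has_internal_terminal C A \<longleftrightarrow>
     (\<exists>T. internal_right_adjoint C A (discrete_icat terminal_psh) bang_functor T)"

definition internal_product ::
  "('o, 'm) category \<Rightarrow> ('o, 'm, 'a, 'b) icategory \<Rightarrow> ('o, 'a \<times> 'a, 'b \<times> 'b, 'a, 'b) ifunctor \<Rightarrow> bool"
where
  "internal_product C A P \<longleftrightarrow> internal_right_adjoint C A (prod_icat A A) diag_functor P"

definition prod_functor ::
  "('o, 'm, 'a, 'b) icategory \<Rightarrow> ('o, 'a \<times> 'a, 'b \<times> 'b, 'a, 'b) ifunctor
    \<Rightarrow> ('o, 'a \<times> 'a, 'a \<times> 'b, 'a \<times> 'a, 'a \<times> 'b) ifunctor" where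
  "prod_functor A P =
     \<lparr>fob = (\<lambda>\<Gamma> (a, b). (a, fob P \<Gamma> (a, b))), fmor = (\<lambda>\<Gamma> (a, f). (a, fmor P \<Gamma> (iid A \<Gamma> a, f)))\<rparr>"

definition has_internal_exponentials ::
  "('o, 'm) category \<Rightarrow> ('o, 'm, 'a, 'b) icategory \<Rightarrow> ('o, 'a \<times> 'a, 'b \<times> 'b, 'a, 'b) ifunctor \<Rightarrow> bool"
where
  "has_internal_exponentials C A P \<longleftrightarrow>
     (\<exists>E. internal_right_adjoint C
            (prod_icat (discrete_icat (iob A)) A) (prod_icat (discrete_icat (iob A)) A)
            (prod_functor A P) E)"

text \<open>
  Exponentials are taken with respect to a chosen product functor. Right adjoints being unique up to
  isomorphism, the choice is immaterial.
\<close>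

definition internally_cartesian_closed ::
  "('o, 'm) category \<Rightarrow> ('o, 'm, 'a, 'b) icategory \<Rightarrow> bool" where
  "internally_cartesian_closed C A \<longleftrightarrow>
     internal_category C A \<and> has_internal_terminal C A \<and>
     (\<exists>P. internal_product C A P \<and> has_internal_exponentials C A P)"


section \<open>Full internal subcategories\<close>

definition full_internal_subcategory ::
  "('o, 'm) category \<Rightarrow> ('o, 'm, 'b) presheaf \<Rightarrow> ('o, 'm, 'a) presheaf \<Rightarrow> ('o \<Rightarrow> 'b \<Rightarrow> 'a)
    \<Rightarrow> ('o, 'm, 'a, 'a \<times> 'a \<times> ('m \<times> 'b \<Rightarrow> 'b)) icategory" where
  "full_internal_subcategory C B A f =
     \<lparr>iob = A, imor = fibre_hom_psh C B A f,
      idom = (\<lambda>\<Gamma> (a, a', \<phi>). a), icod = (\<lambda>\<Gamma> (a, a', \<phi>). a'),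
      iid = (\<lambda>\<Gamma> a. (a, a, restrict (\<lambda>(\<sigma>, b). b) (fibre C B A f \<Gamma> a))),
      icomp = (\<lambda>\<Gamma> ((a', a'', \<psi>), (a, _, \<phi>)).
        (a, a'', restrict (\<lambda>(\<sigma>, b). \<psi> (\<sigma>, \<phi> (\<sigma>, b))) (fibre C B A f \<Gamma> a)))\<rparr>"


section \<open>Natural models\<close>

text \<open>
  \<open>Ty\<close> and \<open>Tm\<close> are the presheaves of types and of terms, \<open>ty_of\<close> is the natural transformation
  \<open>p : Tm \<rightarrow> Ty\<close>, and \<open>ext \<Gamma> A\<close>, \<open>disp \<Gamma> A\<close>, \<open>gen \<Gamma> A\<close> are the chosen representability data for
  \<open>A\<close> in \<open>Ty(\<Gamma>)\<close>.
\<close>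

record ('o, 'm, 'u, 'd) natural_model =
  ctx :: "('o, 'm) category"
  empty_ctx :: "'o"
  Ty :: "('o, 'm, 'u) presheaf"
  Tm :: "('o, 'm, 'd) presheaf"
  ty_of :: "'o \<Rightarrow> 'd \<Rightarrow> 'u"
  ext :: "'o \<Rightarrow> 'u \<Rightarrow> 'o"
  disp :: "'o \<Rightarrow> 'u \<Rightarrow> 'm"
  gen :: "'o \<Rightarrow> 'u \<Rightarrow> 'd"

definition is_natural_model :: "('o, 'm, 'u, 'd) natural_model \<Rightarrow> bool" where
  "is_natural_model M \<longleftrightarrow>
     is_category (ctx M) \<and> is_terminal_object (ctx M) (empty_ctx M) \<and>
     is_presheaf (ctx M) (Ty M) \<and> is_presheaf (ctx M) (Tm M) \<and>
     nat_trans (ctx M) (Tm M) (Ty M) (ty_of M) \<and>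
     (\<forall>\<Gamma> \<in> Obj (ctx M). \<forall>A \<in> sect (Ty M) \<Gamma>.
        ext M \<Gamma> A \<in> Obj (ctx M) \<and>
        disp M \<Gamma> A \<in> hom (ctx M) (ext M \<Gamma> A) \<Gamma> \<and>
        gen M \<Gamma> A \<in> sect (Tm M) (ext M \<Gamma> A) \<and>
        is_pullback (ctx M) (yo (ctx M) (ext M \<Gamma> A)) (yo (ctx M) \<Gamma>) (Tm M) (Ty M)
          (yo_elem (Tm M) (gen M \<Gamma> A)) (yo_map (ctx M) (disp M \<Gamma> A))
          (ty_of M) (yo_elem (Ty M) A))"

definition admits_unit_type :: "('o, 'm, 'u, 'd) natural_model \<Rightarrow> bool" where
  "admits_unit_type M \<longleftrightarrow>
     (\<exists>one star. is_pullback (ctx M) terminal_psh terminal_psh (Tm M) (Ty M)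
        star (\<lambda>\<Gamma> x. x) (ty_of M) one)"

text \<open>The presheaf of pairs \<open>(A, X)\<close> with \<open>A\<close> in \<open>Ty\<close> and \<open>X\<close> in \<open>P^[A]\<close>, where \<open>[A]\<close> is the fibre of
  \<open>ty_of\<close> over \<open>A\<close>.\<close>

abbreviation fam_psh ::
  "('o, 'm, 'u, 'd) natural_model \<Rightarrow> ('o, 'm, 'x) presheaf
    \<Rightarrow> ('o, 'm, 'u \<times> ('m \<times> 'd \<Rightarrow> 'x)) presheaf" where
  "fam_psh M P \<equiv> poly_psh (ctx M) (Tm M) (Ty M) (ty_of M) P"

text \<open>
  The presheaf of quadruples \<open>(A, B, a, b)\<close> with \<open>a\<close> in \<open>[A]\<close> and \<open>b\<close> in \<open>[B(a)]\<close>. Over \<open>\<Gamma>\<close>, the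
  type \<open>B(a)\<close> is \<open>B (Id \<Gamma>, a)\<close>.
\<close>

definition pair_psh ::
  "('o, 'm, 'u, 'd) natural_model
    \<Rightarrow> ('o, 'm, ('u \<times> ('m \<times> 'd \<Rightarrow> 'u)) \<times> 'd \<times> 'd) presheaf" where
  "pair_psh M =
     \<lparr>sect = (\<lambda>\<Gamma>. {((A, B), a, b). (A, B) \<in> sect (fam_psh M (Ty M)) \<Gamma> \<and>
                a \<in> sect (Tm M) \<Gamma> \<and> ty_of M \<Gamma> a = A \<and>
                b \<in> sect (Tm M) \<Gamma> \<and> ty_of M \<Gamma> b = B (Id (ctx M) \<Gamma>, a)}),
      restr = (\<lambda>\<sigma> (AB, a, b). (restr (fam_psh M (Ty M)) \<sigma> AB, restr (Tm M) \<sigma> a, restr (Tm M) \<sigma> b))\<rparr>"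

definition admits_sum_types :: "('o, 'm, 'u, 'd) natural_model \<Rightarrow> bool" where
  "admits_sum_types M \<longleftrightarrow>
     (\<exists>Sig pair. is_pullback (ctx M) (pair_psh M) (fam_psh M (Ty M)) (Tm M) (Ty M)
        pair (\<lambda>\<Gamma>. fst) (ty_of M) Sig)"

text \<open>The map from pairs \<open>(A, t)\<close> to pairs \<open>(A, B)\<close> given by composing \<open>t\<close> with \<open>ty_of\<close>.\<close>

definition fam_ty_of ::
  "('o, 'm, 'u, 'd) natural_model \<Rightarrow> 'o \<Rightarrow> 'u \<times> ('m \<times> 'd \<Rightarrow> 'd) \<Rightarrow> 'u \<times> ('m \<times> 'd \<Rightarrow> 'u)" where
  "fam_ty_of M = (\<lambda>\<Gamma> (A, t).
     (A, restrict (\<lambda>(\<sigma>, a). ty_of M (Dom (ctx M) \<sigma>) (t (\<sigma>, a)))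
           (fibre (ctx M) (Tm M) (Ty M) (ty_of M) \<Gamma> A)))"

definition admits_product_types :: "('o, 'm, 'u, 'd) natural_model \<Rightarrow> bool" where
  "admits_product_types M \<longleftrightarrow>
     (\<exists>Pi lam. is_pullback (ctx M) (fam_psh M (Tm M)) (fam_psh M (Ty M)) (Tm M) (Ty M)
        lam (fam_ty_of M) (ty_of M) Pi)"


section \<open>Basic properties\<close>

lemma category_simps:
  assumes "is_category C"
  shows "f \<in> Arr C \<Longrightarrow> Dom C f \<in> Obj C" "f \<in> Arr C \<Longrightarrow> Cod C f \<in> Obj C"
    "X \<in> Obj C \<Longrightarrow> Id C X \<in> Arr C" "X \<in> Obj C \<Longrightarrow> Dom C (Id C X) = X"
    "X \<in> Obj C \<Longrightarrow> Cod C (Id C X) = X"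
    "f \<in> Arr C \<Longrightarrow> g \<in> Arr C \<Longrightarrow> Dom C g = Cod C f \<Longrightarrow> Comp C g f \<in> Arr C"
    "f \<in> Arr C \<Longrightarrow> g \<in> Arr C \<Longrightarrow> Dom C g = Cod C f \<Longrightarrow> Dom C (Comp C g f) = Dom C f"
    "f \<in> Arr C \<Longrightarrow> g \<in> Arr C \<Longrightarrow> Dom C g = Cod C f \<Longrightarrow> Cod C (Comp C g f) = Cod C g"
    "f \<in> Arr C \<Longrightarrow> Dom C f = X \<Longrightarrow> Comp C f (Id C X) = f"
    "f \<in> Arr C \<Longrightarrow> Cod C f = X \<Longrightarrow> Comp C (Id C X) f = f"
    "f \<in> Arr C \<Longrightarrow> g \<in> Arr C \<Longrightarrow> h \<in> Arr C \<Longrightarrow> Dom C g = Cod C f \<Longrightarrow> Dom C h = Cod C g \<Longrightarrow>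
        Comp C (Comp C h g) f = Comp C h (Comp C g f)"
  using assms unfolding is_category_def hom_def by auto

lemma presheaf_simps:
  assumes "is_presheaf C P"
  shows "f \<in> Arr C \<Longrightarrow> Cod C f = X \<Longrightarrow> x \<in> sect P X \<Longrightarrow> restr P f x \<in> sect P (Dom C f)"
    "X \<in> Obj C \<Longrightarrow> x \<in> sect P X \<Longrightarrow> restr P (Id C X) x = x"
    "f \<in> Arr C \<Longrightarrow> g \<in> Arr C \<Longrightarrow> Dom C g = Cod C f \<Longrightarrow> Cod C g = X \<Longrightarrow> x \<in> sect P X \<Longrightarrow>
       restr P (Comp C g f) x = restr P f (restr P g x)"
  using assms unfolding is_presheaf_def by auto

lemma nat_trans_simps:
  assumes "nat_trans C P Q \<alpha>"
  shows "X \<in> Obj C \<Longrightarrow> x \<in> sect P X \<Longrightarrow> \<alpha> X x \<in> sect Q X"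
    "f \<in> Arr C \<Longrightarrow> Cod C f = X \<Longrightarrow> x \<in> sect P X \<Longrightarrow> Dom C f = Y \<Longrightarrow>
       \<alpha> Y (restr P f x) = restr Q f (\<alpha> X x)"
  using assms unfolding nat_trans_def by auto

lemma is_presheaf_terminal: "is_presheaf C terminal_psh"
  by (simp add: is_presheaf_def terminal_psh_def)

lemma is_presheaf_prod:
  "is_presheaf C P \<Longrightarrow> is_presheaf C Q \<Longrightarrow> is_presheaf C (prod_psh P Q)"
  by (auto simp: is_presheaf_def prod_psh_def)

lemma is_presheaf_pb:
  assumes C: "is_category C" and P: "is_presheaf C P" "is_presheaf C Q"
    and f: "nat_trans C P R f" and g: "nat_trans C Q R g"
  shows "is_presheaf C (pb_psh P Q f g)"
  unfolding is_presheaf_def pb_psh_def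
  by (auto simp: category_simps[OF C] presheaf_simps[OF P(1)] presheaf_simps[OF P(2)]
      nat_trans_simps[OF f] nat_trans_simps[OF g])

lemma is_presheaf_yo: "is_category C \<Longrightarrow> is_presheaf C (yo C X)"
  unfolding is_presheaf_def yo_def hom_def by (auto simp: category_simps)

lemma nat_trans_yo_elem:
  assumes "is_presheaf C P" "x \<in> sect P X"
  shows "nat_trans C (yo C X) P (yo_elem P x)"
  using assms unfolding nat_trans_def yo_def yo_elem_def hom_def
  by (auto simp: presheaf_simps)

lemma nat_isoI:
  assumes C: "is_category C" and P: "is_presheaf C P" and \<alpha>: "nat_trans C P Q \<alpha>"
    and bij: "\<And>X. X \<in> Obj C \<Longrightarrow> bij_betw (\<alpha> X) (sect P X) (sect Q X)"
  shows "nat_iso C P Q \<alpha>"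
proof -
  define \<beta> where "\<beta> X = inv_into (sect P X) (\<alpha> X)" for X
  have 1: "\<beta> X (\<alpha> X x) = x" if "X \<in> Obj C" "x \<in> sect P X" for X x
    unfolding \<beta>_def using bij[OF that(1)] that(2) by (rule bij_betw_inv_into_left)
  have 2: "\<alpha> X (\<beta> X y) = y" "\<beta> X y \<in> sect P X" if "X \<in> Obj C" "y \<in> sect Q X" for X y
    unfolding \<beta>_def using bij[OF that(1)] that(2)
    by (auto simp: bij_betw_def intro: f_inv_into_f inv_into_into)
  have "\<beta> (Dom C f) (restr Q f y) = restr P f (\<beta> (Cod C f) y)"
    if f: "f \<in> Arr C" and y: "y \<in> sect Q (Cod C f)" for f y
  proof -
    have "\<alpha> (Dom C f) (restr P f (\<beta> (Cod C f) y)) = restr Q f y"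
      using f y 2 by (simp add: nat_trans_simps[OF \<alpha>] category_simps[OF C])
    then show ?thesis
      using 1[of "Dom C f" "restr P f (\<beta> (Cod C f) y)"] f y 2(2)
      by (simp add: category_simps[OF C] presheaf_simps[OF P])
  qed
  then have "nat_trans C Q P \<beta>" unfolding nat_trans_def using 2 by auto
  then show ?thesis unfolding nat_iso_def using \<alpha> 1 2 by blast
qed

lemma is_pullback_universal:
  assumes C: "is_category C" and pb: "is_pullback C W P Q R t l r b"
    and u: "nat_trans C T P u" and v: "nat_trans C T Q v"
    and eq: "\<And>X x. X \<in> Obj C \<Longrightarrow> x \<in> sect T X \<Longrightarrow> b X (u X x) = r X (v X x)"
  obtains h where "nat_trans C T W h"
    and "\<And>X x. X \<in> Obj C \<Longrightarrow> x \<in> sect T X \<Longrightarrow> l X (h X x) = u X x \<and> t X (h X x) = v X x"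
    and "\<And>h' X x. nat_trans C T W h' \<Longrightarrow>
        (\<And>Y y. Y \<in> Obj C \<Longrightarrow> y \<in> sect T Y \<Longrightarrow> l Y (h' Y y) = u Y y \<and> t Y (h' Y y) = v Y y) \<Longrightarrow>
        X \<in> Obj C \<Longrightarrow> x \<in> sect T X \<Longrightarrow> h' X x = h X x"
proof -
  from pb obtain \<beta> where \<beta>: "nat_trans C (pb_psh P Q b r) W \<beta>"
    "\<And>X w. X \<in> Obj C \<Longrightarrow> w \<in> sect W X \<Longrightarrow> \<beta> X (l X w, t X w) = w"
    "\<And>X y. X \<in> Obj C \<Longrightarrow> y \<in> sect (pb_psh P Q b r) X \<Longrightarrow> (l X (\<beta> X y), t X (\<beta> X y)) = y"
    unfolding is_pullback_def nat_iso_def by blast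
  have uv: "(u X x, v X x) \<in> sect (pb_psh P Q b r) X" if "X \<in> Obj C" "x \<in> sect T X" for X x
    using that u v eq by (simp add: pb_psh_def nat_trans_simps)
  define h where "h X x = \<beta> X (u X x, v X x)" for X x
  have "h (Dom C f) (restr T f x) = restr W f (h (Cod C f) x)"
    if "f \<in> Arr C" "x \<in> sect T (Cod C f)" for f x
  proof -
    have "restr (pb_psh P Q b r) f (u (Cod C f) x, v (Cod C f) x)
        = (u (Dom C f) (restr T f x), v (Dom C f) (restr T f x))"
      using that by (simp add: pb_psh_def nat_trans_simps[OF u] nat_trans_simps[OF v])
    then show ?thesis
      unfolding h_def using that uv nat_trans_simps(2)[OF \<beta>(1), of f]
      by (metis category_simps(2)[OF C])
  qed
  then have "nat_trans C T W h"
    unfolding nat_trans_def using uv \<beta>(1) by (auto simp: h_def nat_trans_simps)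
  moreover have "l X (h X x) = u X x \<and> t X (h X x) = v X x" if "X \<in> Obj C" "x \<in> sect T X" for X x
    using \<beta>(3)[OF that(1) uv[OF that]] by (simp add: h_def)
  moreover have "h' X x = h X x"
    if "nat_trans C T W h'"
      "\<And>Y y. Y \<in> Obj C \<Longrightarrow> y \<in> sect T Y \<Longrightarrow> l Y (h' Y y) = u Y y \<and> t Y (h' Y y) = v Y y"
      "X \<in> Obj C" "x \<in> sect T X" for h' X x
    using \<beta>(2)[of X "h' X x"] that by (simp add: h_def nat_trans_simps)
  ultimately show ?thesis by (rule that)
qed

lemma is_pullback_if_universal:
  fixes C :: "('o, 'm) category"
  assumes C: "is_category C" and psh: "is_presheaf C W" "is_presheaf C P" "is_presheaf C Q"
    and nt: "nat_trans C W Q t" "nat_trans C W P l" "nat_trans C Q R r" "nat_trans C P R b"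
    and comm: "\<And>X w. X \<in> Obj C \<Longrightarrow> w \<in> sect W X \<Longrightarrow> b X (l X w) = r X (t X w)"
    and ex: "\<And>(T :: ('o, 'm, 'm) presheaf) u v.
        is_presheaf C T \<Longrightarrow> nat_trans C T P u \<Longrightarrow> nat_trans C T Q v \<Longrightarrow>
        (\<And>X x. X \<in> Obj C \<Longrightarrow> x \<in> sect T X \<Longrightarrow> b X (u X x) = r X (v X x)) \<Longrightarrow>
        \<exists>h. nat_trans C T W h \<and>
          (\<forall>X \<in> Obj C. \<forall>x \<in> sect T X. l X (h X x) = u X x \<and> t X (h X x) = v X x)"
    and uniq: "\<And>(T :: ('o, 'm, 'm) presheaf) h h'.
        is_presheaf C T \<Longrightarrow> nat_trans C T W h \<Longrightarrow> nat_trans C T W h' \<Longrightarrow>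
        (\<And>X x. X \<in> Obj C \<Longrightarrow> x \<in> sect T X \<Longrightarrow>
           l X (h X x) = l X (h' X x) \<and> t X (h X x) = t X (h' X x)) \<Longrightarrow>
        (\<forall>X \<in> Obj C. \<forall>x \<in> sect T X. h X x = h' X x)"
  shows "is_pullback C W P Q R t l r b"
proof -
  let ?c = "\<lambda>X w. (l X w, t X w)"
  have nc: "nat_trans C W (pb_psh P Q b r) ?c"
    using nt comm unfolding nat_trans_def pb_psh_def by auto
  have "bij_betw (?c X) (sect W X) (sect (pb_psh P Q b r) X)" if X: "X \<in> Obj C" for X
    unfolding bij_betw_def
  proof
    have idX: "Id C X \<in> sect (yo C X) X"
      using X C by (simp add: yo_def hom_def category_simps)
    show "inj_on (?c X) (sect W X)"
    proof (rule inj_onI)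
      fix w w' assume w: "w \<in> sect W X" "w' \<in> sect W X" "?c X w = ?c X w'"
      have "\<forall>Y \<in> Obj C. \<forall>g \<in> sect (yo C X) Y. yo_elem W w Y g = yo_elem W w' Y g"
      proof (rule uniq)
        fix Y g assume "Y \<in> Obj C" "g \<in> sect (yo C X) Y"
        then have g: "g \<in> Arr C" "Cod C g = X" "Dom C g = Y" by (auto simp: yo_def hom_def)
        show "l Y (yo_elem W w Y g) = l Y (yo_elem W w' Y g) \<and>
              t Y (yo_elem W w Y g) = t Y (yo_elem W w' Y g)"
          using w g by (simp add: yo_elem_def nat_trans_simps[OF nt(1)] nat_trans_simps[OF nt(2)])
      qed (use C psh w in \<open>auto intro: is_presheaf_yo nat_trans_yo_elem\<close>)
      then show "w = w'"
        using X idX w presheaf_simps(2)[OF psh(1) X] by (metis yo_elem_def)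
    qed
    show "?c X ` sect W X = sect (pb_psh P Q b r) X"
    proof (intro equalityI subsetI)
      fix z assume "z \<in> ?c X ` sect W X"
      then show "z \<in> sect (pb_psh P Q b r) X" using nat_trans_simps(1)[OF nc X] by auto
    next
      fix z assume "z \<in> sect (pb_psh P Q b r) X"
      then obtain x y where z: "z = (x, y)" "x \<in> sect P X" "y \<in> sect Q X" "b X x = r X y"
        by (auto simp: pb_psh_def)
      have "\<exists>h. nat_trans C (yo C X) W h \<and> (\<forall>Y \<in> Obj C. \<forall>g \<in> sect (yo C X) Y.
              l Y (h Y g) = yo_elem P x Y g \<and> t Y (h Y g) = yo_elem Q y Y g)"
      proof (rule ex)
        fix Y g assume "Y \<in> Obj C" "g \<in> sect (yo C X) Y"
        then have g: "g \<in> Arr C" "Cod C g = X" "Dom C g = Y" by (auto simp: yo_def hom_def)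
        show "b Y (yo_elem P x Y g) = r Y (yo_elem Q y Y g)"
          using z g by (simp add: yo_elem_def nat_trans_simps[OF nt(3)] nat_trans_simps[OF nt(4)])
      qed (use C psh z in \<open>auto intro: is_presheaf_yo nat_trans_yo_elem\<close>)
      then obtain h where h: "nat_trans C (yo C X) W h"
        "l X (h X (Id C X)) = yo_elem P x X (Id C X)" "t X (h X (Id C X)) = yo_elem Q y X (Id C X)"
        using X idX by blast
      have "?c X (h X (Id C X)) = z"
        using h z X by (simp add: yo_elem_def presheaf_simps[OF psh(2)] presheaf_simps[OF psh(3)])
      moreover have "h X (Id C X) \<in> sect W X" using nat_trans_simps(1)[OF h(1) X idX] .
      ultimately show "z \<in> ?c X ` sect W X" by blast
    qed
  qed
  then show ?thesis
    unfolding is_pullback_def using nt comm nat_isoI[OF C psh(1) nc] by blast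
qed

locale psh_map =
  fixes C :: "('o, 'm) category" and B :: "('o, 'm, 'b) presheaf" and A :: "('o, 'm, 'a) presheaf"
    and f :: "'o \<Rightarrow> 'b \<Rightarrow> 'a"
  assumes C: "is_category C" and B: "is_presheaf C B" and A: "is_presheaf C A"
    and f: "nat_trans C B A f"
begin

lemmas simps = category_simps[OF C] presheaf_simps[OF B] presheaf_simps[OF A] nat_trans_simps[OF f]

lemma fibreD:
  assumes "(\<sigma>, b) \<in> fibre C B A f \<Gamma> a"
  shows "\<sigma> \<in> Arr C" "Cod C \<sigma> = \<Gamma>" "b \<in> sect B (Dom C \<sigma>)" "f (Dom C \<sigma>) b = restr A \<sigma> a"
  using assms by (auto simp: fibre_def)

lemma fibreI:
  "\<sigma> \<in> Arr C \<Longrightarrow> Cod C \<sigma> = \<Gamma> \<Longrightarrow> b \<in> sect B (Dom C \<sigma>) \<Longrightarrow> f (Dom C \<sigma>) b = restr A \<sigma> a \<Longrightarrow>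
   (\<sigma>, b) \<in> fibre C B A f \<Gamma> a"
  by (auto simp: fibre_def)

lemma fibre_restr:
  assumes "(\<sigma>, b) \<in> fibre C B A f \<Gamma> a" "\<tau> \<in> Arr C" "Cod C \<tau> = Dom C \<sigma>" "a \<in> sect A \<Gamma>"
  shows "(Comp C \<sigma> \<tau>, restr B \<tau> b) \<in> fibre C B A f \<Gamma> a"
  using assms fibreD[OF assms(1)] by (intro fibreI) (auto simp: simps)

lemma fibre_reindex:
  assumes "\<tau> \<in> Arr C" "Cod C \<tau> = \<Gamma>" "a \<in> sect A \<Gamma>"
    "(\<sigma>, b) \<in> fibre C B A f (Dom C \<tau>) (restr A \<tau> a)"
  shows "(Comp C \<tau> \<sigma>, b) \<in> fibre C B A f \<Gamma> a"
  using assms fibreD[OF assms(4)] by (intro fibreI) (auto simp: simps)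

lemma fibre_id:
  assumes "\<Gamma> \<in> Obj C" "a \<in> sect A \<Gamma>"
  shows "(Id C \<Gamma>, b) \<in> fibre C B A f \<Gamma> a \<longleftrightarrow> b \<in> sect B \<Gamma> \<and> f \<Gamma> b = a"
  using assms by (auto simp: fibre_def simps)

lemma fibre_mapsD:
  assumes "\<phi> \<in> fibre_maps C B A f X \<Gamma> a" "(\<sigma>, b) \<in> fibre C B A f \<Gamma> a"
  shows "\<phi> (\<sigma>, b) \<in> sect X (Dom C \<sigma>)"
    "\<tau> \<in> Arr C \<Longrightarrow> Cod C \<tau> = Dom C \<sigma> \<Longrightarrow>
       \<phi> (Comp C \<sigma> \<tau>, restr B \<tau> b) = restr X \<tau> (\<phi> (\<sigma>, b))"
  using assms by (auto simp: fibre_maps_def)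

lemma fibre_maps_ext:
  assumes "\<phi> \<in> fibre_maps C B A f X \<Gamma> a"
  shows "\<phi> \<in> extensional (fibre C B A f \<Gamma> a)"
  using assms by (auto simp: fibre_maps_def)

lemma fibre_mapsI:
  assumes "\<phi> \<in> extensional (fibre C B A f \<Gamma> a)"
    "\<And>\<sigma> b. (\<sigma>, b) \<in> fibre C B A f \<Gamma> a \<Longrightarrow> \<phi> (\<sigma>, b) \<in> sect X (Dom C \<sigma>)"
    "\<And>\<sigma> b \<tau>. (\<sigma>, b) \<in> fibre C B A f \<Gamma> a \<Longrightarrow> \<tau> \<in> Arr C \<Longrightarrow> Cod C \<tau> = Dom C \<sigma> \<Longrightarrow>
       \<phi> (Comp C \<sigma> \<tau>, restr B \<tau> b) = restr X \<tau> (\<phi> (\<sigma>, b))"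
  shows "\<phi> \<in> fibre_maps C B A f X \<Gamma> a"
  using assms by (auto simp: fibre_maps_def)

lemma fibre_maps_eqI:
  assumes "\<phi> \<in> extensional (fibre C B A f \<Gamma> a)" "\<psi> \<in> extensional (fibre C B A f \<Gamma> a)"
    "\<And>\<sigma> b. (\<sigma>, b) \<in> fibre C B A f \<Gamma> a \<Longrightarrow> \<phi> (\<sigma>, b) = \<psi> (\<sigma>, b)"
  shows "\<phi> = \<psi>"
  by (rule extensionalityI[OF assms(1,2)]) (use assms(3) in auto)

lemma fibre_map_restr_ext:
  "fibre_map_restr C B A f \<tau> a \<phi> \<in> extensional (fibre C B A f (Dom C \<tau>) (restr A \<tau> a))"
  by (simp add: fibre_map_restr_def)

lemma fibre_map_restr_apply:
  "(\<sigma>, b) \<in> fibre C B A f (Dom C \<tau>) (restr A \<tau> a) \<Longrightarrow>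
    fibre_map_restr C B A f \<tau> a \<phi> (\<sigma>, b) = \<phi> (Comp C \<tau> \<sigma>, b)"
  by (simp add: fibre_map_restr_def)

lemma fibre_map_restr_closed:
  assumes "\<tau> \<in> Arr C" "Cod C \<tau> = \<Gamma>" "a \<in> sect A \<Gamma>" "\<phi> \<in> fibre_maps C B A f X \<Gamma> a"
  shows "fibre_map_restr C B A f \<tau> a \<phi> \<in> fibre_maps C B A f X (Dom C \<tau>) (restr A \<tau> a)"
proof (rule fibre_mapsI[OF fibre_map_restr_ext])
  fix \<sigma> b assume sb: "(\<sigma>, b) \<in> fibre C B A f (Dom C \<tau>) (restr A \<tau> a)"
  note s = fibreD[OF sb] and r = fibre_reindex[OF assms(1-3) sb]
  show "fibre_map_restr C B A f \<tau> a \<phi> (\<sigma>, b) \<in> sect X (Dom C \<sigma>)"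
    using fibre_mapsD(1)[OF assms(4) r] assms s sb by (simp add: fibre_map_restr_apply simps)
  fix \<rho> assume rho: "\<rho> \<in> Arr C" "Cod C \<rho> = Dom C \<sigma>"
  have "restr A \<tau> a \<in> sect A (Dom C \<tau>)" using assms by (simp add: simps)
  from fibre_restr[OF sb rho this]
  show "fibre_map_restr C B A f \<tau> a \<phi> (Comp C \<sigma> \<rho>, restr B \<rho> b)
      = restr X \<rho> (fibre_map_restr C B A f \<tau> a \<phi> (\<sigma>, b))"
    using fibre_mapsD(2)[OF assms(4) r, of \<rho>] assms s sb rho
    by (simp add: fibre_map_restr_apply simps)
qed

lemma fibre_map_restr_id:
  assumes "\<Gamma> \<in> Obj C" "a \<in> sect A \<Gamma>" "\<phi> \<in> fibre_maps C B A f X \<Gamma> a"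
  shows "fibre_map_restr C B A f (Id C \<Gamma>) a \<phi> = \<phi>"
proof -
  have eq: "fibre C B A f (Dom C (Id C \<Gamma>)) (restr A (Id C \<Gamma>) a) = fibre C B A f \<Gamma> a"
    using assms by (simp add: simps)
  show ?thesis
  proof (rule fibre_maps_eqI)
    show "fibre_map_restr C B A f (Id C \<Gamma>) a \<phi> \<in> extensional (fibre C B A f \<Gamma> a)"
      using fibre_map_restr_ext[of "Id C \<Gamma>" a] by (simp only: eq)
    show "\<phi> \<in> extensional (fibre C B A f \<Gamma> a)" using assms by (simp add: fibre_maps_ext)
    fix \<sigma> b assume sb: "(\<sigma>, b) \<in> fibre C B A f \<Gamma> a"
    then show "fibre_map_restr C B A f (Id C \<Gamma>) a \<phi> (\<sigma>, b) = \<phi> (\<sigma>, b)"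
      using fibreD[OF sb] by (simp add: fibre_map_restr_apply eq simps)
  qed
qed

lemma fibre_map_restr_comp:
  assumes "\<rho> \<in> Arr C" "\<tau> \<in> Arr C" "Dom C \<tau> = Cod C \<rho>" "Cod C \<tau> = \<Gamma>" "a \<in> sect A \<Gamma>"
    "\<phi> \<in> fibre_maps C B A f X \<Gamma> a"
  shows "fibre_map_restr C B A f (Comp C \<tau> \<rho>) a \<phi>
    = fibre_map_restr C B A f \<rho> (restr A \<tau> a) (fibre_map_restr C B A f \<tau> a \<phi>)"
proof -
  have eq: "fibre C B A f (Dom C (Comp C \<tau> \<rho>)) (restr A (Comp C \<tau> \<rho>) a)
      = fibre C B A f (Dom C \<rho>) (restr A \<rho> (restr A \<tau> a))"
    using assms by (simp add: simps)
  show ?thesis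
  proof (rule fibre_maps_eqI[OF _ fibre_map_restr_ext])
    show "fibre_map_restr C B A f (Comp C \<tau> \<rho>) a \<phi>
        \<in> extensional (fibre C B A f (Dom C \<rho>) (restr A \<rho> (restr A \<tau> a)))"
      using fibre_map_restr_ext[of "Comp C \<tau> \<rho>" a] by (simp only: eq)
    fix \<sigma> b assume sb: "(\<sigma>, b) \<in> fibre C B A f (Dom C \<rho>) (restr A \<rho> (restr A \<tau> a))"
    have "(Comp C \<rho> \<sigma>, b) \<in> fibre C B A f (Dom C \<tau>) (restr A \<tau> a)"
      using assms presheaf_simps(1)[OF A assms(2,4,5)]
      by (intro fibre_reindex[OF assms(1) _ _ sb]) simp_all
    then show "fibre_map_restr C B A f (Comp C \<tau> \<rho>) a \<phi> (\<sigma>, b)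
       = fibre_map_restr C B A f \<rho> (restr A \<tau> a) (fibre_map_restr C B A f \<tau> a \<phi>) (\<sigma>, b)"
      using assms sb fibreD[OF sb] by (simp add: fibre_map_restr_apply eq simps)
  qed
qed

lemma is_presheaf_poly: "is_presheaf C (poly_psh C B A f X)"
  unfolding is_presheaf_def poly_psh_def
  by (auto simp: simps fibre_map_restr_closed fibre_map_restr_id fibre_map_restr_comp)

lemma fibre_homD:
  assumes "(a, a', \<phi>) \<in> sect (fibre_hom_psh C B A f) \<Gamma>"
  shows "a \<in> sect A \<Gamma>" "a' \<in> sect A \<Gamma>" "\<phi> \<in> fibre_maps C B A f B \<Gamma> a"
    "(\<sigma>, b) \<in> fibre C B A f \<Gamma> a \<Longrightarrow> f (Dom C \<sigma>) (\<phi> (\<sigma>, b)) = restr A \<sigma> a'"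
    "(\<sigma>, b) \<in> fibre C B A f \<Gamma> a \<Longrightarrow> (\<sigma>, \<phi> (\<sigma>, b)) \<in> fibre C B A f \<Gamma> a'"
  using assms unfolding fibre_hom_psh_def by (auto simp: fibre_def fibre_maps_def)

lemma is_presheaf_fibre_hom: "is_presheaf C (fibre_hom_psh C B A f)"
proof -
  have *: "restr A (Comp C \<tau> \<sigma>) a' = restr A \<sigma> (restr A \<tau> a')"
    if "\<tau> \<in> Arr C" "a' \<in> sect A (Cod C \<tau>)" "(\<sigma>, b) \<in> fibre C B A f (Dom C \<tau>) z" for \<tau> a' \<sigma> b z
    using that fibreD[OF that(3)] by (simp add: simps)
  have "restr (fibre_hom_psh C B A f) \<tau> x \<in> sect (fibre_hom_psh C B A f) (Dom C \<tau>)"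
    if t: "\<tau> \<in> Arr C" and x: "x \<in> sect (fibre_hom_psh C B A f) (Cod C \<tau>)" for \<tau> x
  proof -
    obtain a a' \<phi> where x: "x = (a, a', \<phi>)" by (cases x)
    note x' = fibre_homD[OF that(2)[unfolded x]]
    have "f (Dom C \<sigma>) (fibre_map_restr C B A f \<tau> a \<phi> (\<sigma>, b)) = restr A \<sigma> (restr A \<tau> a')"
      if sb: "(\<sigma>, b) \<in> fibre C B A f (Dom C \<tau>) (restr A \<tau> a)" for \<sigma> b
      using x'(4)[OF fibre_reindex[OF t refl x'(1) sb]] fibreD[OF sb] t x' sb
      by (simp add: fibre_map_restr_apply simps)
    then show ?thesis using t x x'(1-3) by (auto simp: fibre_hom_psh_def simps fibre_map_restr_closed)
  qed
  then show ?thesis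
    unfolding is_presheaf_def
    by (auto simp: fibre_hom_psh_def simps fibre_map_restr_id fibre_map_restr_comp)
qed

lemma fibre_homI:
  assumes "a \<in> sect A \<Gamma>" "a' \<in> sect A \<Gamma>" "\<phi> \<in> extensional (fibre C B A f \<Gamma> a)"
    "\<And>\<sigma> b. (\<sigma>, b) \<in> fibre C B A f \<Gamma> a \<Longrightarrow> (\<sigma>, \<phi> (\<sigma>, b)) \<in> fibre C B A f \<Gamma> a'"
    "\<And>\<sigma> b \<tau>. (\<sigma>, b) \<in> fibre C B A f \<Gamma> a \<Longrightarrow> \<tau> \<in> Arr C \<Longrightarrow> Cod C \<tau> = Dom C \<sigma> \<Longrightarrow>
       \<phi> (Comp C \<sigma> \<tau>, restr B \<tau> b) = restr B \<tau> (\<phi> (\<sigma>, b))"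
  shows "(a, a', \<phi>) \<in> sect (fibre_hom_psh C B A f) \<Gamma>"
proof -
  have "\<phi> \<in> fibre_maps C B A f B \<Gamma> a"
    using fibreD(3)[OF assms(4)] assms(5) by (intro fibre_mapsI[OF assms(3)])
  then show ?thesis
    unfolding fibre_hom_psh_def using assms(1,2) fibreD(4)[OF assms(4)] by auto
qed

text \<open>Maps \<open>Y \<rightarrow> poly_psh C B A f X\<close> over \<open>u : Y \<rightarrow> A\<close> correspond to maps \<open>Y \<times>\<^sub>A B \<rightarrow> X\<close>.\<close>

lemma poly_universal:
  assumes Y: "is_presheaf C Y" and u: "nat_trans C Y A u" and k: "nat_trans C (pb_psh Y B u f) X k"
  obtains h where "nat_trans C Y (poly_psh C B A f X) h"
    and "\<And>\<Gamma> y. \<Gamma> \<in> Obj C \<Longrightarrow> y \<in> sect Y \<Gamma> \<Longrightarrow> fst (h \<Gamma> y) = u \<Gamma> y"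
    and "\<And>\<Gamma> y b. \<Gamma> \<in> Obj C \<Longrightarrow> (y, b) \<in> sect (pb_psh Y B u f) \<Gamma> \<Longrightarrow>
           snd (h \<Gamma> y) (Id C \<Gamma>, b) = k \<Gamma> (y, b)"
    and "\<And>h' \<Gamma> y. nat_trans C Y (poly_psh C B A f X) h' \<Longrightarrow>
           (\<And>\<Gamma> y. \<Gamma> \<in> Obj C \<Longrightarrow> y \<in> sect Y \<Gamma> \<Longrightarrow> fst (h' \<Gamma> y) = u \<Gamma> y) \<Longrightarrow>
           (\<And>\<Gamma> y b. \<Gamma> \<in> Obj C \<Longrightarrow> (y, b) \<in> sect (pb_psh Y B u f) \<Gamma> \<Longrightarrow>
              snd (h' \<Gamma> y) (Id C \<Gamma>, b) = k \<Gamma> (y, b)) \<Longrightarrow>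
           \<Gamma> \<in> Obj C \<Longrightarrow> y \<in> sect Y \<Gamma> \<Longrightarrow> h' \<Gamma> y = h \<Gamma> y"
proof -
  let ?F = "fibre C B A f"
  note ysimps = simps presheaf_simps[OF Y] nat_trans_simps[OF u]
  define h where
    "h \<Gamma> y = (u \<Gamma> y, restrict (\<lambda>(\<sigma>, b). k (Dom C \<sigma>) (restr Y \<sigma> y, b)) (?F \<Gamma> (u \<Gamma> y)))" for \<Gamma> y
  have pb: "(restr Y \<sigma> y, b) \<in> sect (pb_psh Y B u f) (Dom C \<sigma>)"
    if "y \<in> sect Y \<Gamma>" "(\<sigma>, b) \<in> ?F \<Gamma> (u \<Gamma> y)" for \<Gamma> y \<sigma> b
    using that(1) fibreD[OF that(2)] by (auto simp: pb_psh_def ysimps)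
  have h_fm: "snd (h \<Gamma> y) \<in> fibre_maps C B A f X \<Gamma> (u \<Gamma> y)"
    if "\<Gamma> \<in> Obj C" "y \<in> sect Y \<Gamma>" for \<Gamma> y
  proof (rule fibre_mapsI)
    fix \<sigma> b assume sb: "(\<sigma>, b) \<in> ?F \<Gamma> (u \<Gamma> y)"
    note s = fibreD[OF sb]
    show "snd (h \<Gamma> y) (\<sigma>, b) \<in> sect X (Dom C \<sigma>)"
      using nat_trans_simps(1)[OF k _ pb[OF that(2) sb]] sb s by (simp add: h_def simps)
    fix \<tau> assume t: "\<tau> \<in> Arr C" "Cod C \<tau> = Dom C \<sigma>"
    have "(Comp C \<sigma> \<tau>, restr B \<tau> b) \<in> ?F \<Gamma> (u \<Gamma> y)"
      using that by (intro fibre_restr[OF sb t]) (simp add: ysimps)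
    then show "snd (h \<Gamma> y) (Comp C \<sigma> \<tau>, restr B \<tau> b) = restr X \<tau> (snd (h \<Gamma> y) (\<sigma>, b))"
      using nat_trans_simps(2)[OF k t pb[OF that(2) sb] refl] sb s t that
      by (simp add: h_def ysimps pb_psh_def)
  qed (simp add: h_def)
  have h_nat: "h (Dom C \<tau>) (restr Y \<tau> y) = restr (poly_psh C B A f X) \<tau> (h (Cod C \<tau>) y)"
    if t: "\<tau> \<in> Arr C" and y: "y \<in> sect Y (Cod C \<tau>)" for \<tau> y
  proof -
    have u': "u (Dom C \<tau>) (restr Y \<tau> y) = restr A \<tau> (u (Cod C \<tau>) y)" using t y by (simp add: ysimps)
    have uy: "u (Cod C \<tau>) y \<in> sect A (Cod C \<tau>)" using t y by (simp add: ysimps)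
    have "snd (h (Dom C \<tau>) (restr Y \<tau> y))
        = fibre_map_restr C B A f \<tau> (u (Cod C \<tau>) y) (snd (h (Cod C \<tau>) y))"
    proof (rule fibre_maps_eqI[OF _ fibre_map_restr_ext])
      fix \<sigma> b assume sb: "(\<sigma>, b) \<in> ?F (Dom C \<tau>) (restr A \<tau> (u (Cod C \<tau>) y))"
      show "snd (h (Dom C \<tau>) (restr Y \<tau> y)) (\<sigma>, b)
          = fibre_map_restr C B A f \<tau> (u (Cod C \<tau>) y) (snd (h (Cod C \<tau>) y)) (\<sigma>, b)"
        using fibre_reindex[OF t refl uy sb] sb fibreD[OF sb] t y
        by (simp add: fibre_map_restr_apply h_def u' ysimps)
    qed (simp add: h_def u')
    then show ?thesis using u' by (simp add: poly_psh_def h_def)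
  qed
  have h: "nat_trans C Y (poly_psh C B A f X) h"
    unfolding nat_trans_def
  proof (intro conjI ballI)
    fix \<Gamma> y assume y: "\<Gamma> \<in> Obj C" "y \<in> sect Y \<Gamma>"
    show "h \<Gamma> y \<in> sect (poly_psh C B A f X) \<Gamma>"
      using h_fm[OF y] y by (simp add: poly_psh_def h_def ysimps)
  qed (rule h_nat)
  have hk: "snd (h \<Gamma> y) (Id C \<Gamma>, b) = k \<Gamma> (y, b)"
    if "\<Gamma> \<in> Obj C" "(y, b) \<in> sect (pb_psh Y B u f) \<Gamma>" for \<Gamma> y b
    using that by (auto simp: pb_psh_def h_def fibre_id ysimps)
  have uniq: "h' \<Gamma> y = h \<Gamma> y"
    if h': "nat_trans C Y (poly_psh C B A f X) h'"
      and fst': "\<And>\<Gamma> y. \<Gamma> \<in> Obj C \<Longrightarrow> y \<in> sect Y \<Gamma> \<Longrightarrow> fst (h' \<Gamma> y) = u \<Gamma> y"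
      and ev': "\<And>\<Gamma> y b. \<Gamma> \<in> Obj C \<Longrightarrow> (y, b) \<in> sect (pb_psh Y B u f) \<Gamma> \<Longrightarrow>
              snd (h' \<Gamma> y) (Id C \<Gamma>, b) = k \<Gamma> (y, b)"
      and y: "\<Gamma> \<in> Obj C" "y \<in> sect Y \<Gamma>" for h' \<Gamma> y
  proof (rule prod_eqI)
    have uy: "u \<Gamma> y \<in> sect A \<Gamma>" using y by (simp add: ysimps)
    show "fst (h' \<Gamma> y) = fst (h \<Gamma> y)" using y by (simp add: fst' h_def)
    obtain \<phi> where hy: "h' \<Gamma> y = (u \<Gamma> y, \<phi>)" using fst'[OF y] by (metis prod.collapse)
    have \<phi>: "\<phi> \<in> fibre_maps C B A f X \<Gamma> (u \<Gamma> y)"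
      using nat_trans_simps(1)[OF h' y] by (auto simp: hy poly_psh_def)
    have "\<phi> = snd (h \<Gamma> y)"
    proof (rule fibre_maps_eqI[OF fibre_maps_ext[OF \<phi>] fibre_maps_ext[OF h_fm[OF y]]])
      fix \<sigma> b assume sb: "(\<sigma>, b) \<in> ?F \<Gamma> (u \<Gamma> y)"
      note s = fibreD[OF sb]
      have ra: "restr A \<sigma> (u \<Gamma> y) \<in> sect A (Dom C \<sigma>)" using s uy by (simp add: simps)
      have "h' (Dom C \<sigma>) (restr Y \<sigma> y)
          = (restr A \<sigma> (u \<Gamma> y), fibre_map_restr C B A f \<sigma> (u \<Gamma> y) \<phi>)"
        using nat_trans_simps(2)[OF h' s(1,2) y(2) refl] by (simp add: hy poly_psh_def)
      moreover have "snd (h' (Dom C \<sigma>) (restr Y \<sigma> y)) (Id C (Dom C \<sigma>), b)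
          = k (Dom C \<sigma>) (restr Y \<sigma> y, b)"
        using ev'[OF _ pb[OF y(2) sb]] s by (simp add: simps)
      moreover have "(Id C (Dom C \<sigma>), b) \<in> ?F (Dom C \<sigma>) (restr A \<sigma> (u \<Gamma> y))"
        using s ra by (simp add: fibre_id simps)
      ultimately have "\<phi> (Comp C \<sigma> (Id C (Dom C \<sigma>)), b) = k (Dom C \<sigma>) (restr Y \<sigma> y, b)"
        by (simp add: fibre_map_restr_apply)
      then show "\<phi> (\<sigma>, b) = snd (h \<Gamma> y) (\<sigma>, b)" using s sb by (simp add: h_def simps)
    qed
    then show "snd (h' \<Gamma> y) = snd (h \<Gamma> y)" by (simp add: hy)
  qed
  have "fst (h \<Gamma> y) = u \<Gamma> y" for \<Gamma> y by (simp add: h_def)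
  from that[OF h this hk] show ?thesis using uniq by blast
qed

text \<open>
  Maps \<open>Y \<rightarrow> fibre_hom_psh C B A f\<close> over \<open>(u, v) : Y \<rightarrow> A \<times> A\<close> correspond to maps
  \<open>Y \<times>\<^sub>A B \<rightarrow> B\<close> over \<open>v : Y \<rightarrow> A\<close>, the pullback being taken along \<open>u\<close>.
\<close>

lemma fibre_hom_universal:
  assumes Y: "is_presheaf C Y" and u: "nat_trans C Y A u" and v: "nat_trans C Y A v"
    and k: "nat_trans C (pb_psh Y B u f) B k"
    and kv: "\<And>\<Gamma> y b. \<Gamma> \<in> Obj C \<Longrightarrow> (y, b) \<in> sect (pb_psh Y B u f) \<Gamma> \<Longrightarrow> f \<Gamma> (k \<Gamma> (y, b)) = v \<Gamma> y"
  obtains h where "nat_trans C Y (fibre_hom_psh C B A f) h"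
    and "\<And>\<Gamma> y. \<Gamma> \<in> Obj C \<Longrightarrow> y \<in> sect Y \<Gamma> \<Longrightarrow> fst (h \<Gamma> y) = u \<Gamma> y \<and> fst (snd (h \<Gamma> y)) = v \<Gamma> y"
    and "\<And>\<Gamma> y b. \<Gamma> \<in> Obj C \<Longrightarrow> (y, b) \<in> sect (pb_psh Y B u f) \<Gamma> \<Longrightarrow>
           snd (snd (h \<Gamma> y)) (Id C \<Gamma>, b) = k \<Gamma> (y, b)"
    and "\<And>h' \<Gamma> y. nat_trans C Y (fibre_hom_psh C B A f) h' \<Longrightarrow>
           (\<And>\<Gamma> y. \<Gamma> \<in> Obj C \<Longrightarrow> y \<in> sect Y \<Gamma> \<Longrightarrow> fst (h' \<Gamma> y) = u \<Gamma> y \<and> fst (snd (h' \<Gamma> y)) = v \<Gamma> y) \<Longrightarrow>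
           (\<And>\<Gamma> y b. \<Gamma> \<in> Obj C \<Longrightarrow> (y, b) \<in> sect (pb_psh Y B u f) \<Gamma> \<Longrightarrow>
              snd (snd (h' \<Gamma> y)) (Id C \<Gamma>, b) = k \<Gamma> (y, b)) \<Longrightarrow>
           \<Gamma> \<in> Obj C \<Longrightarrow> y \<in> sect Y \<Gamma> \<Longrightarrow> h' \<Gamma> y = h \<Gamma> y"
proof -
  note ysimps = simps presheaf_simps[OF Y] nat_trans_simps[OF u] nat_trans_simps[OF v]
  obtain g where g: "nat_trans C Y (poly_psh C B A f B) g"
    "\<And>\<Gamma> y. \<Gamma> \<in> Obj C \<Longrightarrow> y \<in> sect Y \<Gamma> \<Longrightarrow> fst (g \<Gamma> y) = u \<Gamma> y"
    "\<And>\<Gamma> y b. \<Gamma> \<in> Obj C \<Longrightarrow> (y, b) \<in> sect (pb_psh Y B u f) \<Gamma> \<Longrightarrow>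
           snd (g \<Gamma> y) (Id C \<Gamma>, b) = k \<Gamma> (y, b)"
    "\<And>h' \<Gamma> y. nat_trans C Y (poly_psh C B A f B) h' \<Longrightarrow>
           (\<And>\<Gamma> y. \<Gamma> \<in> Obj C \<Longrightarrow> y \<in> sect Y \<Gamma> \<Longrightarrow> fst (h' \<Gamma> y) = u \<Gamma> y) \<Longrightarrow>
           (\<And>\<Gamma> y b. \<Gamma> \<in> Obj C \<Longrightarrow> (y, b) \<in> sect (pb_psh Y B u f) \<Gamma> \<Longrightarrow>
              snd (h' \<Gamma> y) (Id C \<Gamma>, b) = k \<Gamma> (y, b)) \<Longrightarrow>
           \<Gamma> \<in> Obj C \<Longrightarrow> y \<in> sect Y \<Gamma> \<Longrightarrow> h' \<Gamma> y = g \<Gamma> y"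
  proof (rule poly_universal[OF Y u k], goal_cases)
    case (1 h)
    from 1(1)[OF 1(2-4)] show ?case using 1(5) by blast
  qed
  define h where "h \<Gamma> y = (u \<Gamma> y, v \<Gamma> y, snd (g \<Gamma> y))" for \<Gamma> y
  have gy: "g \<Gamma> y = (u \<Gamma> y, snd (g \<Gamma> y))" if "\<Gamma> \<in> Obj C" "y \<in> sect Y \<Gamma>" for \<Gamma> y
    using g(2)[OF that] by (metis prod.collapse)
  have fm: "snd (g \<Gamma> y) \<in> fibre_maps C B A f B \<Gamma> (u \<Gamma> y)" if "\<Gamma> \<in> Obj C" "y \<in> sect Y \<Gamma>" for \<Gamma> y
    using nat_trans_simps(1)[OF g(1) that] g(2)[OF that] by (auto simp: poly_psh_def)
  have g_nat: "snd (g (Dom C \<tau>) (restr Y \<tau> y))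
      = fibre_map_restr C B A f \<tau> (u (Cod C \<tau>) y) (snd (g (Cod C \<tau>) y))"
    if "\<tau> \<in> Arr C" "y \<in> sect Y (Cod C \<tau>)" for \<tau> y
  proof -
    have "snd (g (Dom C \<tau>) (restr Y \<tau> y)) = snd (restr (poly_psh C B A f B) \<tau> (g (Cod C \<tau>) y))"
      using nat_trans_simps(2)[OF g(1) that(1) refl that(2) refl] by simp
    also have "g (Cod C \<tau>) y = (u (Cod C \<tau>) y, snd (g (Cod C \<tau>) y))"
      using that by (intro gy) (simp_all add: simps)
    finally show ?thesis by (simp add: poly_psh_def)
  qed
  have over: "f (Dom C \<sigma>) (snd (g \<Gamma> y) (\<sigma>, b)) = restr A \<sigma> (v \<Gamma> y)"
    if y: "\<Gamma> \<in> Obj C" "y \<in> sect Y \<Gamma>" and sb: "(\<sigma>, b) \<in> fibre C B A f \<Gamma> (u \<Gamma> y)" for \<Gamma> y \<sigma> b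
  proof -
    note s = fibreD[OF sb]
    have pb: "(restr Y \<sigma> y, b) \<in> sect (pb_psh Y B u f) (Dom C \<sigma>)"
      using y s by (auto simp: pb_psh_def ysimps)
    have mem: "(Id C (Dom C \<sigma>), b) \<in> fibre C B A f (Dom C \<sigma>) (restr A \<sigma> (u \<Gamma> y))"
      using s y by (simp add: fibre_id ysimps)
    have "snd (g \<Gamma> y) (\<sigma>, b) = snd (g (Dom C \<sigma>) (restr Y \<sigma> y)) (Id C (Dom C \<sigma>), b)"
      using g_nat[OF s(1)] s y mem by (simp add: fibre_map_restr_apply simps)
    also have "\<dots> = k (Dom C \<sigma>) (restr Y \<sigma> y, b)" using g(3)[OF _ pb] s by (simp add: simps)
    finally show ?thesis using kv[OF _ pb] s y by (simp add: ysimps)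
  qed
  have h: "nat_trans C Y (fibre_hom_psh C B A f) h"
    unfolding nat_trans_def
  proof (intro conjI ballI)
    fix \<Gamma> y assume y: "\<Gamma> \<in> Obj C" "y \<in> sect Y \<Gamma>"
    show "h \<Gamma> y \<in> sect (fibre_hom_psh C B A f) \<Gamma>"
      using y fm over by (auto simp: fibre_hom_psh_def h_def ysimps)
  next
    fix \<tau> y assume "\<tau> \<in> Arr C" "y \<in> sect Y (Cod C \<tau>)"
    then show "h (Dom C \<tau>) (restr Y \<tau> y) = restr (fibre_hom_psh C B A f) \<tau> (h (Cod C \<tau>) y)"
      using g_nat by (simp add: fibre_hom_psh_def h_def ysimps)
  qed
  have uniq: "h' \<Gamma> y = h \<Gamma> y"
    if h': "nat_trans C Y (fibre_hom_psh C B A f) h'"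
      and fst': "\<And>\<Gamma> y. \<Gamma> \<in> Obj C \<Longrightarrow> y \<in> sect Y \<Gamma> \<Longrightarrow>
             fst (h' \<Gamma> y) = u \<Gamma> y \<and> fst (snd (h' \<Gamma> y)) = v \<Gamma> y"
      and ev': "\<And>\<Gamma> y b. \<Gamma> \<in> Obj C \<Longrightarrow> (y, b) \<in> sect (pb_psh Y B u f) \<Gamma> \<Longrightarrow>
              snd (snd (h' \<Gamma> y)) (Id C \<Gamma>, b) = k \<Gamma> (y, b)"
      and y: "\<Gamma> \<in> Obj C" "y \<in> sect Y \<Gamma>" for h' \<Gamma> y
  proof -
    have "nat_trans C Y (poly_psh C B A f B) (\<lambda>\<Gamma> y. (fst (h' \<Gamma> y), snd (snd (h' \<Gamma> y))))"
      unfolding nat_trans_def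
    proof (intro conjI ballI)
      fix \<Gamma> y assume "\<Gamma> \<in> Obj C" "y \<in> sect Y \<Gamma>"
      then have "h' \<Gamma> y \<in> sect (fibre_hom_psh C B A f) \<Gamma>" by (rule nat_trans_simps(1)[OF h'])
      then show "(fst (h' \<Gamma> y), snd (snd (h' \<Gamma> y))) \<in> sect (poly_psh C B A f B) \<Gamma>"
        by (auto simp: fibre_hom_psh_def poly_psh_def)
    next
      fix \<tau> y assume "\<tau> \<in> Arr C" "y \<in> sect Y (Cod C \<tau>)"
      then have "h' (Dom C \<tau>) (restr Y \<tau> y) = restr (fibre_hom_psh C B A f) \<tau> (h' (Cod C \<tau>) y)"
        using nat_trans_simps(2)[OF h'] by blast
      then show "(fst (h' (Dom C \<tau>) (restr Y \<tau> y)), snd (snd (h' (Dom C \<tau>) (restr Y \<tau> y))))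
          = restr (poly_psh C B A f B) \<tau> (fst (h' (Cod C \<tau>) y), snd (snd (h' (Cod C \<tau>) y)))"
        by (simp add: fibre_hom_psh_def poly_psh_def split_beta)
    qed
    then have "(fst (h' \<Gamma> y), snd (snd (h' \<Gamma> y))) = g \<Gamma> y"
      by (rule g(4)) (use fst' ev' y in auto)
    then show ?thesis using fst'[OF y] by (auto simp: h_def prod_eq_iff)
  qed
  have h_fst: "fst (h \<Gamma> y) = u \<Gamma> y \<and> fst (snd (h \<Gamma> y)) = v \<Gamma> y" for \<Gamma> y by (simp add: h_def)
  have h_ev: "snd (snd (h \<Gamma> y)) (Id C \<Gamma>, b) = k \<Gamma> (y, b)"
    if "\<Gamma> \<in> Obj C" "(y, b) \<in> sect (pb_psh Y B u f) \<Gamma>" for \<Gamma> y b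
    using g(3)[OF that] by (simp add: h_def)
  from that[OF h h_fst h_ev] show ?thesis using uniq by blast
qed

lemma internal_category_full_internal_subcategory:
  "internal_category C (full_internal_subcategory C B A f)"
  (is "internal_category C ?S")
proof -
  let ?H = "fibre_hom_psh C B A f" and ?F = "fibre C B A f"
  have S: "iob ?S = A" "imor ?S = ?H"
    "\<And>\<Gamma> a a' \<phi>. idom ?S \<Gamma> (a, a', \<phi>) = a" "\<And>\<Gamma> a a' \<phi>. icod ?S \<Gamma> (a, a', \<phi>) = a'"
    "\<And>\<Gamma> a. iid ?S \<Gamma> a = (a, a, restrict (\<lambda>(\<sigma>, b). b) (?F \<Gamma> a))"
    "\<And>\<Gamma> a' a'' \<psi> a x \<phi>. icomp ?S \<Gamma> ((a', a'', \<psi>), (a, x, \<phi>))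
       = (a, a'', restrict (\<lambda>(\<sigma>, b). \<psi> (\<sigma>, \<phi> (\<sigma>, b))) (?F \<Gamma> a))"
    by (simp_all add: full_internal_subcategory_def)
  have Hrestr: "restr ?H \<tau> (a, a', \<phi>) = (restr A \<tau> a, restr A \<tau> a', fibre_map_restr C B A f \<tau> a \<phi>)"
    for \<tau> a a' \<phi> by (simp add: fibre_hom_psh_def)
  have comp: "sect (composable ?S) \<Gamma> =
      {((a', a'', \<psi>), (a, a', \<phi>)) |a a' a'' \<phi> \<psi>.
         (a', a'', \<psi>) \<in> sect ?H \<Gamma> \<and> (a, a', \<phi>) \<in> sect ?H \<Gamma>}" for \<Gamma>
    by (auto simp: composable_def pb_psh_def S)
  have comp_restr: "restr (composable ?S) \<tau> (x, y) = (restr ?H \<tau> x, restr ?H \<tau> y)" for \<tau> x y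
    by (simp add: composable_def pb_psh_def S)
  have id_in: "iid ?S \<Gamma> a \<in> sect ?H \<Gamma>" if "\<Gamma> \<in> Obj C" "a \<in> sect A \<Gamma>" for \<Gamma> a
    unfolding S using that by (intro fibre_homI) (auto simp: fibre_restr)
  have comp_in: "icomp ?S \<Gamma> ((a', a'', \<psi>), (a, a', \<phi>)) \<in> sect ?H \<Gamma>"
    if p: "(a', a'', \<psi>) \<in> sect ?H \<Gamma>" and q: "(a, a', \<phi>) \<in> sect ?H \<Gamma>" for \<Gamma> a a' a'' \<phi> \<psi>
    unfolding S
  proof (rule fibre_homI)
    note p' = fibre_homD[OF p] and q' = fibre_homD[OF q]
    show "a \<in> sect A \<Gamma>" "a'' \<in> sect A \<Gamma>" using p' q' by auto
    fix \<sigma> b assume sb: "(\<sigma>, b) \<in> ?F \<Gamma> a"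
    show "(\<sigma>, restrict (\<lambda>(\<sigma>, b). \<psi> (\<sigma>, \<phi> (\<sigma>, b))) (?F \<Gamma> a) (\<sigma>, b)) \<in> ?F \<Gamma> a''"
      using p'(5) q'(5) sb by simp
    fix \<tau> assume t: "\<tau> \<in> Arr C" "Cod C \<tau> = Dom C \<sigma>"
    show "restrict (\<lambda>(\<sigma>, b). \<psi> (\<sigma>, \<phi> (\<sigma>, b))) (?F \<Gamma> a) (Comp C \<sigma> \<tau>, restr B \<tau> b)
        = restr B \<tau> (restrict (\<lambda>(\<sigma>, b). \<psi> (\<sigma>, \<phi> (\<sigma>, b))) (?F \<Gamma> a) (\<sigma>, b))"
      using fibre_restr[OF sb t q'(1)] sb fibre_mapsD(2)[OF q'(3) sb t]
        fibre_mapsD(2)[OF p'(3) q'(5)[OF sb] t] by simp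
  qed simp
  have "nat_trans C (imor ?S) (iob ?S) (idom ?S)" "nat_trans C (imor ?S) (iob ?S) (icod ?S)"
    unfolding nat_trans_def S(1,2) by (auto simp: S Hrestr dest: fibre_homD)
  moreover have "nat_trans C (iob ?S) (imor ?S) (iid ?S)"
    unfolding nat_trans_def S(1,2)
  proof (intro conjI ballI id_in)
    fix \<tau> a assume t: "\<tau> \<in> Arr C" "a \<in> sect A (Cod C \<tau>)"
    have "restrict (\<lambda>(\<sigma>, b). b) (?F (Dom C \<tau>) (restr A \<tau> a))
        = fibre_map_restr C B A f \<tau> a (restrict (\<lambda>(\<sigma>, b). b) (?F (Cod C \<tau>) a))"
      by (rule fibre_maps_eqI[OF _ fibre_map_restr_ext])
        (use t fibre_reindex[OF t(1) refl t(2)] in \<open>auto simp: fibre_map_restr_apply\<close>)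
    then show "iid ?S (Dom C \<tau>) (restr A \<tau> a) = restr ?H \<tau> (iid ?S (Cod C \<tau>) a)"
      by (simp add: S Hrestr)
  qed
  moreover have "nat_trans C (composable ?S) (imor ?S) (icomp ?S)"
    unfolding nat_trans_def S(2)
  proof (intro conjI ballI)
    fix \<Gamma> x assume "x \<in> sect (composable ?S) \<Gamma>"
    then show "icomp ?S \<Gamma> x \<in> sect ?H \<Gamma>" unfolding comp using comp_in by auto
  next
    fix \<tau> x assume t: "\<tau> \<in> Arr C" and "x \<in> sect (composable ?S) (Cod C \<tau>)"
    then obtain a a' a'' \<phi> \<psi> where x: "x = ((a', a'', \<psi>), (a, a', \<phi>))"
      and p: "(a', a'', \<psi>) \<in> sect ?H (Cod C \<tau>)" and q: "(a, a', \<phi>) \<in> sect ?H (Cod C \<tau>)"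
      unfolding comp by blast
    note p' = fibre_homD[OF p] and q' = fibre_homD[OF q]
    have "restrict (\<lambda>(\<sigma>, b). fibre_map_restr C B A f \<tau> a' \<psi> (\<sigma>, fibre_map_restr C B A f \<tau> a \<phi> (\<sigma>, b)))
            (?F (Dom C \<tau>) (restr A \<tau> a))
        = fibre_map_restr C B A f \<tau> a
            (restrict (\<lambda>(\<sigma>, b). \<psi> (\<sigma>, \<phi> (\<sigma>, b))) (?F (Cod C \<tau>) a))" (is "?l = ?r")
    proof (rule fibre_maps_eqI[OF _ fibre_map_restr_ext])
      fix \<sigma> b assume sb: "(\<sigma>, b) \<in> ?F (Dom C \<tau>) (restr A \<tau> a)"
      note r = fibre_reindex[OF t refl q'(1) sb]
      have "(\<sigma>, \<phi> (Comp C \<tau> \<sigma>, b)) \<in> ?F (Dom C \<tau>) (restr A \<tau> a')"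
        using fibreD[OF q'(5)[OF r]] fibreD[OF sb] t p'(1)
        by (intro fibreI) (simp_all add: simps)
      then show "?l (\<sigma>, b) = ?r (\<sigma>, b)" using sb r by (simp add: fibre_map_restr_apply)
    qed simp
    then show "icomp ?S (Dom C \<tau>) (restr (composable ?S) \<tau> x) = restr ?H \<tau> (icomp ?S (Cod C \<tau>) x)"
      unfolding x comp_restr Hrestr S by simp
  qed
  moreover have "icomp ?S \<Gamma> (x, iid ?S \<Gamma> (idom ?S \<Gamma> x)) = x"
      "icomp ?S \<Gamma> (iid ?S \<Gamma> (icod ?S \<Gamma> x), x) = x" if "x \<in> sect ?H \<Gamma>" for \<Gamma> x
  proof -
    obtain a a' \<phi> where x: "x = (a, a', \<phi>)" by (cases x)
    note p' = fibre_homD[OF that[unfolded x]]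
    show "icomp ?S \<Gamma> (x, iid ?S \<Gamma> (idom ?S \<Gamma> x)) = x"
      unfolding x S using fibre_maps_ext[OF p'(3)]
      by (auto intro!: fibre_maps_eqI[where a = a and \<Gamma> = \<Gamma>])
    show "icomp ?S \<Gamma> (iid ?S \<Gamma> (icod ?S \<Gamma> x), x) = x"
      unfolding x S using fibre_maps_ext[OF p'(3)] p'(5)
      by (auto intro!: fibre_maps_eqI[where a = a and \<Gamma> = \<Gamma>])
  qed
  moreover have "icomp ?S \<Gamma> (z, icomp ?S \<Gamma> (y, x)) = icomp ?S \<Gamma> (icomp ?S \<Gamma> (z, y), x)"
    if zyx: "(z, y) \<in> sect (composable ?S) \<Gamma>" "(y, x) \<in> sect (composable ?S) \<Gamma>" for \<Gamma> x y z
  proof -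
    obtain a a' a'' a''' \<phi> \<psi> \<chi> where xyz: "x = (a, a', \<phi>)" "y = (a', a'', \<psi>)" "z = (a'', a''', \<chi>)"
      and x: "(a, a', \<phi>) \<in> sect ?H \<Gamma>"
      using zyx unfolding comp by auto
    show ?thesis unfolding xyz S using fibre_homD(5)[OF x]
      by (auto intro!: fibre_maps_eqI[where a = a and \<Gamma> = \<Gamma>])
  qed
  ultimately show ?thesis
    unfolding internal_category_def using A is_presheaf_fibre_hom
    by (auto simp: S(1,2)) (auto simp: S comp)
qed

end

lemma internal_category_discrete:
  assumes "is_presheaf C X"
  shows "internal_category C (discrete_icat X)"
  using assms unfolding internal_category_def discrete_icat_def composable_def nat_trans_def
    pb_psh_def by auto

lemma internal_category_prod:
  assumes "internal_category C A" "internal_category C B"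
  shows "internal_category C (prod_icat A B)"
  using assms
  unfolding internal_category_def prod_icat_def composable_def nat_trans_def pb_psh_def prod_psh_def
    is_presheaf_def
  by auto

text \<open>
  In a natural model, the morphisms over \<open>\<Gamma>\<close> from \<open>A\<close> to \<open>B\<close> in the full internal subcategory of
  \<open>ty_of\<close> correspond to the arrows \<open>ext \<Gamma> A \<rightarrow> ext \<Gamma> B\<close> over \<open>\<Gamma>\<close>.
\<close>

lemma ext_universal:
  assumes M: "is_natural_model M" and A: "\<Gamma> \<in> Obj (ctx M)" "A \<in> sect (Ty M) \<Gamma>"
    and sa: "(\<sigma>, a) \<in> fibre (ctx M) (Tm M) (Ty M) (ty_of M) \<Gamma> A"
  shows "\<exists>!h. h \<in> hom (ctx M) (Dom (ctx M) \<sigma>) (ext M \<Gamma> A) \<and>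
    Comp (ctx M) (disp M \<Gamma> A) h = \<sigma> \<and> restr (Tm M) h (gen M \<Gamma> A) = a"
proof -
  let ?C = "ctx M" and ?\<Delta> = "Dom (ctx M) \<sigma>"
  let ?P = "pb_psh (yo ?C \<Gamma>) (Tm M) (yo_elem (Ty M) A) (ty_of M)"
  have C: "is_category ?C" using M by (simp add: is_natural_model_def)
  have s: "\<sigma> \<in> hom ?C ?\<Delta> \<Gamma>" "?\<Delta> \<in> Obj ?C" "a \<in> sect (Tm M) ?\<Delta>"
      "ty_of M ?\<Delta> a = restr (Ty M) \<sigma> A"
    using sa C by (auto simp: fibre_def hom_def category_simps)
  have mem: "(\<sigma>, a) \<in> sect ?P ?\<Delta>" using s by (simp add: pb_psh_def yo_def yo_elem_def)
  have "is_pullback ?C (yo ?C (ext M \<Gamma> A)) (yo ?C \<Gamma>) (Tm M) (Ty M)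
          (yo_elem (Tm M) (gen M \<Gamma> A)) (yo_map ?C (disp M \<Gamma> A)) (ty_of M) (yo_elem (Ty M) A)"
    using M A by (simp add: is_natural_model_def)
  then obtain \<beta> where \<beta>: "nat_trans ?C ?P (yo ?C (ext M \<Gamma> A)) \<beta>"
    "\<forall>X \<in> Obj ?C. (\<forall>h \<in> sect (yo ?C (ext M \<Gamma> A)) X.
        \<beta> X (yo_map ?C (disp M \<Gamma> A) X h, yo_elem (Tm M) (gen M \<Gamma> A) X h) = h) \<and>
      (\<forall>z \<in> sect ?P X. (yo_map ?C (disp M \<Gamma> A) X (\<beta> X z),
        yo_elem (Tm M) (gen M \<Gamma> A) X (\<beta> X z)) = z)"
    unfolding is_pullback_def nat_iso_def by blast
  show ?thesis
  proof (rule ex1I[of _ "\<beta> ?\<Delta> (\<sigma>, a)"])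
    show "\<beta> ?\<Delta> (\<sigma>, a) \<in> hom ?C ?\<Delta> (ext M \<Gamma> A) \<and>
        Comp ?C (disp M \<Gamma> A) (\<beta> ?\<Delta> (\<sigma>, a)) = \<sigma> \<and> restr (Tm M) (\<beta> ?\<Delta> (\<sigma>, a)) (gen M \<Gamma> A) = a"
      using nat_trans_simps(1)[OF \<beta>(1) s(2) mem] \<beta>(2) s(2) mem
      by (auto simp: yo_def yo_map_def yo_elem_def)
  next
    fix h assume "h \<in> hom ?C ?\<Delta> (ext M \<Gamma> A) \<and>
        Comp ?C (disp M \<Gamma> A) h = \<sigma> \<and> restr (Tm M) h (gen M \<Gamma> A) = a"
    then show "h = \<beta> ?\<Delta> (\<sigma>, a)"
      using \<beta>(2) s(2) by (auto simp: yo_def yo_map_def yo_elem_def)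
  qed
qed

lemma fibre_hom_arrows:
  assumes M: "is_natural_model M" and \<Gamma>: "\<Gamma> \<in> Obj (ctx M)"
    and A: "A \<in> sect (Ty M) \<Gamma>" and B: "B \<in> sect (Ty M) \<Gamma>"
  defines "S \<equiv> {\<phi>. (A, B, \<phi>) \<in> sect (fibre_hom_psh (ctx M) (Tm M) (Ty M) (ty_of M)) \<Gamma>}"
    and "H \<equiv> {h \<in> hom (ctx M) (ext M \<Gamma> A) (ext M \<Gamma> B).
               Comp (ctx M) (disp M \<Gamma> B) h = disp M \<Gamma> A}"
  shows "\<phi> \<in> S \<Longrightarrow> \<exists>!h. h \<in> H \<and> restr (Tm M) h (gen M \<Gamma> B) = \<phi> (disp M \<Gamma> A, gen M \<Gamma> A)"
    and "h \<in> H \<Longrightarrow> \<exists>!\<phi>. \<phi> \<in> S \<and> restr (Tm M) h (gen M \<Gamma> B) = \<phi> (disp M \<Gamma> A, gen M \<Gamma> A)"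
proof -
  let ?C = "ctx M" and ?F = "fibre (ctx M) (Tm M) (Ty M) (ty_of M) \<Gamma>"
  interpret pm: psh_map ?C "Tm M" "Ty M" "ty_of M"
    using M by unfold_locales (simp_all add: is_natural_model_def)
  have gen: "(disp M \<Gamma> X, gen M \<Gamma> X) \<in> ?F X" "ext M \<Gamma> X \<in> Obj ?C"
      "disp M \<Gamma> X \<in> Arr ?C" "Dom ?C (disp M \<Gamma> X) = ext M \<Gamma> X" "Cod ?C (disp M \<Gamma> X) = \<Gamma>"
      "gen M \<Gamma> X \<in> sect (Tm M) (ext M \<Gamma> X)"
      "ty_of M (ext M \<Gamma> X) (gen M \<Gamma> X) = restr (Ty M) (disp M \<Gamma> X) X"
    if X: "X \<in> sect (Ty M) \<Gamma>" for X
  proof -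
    have pb: "is_pullback ?C (yo ?C (ext M \<Gamma> X)) (yo ?C \<Gamma>) (Tm M) (Ty M)
          (yo_elem (Tm M) (gen M \<Gamma> X)) (yo_map ?C (disp M \<Gamma> X)) (ty_of M) (yo_elem (Ty M) X)"
      and d: "ext M \<Gamma> X \<in> Obj ?C" "disp M \<Gamma> X \<in> hom ?C (ext M \<Gamma> X) \<Gamma>"
        "gen M \<Gamma> X \<in> sect (Tm M) (ext M \<Gamma> X)"
      using M \<Gamma> X by (simp_all add: is_natural_model_def)
    have i: "Id ?C (ext M \<Gamma> X) \<in> sect (yo ?C (ext M \<Gamma> X)) (ext M \<Gamma> X)"
      using d by (simp add: yo_def hom_def pm.simps)
    have "yo_elem (Ty M) X (ext M \<Gamma> X) (yo_map ?C (disp M \<Gamma> X) (ext M \<Gamma> X) (Id ?C (ext M \<Gamma> X)))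
        = ty_of M (ext M \<Gamma> X) (yo_elem (Tm M) (gen M \<Gamma> X) (ext M \<Gamma> X) (Id ?C (ext M \<Gamma> X)))"
      using pb d(1) i unfolding is_pullback_def by blast
    then show "ty_of M (ext M \<Gamma> X) (gen M \<Gamma> X) = restr (Ty M) (disp M \<Gamma> X) X"
      using d by (simp add: yo_elem_def yo_map_def hom_def pm.simps)
    then show "(disp M \<Gamma> X, gen M \<Gamma> X) \<in> ?F X" "ext M \<Gamma> X \<in> Obj ?C"
      "disp M \<Gamma> X \<in> Arr ?C" "Dom ?C (disp M \<Gamma> X) = ext M \<Gamma> X" "Cod ?C (disp M \<Gamma> X) = \<Gamma>"
      "gen M \<Gamma> X \<in> sect (Tm M) (ext M \<Gamma> X)"
      using d by (auto simp: fibre_def hom_def)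
  qed
  note gA = gen[OF A] and gB = gen[OF B]
  {
    assume "\<phi> \<in> S"
    then have "(disp M \<Gamma> A, \<phi> (disp M \<Gamma> A, gen M \<Gamma> A)) \<in> ?F B"
      unfolding S_def using pm.fibre_homD(5) gA(1) by blast
    from ext_universal[OF M \<Gamma> B this]
    show "\<exists>!h. h \<in> H \<and> restr (Tm M) h (gen M \<Gamma> B) = \<phi> (disp M \<Gamma> A, gen M \<Gamma> A)"
      by (simp add: H_def gA conj_assoc)
  next
    assume h: "h \<in> H"
    then have h: "h \<in> Arr ?C" "Dom ?C h = ext M \<Gamma> A" "Cod ?C h = ext M \<Gamma> B"
      "Comp ?C (disp M \<Gamma> B) h = disp M \<Gamma> A" by (auto simp: H_def hom_def)
    define k where "k = (\<lambda>(\<sigma>, a). THE k. k \<in> hom ?C (Dom ?C \<sigma>) (ext M \<Gamma> A) \<and>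
        Comp ?C (disp M \<Gamma> A) k = \<sigma> \<and> restr (Tm M) k (gen M \<Gamma> A) = a)"
    have k: "k (\<sigma>, a) \<in> Arr ?C" "Dom ?C (k (\<sigma>, a)) = Dom ?C \<sigma>" "Cod ?C (k (\<sigma>, a)) = ext M \<Gamma> A"
        "Comp ?C (disp M \<Gamma> A) (k (\<sigma>, a)) = \<sigma>" "restr (Tm M) (k (\<sigma>, a)) (gen M \<Gamma> A) = a"
      if sa: "(\<sigma>, a) \<in> ?F A" for \<sigma> a
      using theI'[OF ext_universal[OF M \<Gamma> A sa]] by (auto simp: k_def hom_def)
    have k_eq: "k (\<sigma>, a) = g" if "(\<sigma>, a) \<in> ?F A" "g \<in> Arr ?C" "Dom ?C g = Dom ?C \<sigma>"
        "Cod ?C g = ext M \<Gamma> A" "Comp ?C (disp M \<Gamma> A) g = \<sigma>" "restr (Tm M) g (gen M \<Gamma> A) = a"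
      for \<sigma> a g
      unfolding k_def using that
      by (simp, intro the1_equality ext_universal[OF M \<Gamma> A that(1)]) (simp add: hom_def)
    define \<phi> where "\<phi> = restrict (\<lambda>z. restr (Tm M) (k z) (restr (Tm M) h (gen M \<Gamma> B))) (?F A)"
    have "(A, B, \<phi>) \<in> sect (fibre_hom_psh ?C (Tm M) (Ty M) (ty_of M)) \<Gamma>"
    proof (rule pm.fibre_homI[OF A B])
      fix \<sigma> a assume sa: "(\<sigma>, a) \<in> ?F A"
      note s = pm.fibreD[OF sa]
      have hk: "Comp ?C (disp M \<Gamma> B) (Comp ?C h (k (\<sigma>, a))) = \<sigma>"
        using k[OF sa] h gB category_simps(11)[OF pm.C, of "k (\<sigma>, a)" h "disp M \<Gamma> B"] by simp
      have \<phi>: "\<phi> (\<sigma>, a) = restr (Tm M) (Comp ?C h (k (\<sigma>, a))) (gen M \<Gamma> B)"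
        using k[OF sa] h gB sa by (simp add: \<phi>_def pm.simps)
      have c: "Comp ?C h (k (\<sigma>, a)) \<in> Arr ?C" "Dom ?C (Comp ?C h (k (\<sigma>, a))) = Dom ?C \<sigma>"
        "Cod ?C (Comp ?C h (k (\<sigma>, a))) = ext M \<Gamma> B"
        using k[OF sa] h by (simp_all add: pm.simps)
      have cs: "restr (Tm M) (Comp ?C h (k (\<sigma>, a))) (gen M \<Gamma> B) \<in> sect (Tm M) (Dom ?C \<sigma>)"
        using presheaf_simps(1)[OF pm.B c(1,3) gB(6)] c(2) by simp
      have "ty_of M (Dom ?C \<sigma>) (\<phi> (\<sigma>, a))
          = restr (Ty M) (Comp ?C h (k (\<sigma>, a))) (restr (Ty M) (disp M \<Gamma> B) B)"
        unfolding \<phi> using c gB nat_trans_simps(2)[OF pm.f c(1) c(3) gB(6) c(2)] by simp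
      also have "\<dots> = restr (Ty M) \<sigma> B"
        using c gB B presheaf_simps(3)[OF pm.A, of "Comp ?C h (k (\<sigma>, a))" "disp M \<Gamma> B" \<Gamma> B] hk
        by simp
      finally show "(\<sigma>, \<phi> (\<sigma>, a)) \<in> ?F B"
        using s c gB by (intro pm.fibreI) (simp_all add: \<phi> cs)
      fix \<tau> assume t: "\<tau> \<in> Arr ?C" "Cod ?C \<tau> = Dom ?C \<sigma>"
      have st: "(Comp ?C \<sigma> \<tau>, restr (Tm M) \<tau> a) \<in> ?F A" by (rule pm.fibre_restr[OF sa t A])
      have "k (Comp ?C \<sigma> \<tau>, restr (Tm M) \<tau> a) = Comp ?C (k (\<sigma>, a)) \<tau>"
      proof (rule k_eq[OF st])
        show "Comp ?C (disp M \<Gamma> A) (Comp ?C (k (\<sigma>, a)) \<tau>) = Comp ?C \<sigma> \<tau>"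
          using k[OF sa] t gA category_simps(11)[OF pm.C, of \<tau> "k (\<sigma>, a)" "disp M \<Gamma> A"] by simp
      qed (use k[OF sa] t s gA in \<open>simp_all add: pm.simps\<close>)
      then show "\<phi> (Comp ?C \<sigma> \<tau>, restr (Tm M) \<tau> a) = restr (Tm M) \<tau> (\<phi> (\<sigma>, a))"
        using sa st k[OF sa] t h presheaf_simps(1)[OF pm.B h(1,3) gB(6)]
          presheaf_simps(3)[OF pm.B t(1) k(1)[OF sa] _ k(3)[OF sa]] by (simp add: \<phi>_def)
    qed (simp add: \<phi>_def)
    moreover have "k (disp M \<Gamma> A, gen M \<Gamma> A) = Id ?C (ext M \<Gamma> A)"
      using gA by (intro k_eq) (simp_all add: pm.simps)
    then have "restr (Tm M) h (gen M \<Gamma> B) = \<phi> (disp M \<Gamma> A, gen M \<Gamma> A)"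
      using gA h presheaf_simps(1)[OF pm.B h(1,3) gB(6)] presheaf_simps(2)[OF pm.B gA(2)]
      by (simp add: \<phi>_def)
    moreover have "\<psi> = \<phi>" if "\<psi> \<in> S"
      and \<psi>: "restr (Tm M) h (gen M \<Gamma> B) = \<psi> (disp M \<Gamma> A, gen M \<Gamma> A)" for \<psi>
    proof (rule pm.fibre_maps_eqI)
      have p: "\<psi> \<in> fibre_maps ?C (Tm M) (Ty M) (ty_of M) (Tm M) \<Gamma> A"
        using that(1) unfolding S_def using pm.fibre_homD(3) by blast
      then show "\<psi> \<in> extensional (?F A)" by (rule pm.fibre_maps_ext)
      fix \<sigma> a assume sa: "(\<sigma>, a) \<in> ?F A"
      have "\<psi> (\<sigma>, a) = \<psi> (Comp ?C (disp M \<Gamma> A) (k (\<sigma>, a)), restr (Tm M) (k (\<sigma>, a)) (gen M \<Gamma> A))"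
        using k[OF sa] by simp
      also have "\<dots> = restr (Tm M) (k (\<sigma>, a)) (\<psi> (disp M \<Gamma> A, gen M \<Gamma> A))"
        using k[OF sa] gA by (intro pm.fibre_mapsD(2)[OF p gA(1)]) simp_all
      finally show "\<psi> (\<sigma>, a) = \<phi> (\<sigma>, a)" using sa by (simp add: \<phi>_def \<psi>)
    qed (simp add: \<phi>_def)
    ultimately show "\<exists>!\<phi>. \<phi> \<in> S \<and> restr (Tm M) h (gen M \<Gamma> B) = \<phi> (disp M \<Gamma> A, gen M \<Gamma> A)"
      unfolding S_def by blast
  }
qed

end

theory Submission
  imports Defs
begin

text \<open>
  Applied to constant families, dependent sum types exhibit \<open>p \<times> p\<close> as a pullback of \<open>p\<close>, and dependent
  product types exhibit the family of function objects \<open>U\<^sub>1 \<rightarrow> U\<^sub>0 \<times> U\<^sub>0\<close> as a pullback of \<open>p\<close>. So \<open>p\<close> has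
  codes for binary products and exponentials of its fibres. Each of the three right adjoints is
  then given by universal arrows: a natural choice of objects and counits, such that every morphism
  over every context has a unique transpose. Uniqueness makes the transposes natural, so nothing
  about them has to be constructed internally.
\<close>

section \<open>Internal categories and right adjoints\<close>

text \<open>A morphism of the full internal subcategory over \<Gamma> is a natural family of
  functions indexed by all arrows \<sigma> into \<Gamma>, so looking at the stage \<Gamma> alone is
  not enough: equations are tested on pairs \<open>(\<sigma>, x)\<close> with \<open>x\<close> an
  element of the fibre at the stage \<open>Dom C \<sigma>\<close>. Naturality in the stage moves
  such a test to the identity arrow, by restricting along \<sigma>; in this way a formula at the
  identity arrows fixes the whole family. Two obstacles shape the rest. Codes need not be injective,
  so a term of a product or function type can be taken apart only relative to the pair of types that
  is meant; every decoding takes that pair as an argument. Moreover, internal exponentials refer to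
  the arrow part of a product functor that is only known to exist as a right adjoint. Its action on
  pairs has to be recovered from naturality of the projections before exponentials can be
  treated.\<close>

lemma nat_transI:
  assumes "\<And>\<Gamma> x. \<Gamma> \<in> Obj C \<Longrightarrow> x \<in> sect P \<Gamma> \<Longrightarrow> \<alpha> \<Gamma> x \<in> sect Q \<Gamma>"
    "\<And>\<tau> x. \<tau> \<in> Arr C \<Longrightarrow> x \<in> sect P (Cod C \<tau>) \<Longrightarrow>
       \<alpha> (Dom C \<tau>) (restr P \<tau> x) = restr Q \<tau> (\<alpha> (Cod C \<tau>) x)"
  shows "nat_trans C P Q \<alpha>"
  using assms by (simp add: nat_trans_def)

text \<open>Fixing both ends turns composability into matching endpoints of hom sets, so that the
  axioms of an internal category become ordinary rules about typed arrows at one stage.\<close>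

definition ihom :: "('o, 'm, 'a, 'b) icategory \<Rightarrow> 'o \<Rightarrow> 'a \<Rightarrow> 'a \<Rightarrow> 'b set" where
  "ihom A \<Gamma> x y = {m \<in> sect (imor A) \<Gamma>. idom A \<Gamma> m = x \<and> icod A \<Gamma> m = y}"

lemma ihomD:
  assumes "m \<in> ihom A \<Gamma> x y"
  shows "m \<in> sect (imor A) \<Gamma>" "idom A \<Gamma> m = x" "icod A \<Gamma> m = y"
  using assms by (simp_all add: ihom_def)

lemma sect_composable:
  "(g, f) \<in> sect (composable A) \<Gamma> \<longleftrightarrow>
     g \<in> sect (imor A) \<Gamma> \<and> f \<in> sect (imor A) \<Gamma> \<and> idom A \<Gamma> g = icod A \<Gamma> f"
  by (auto simp: composable_def pb_psh_def)

lemma icat_presheaf: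
  assumes "internal_category C A"
  shows "is_presheaf C (iob A)" "is_presheaf C (imor A)"
  using assms by (simp_all add: internal_category_def)

lemma icat_ob:
  assumes "internal_category C A" "\<Gamma> \<in> Obj C" "m \<in> ihom A \<Gamma> x y"
  shows "x \<in> sect (iob A) \<Gamma>" "y \<in> sect (iob A) \<Gamma>"
  using assms by (auto simp: ihom_def internal_category_def nat_trans_def)

lemma iid_ihom:
  assumes "internal_category C A" "\<Gamma> \<in> Obj C" "x \<in> sect (iob A) \<Gamma>"
  shows "iid A \<Gamma> x \<in> ihom A \<Gamma> x x"
  using assms by (auto simp: ihom_def internal_category_def nat_trans_def)

lemma icomp_ihom:
  assumes "internal_category C A" "\<Gamma> \<in> Obj C" "g \<in> ihom A \<Gamma> y z" "f \<in> ihom A \<Gamma> x y"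
  shows "icomp A \<Gamma> (g, f) \<in> ihom A \<Gamma> x z"
proof -
  have "(g, f) \<in> sect (composable A) \<Gamma>" using assms(3,4) by (simp add: sect_composable ihom_def)
  then show ?thesis
    using assms by (auto simp: ihom_def internal_category_def nat_trans_def)
qed

lemma icomp_iid:
  assumes "internal_category C A" "\<Gamma> \<in> Obj C" "m \<in> ihom A \<Gamma> x y"
  shows "icomp A \<Gamma> (m, iid A \<Gamma> x) = m" "icomp A \<Gamma> (iid A \<Gamma> y, m) = m"
  using assms by (auto simp: ihom_def internal_category_def)

lemma icomp_assoc:
  assumes "internal_category C A" "\<Gamma> \<in> Obj C"
    "h \<in> ihom A \<Gamma> z w" "g \<in> ihom A \<Gamma> y z" "f \<in> ihom A \<Gamma> x y"
  shows "icomp A \<Gamma> (icomp A \<Gamma> (h, g), f) = icomp A \<Gamma> (h, icomp A \<Gamma> (g, f))"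
proof -
  have "(h, g) \<in> sect (composable A) \<Gamma>" "(g, f) \<in> sect (composable A) \<Gamma>"
    using assms(3-) by (auto simp: sect_composable ihom_def)
  then have "icomp A \<Gamma> (h, icomp A \<Gamma> (g, f)) = icomp A \<Gamma> (icomp A \<Gamma> (h, g), f)"
    using assms(1,2) unfolding internal_category_def by blast
  then show ?thesis ..
qed

lemma ihom_restr:
  assumes "internal_category C A" "\<tau> \<in> Arr C" "m \<in> ihom A (Cod C \<tau>) x y"
  shows "restr (imor A) \<tau> m \<in> ihom A (Dom C \<tau>) (restr (iob A) \<tau> x) (restr (iob A) \<tau> y)"
  using assms by (auto simp: ihom_def internal_category_def nat_trans_def is_presheaf_def)

lemma iid_restr:
  assumes "internal_category C A" "\<tau> \<in> Arr C" "x \<in> sect (iob A) (Cod C \<tau>)"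
  shows "restr (imor A) \<tau> (iid A (Cod C \<tau>) x) = iid A (Dom C \<tau>) (restr (iob A) \<tau> x)"
  using assms by (auto simp: internal_category_def nat_trans_def)

lemma icomp_restr:
  assumes "internal_category C A" "\<tau> \<in> Arr C"
    "g \<in> ihom A (Cod C \<tau>) y z" "f \<in> ihom A (Cod C \<tau>) x y"
  shows "restr (imor A) \<tau> (icomp A (Cod C \<tau>) (g, f))
    = icomp A (Dom C \<tau>) (restr (imor A) \<tau> g, restr (imor A) \<tau> f)"
proof -
  have "(g, f) \<in> sect (composable A) (Cod C \<tau>)"
    using assms(3,4) by (simp add: sect_composable ihom_def)
  moreover have "restr (composable A) \<tau> (g, f) = (restr (imor A) \<tau> g, restr (imor A) \<tau> f)"
    by (simp add: composable_def pb_psh_def)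
  moreover have "nat_trans C (composable A) (imor A) (icomp A)"
    using assms(1) by (simp add: internal_category_def)
  ultimately show ?thesis using assms(2) unfolding nat_trans_def by metis
qed

section \<open>Internal functors and natural transformations in terms of hom sets\<close>

lemma internal_functorD:
  assumes "internal_functor C A B F"
  shows "internal_category C A" "internal_category C B"
    "nat_trans C (iob A) (iob B) (fob F)" "nat_trans C (imor A) (imor B) (fmor F)"
    "\<Gamma> \<in> Obj C \<Longrightarrow> x \<in> sect (iob A) \<Gamma> \<Longrightarrow> fmor F \<Gamma> (iid A \<Gamma> x) = iid B \<Gamma> (fob F \<Gamma> x)"
    "\<Gamma> \<in> Obj C \<Longrightarrow> m \<in> ihom A \<Gamma> x y \<Longrightarrow> fmor F \<Gamma> m \<in> ihom B \<Gamma> (fob F \<Gamma> x) (fob F \<Gamma> y)"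
    "\<Gamma> \<in> Obj C \<Longrightarrow> n \<in> ihom A \<Gamma> y z \<Longrightarrow> m \<in> ihom A \<Gamma> x y \<Longrightarrow>
       fmor F \<Gamma> (icomp A \<Gamma> (n, m)) = icomp B \<Gamma> (fmor F \<Gamma> n, fmor F \<Gamma> m)"
proof -
  have "\<forall>(n, m) \<in> sect (composable A) \<Gamma>.
      fmor F \<Gamma> (icomp A \<Gamma> (n, m)) = icomp B \<Gamma> (fmor F \<Gamma> n, fmor F \<Gamma> m)" if "\<Gamma> \<in> Obj C"
    using assms that by (simp add: internal_functor_def)
  then show "\<Gamma> \<in> Obj C \<Longrightarrow> n \<in> ihom A \<Gamma> y z \<Longrightarrow> m \<in> ihom A \<Gamma> x y \<Longrightarrow>
       fmor F \<Gamma> (icomp A \<Gamma> (n, m)) = icomp B \<Gamma> (fmor F \<Gamma> n, fmor F \<Gamma> m)"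
    by (force simp: ihom_def sect_composable)
qed (use assms in \<open>auto simp: internal_functor_def ihom_def nat_trans_def\<close>)

lemma internal_functorI:
  assumes "internal_category C A" "internal_category C B"
    "nat_trans C (iob A) (iob B) (fob F)"
    "\<And>\<Gamma> m x y. \<Gamma> \<in> Obj C \<Longrightarrow> m \<in> ihom A \<Gamma> x y \<Longrightarrow> fmor F \<Gamma> m \<in> ihom B \<Gamma> (fob F \<Gamma> x) (fob F \<Gamma> y)"
    "\<And>\<tau> m x y. \<tau> \<in> Arr C \<Longrightarrow> m \<in> ihom A (Cod C \<tau>) x y \<Longrightarrow>
       fmor F (Dom C \<tau>) (restr (imor A) \<tau> m) = restr (imor B) \<tau> (fmor F (Cod C \<tau>) m)"
    "\<And>\<Gamma> x. \<Gamma> \<in> Obj C \<Longrightarrow> x \<in> sect (iob A) \<Gamma> \<Longrightarrow> fmor F \<Gamma> (iid A \<Gamma> x) = iid B \<Gamma> (fob F \<Gamma> x)"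
    "\<And>\<Gamma> n m x y z. \<Gamma> \<in> Obj C \<Longrightarrow> n \<in> ihom A \<Gamma> y z \<Longrightarrow> m \<in> ihom A \<Gamma> x y \<Longrightarrow>
       fmor F \<Gamma> (icomp A \<Gamma> (n, m)) = icomp B \<Gamma> (fmor F \<Gamma> n, fmor F \<Gamma> m)"
  shows "internal_functor C A B F"
  using assms unfolding internal_functor_def
  by (auto simp: ihom_def sect_composable nat_trans_def)

lemma internal_nat_transD:
  assumes "internal_nat_trans C A B F G \<eta>" "\<Gamma> \<in> Obj C" "m \<in> ihom A \<Gamma> x y"
  shows "icomp B \<Gamma> (\<eta> \<Gamma> y, fmor F \<Gamma> m) = icomp B \<Gamma> (fmor G \<Gamma> m, \<eta> \<Gamma> x)"
  using assms by (auto simp: internal_nat_trans_def ihom_def)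

text \<open>The classical construction of a right adjoint from universal arrows, carried out stage
  by stage. Universality is required over every \<Gamma>, while only \<open>g\<close> and the counit
  are assumed natural in the stage; uniqueness of transposes then forces the arrow part of the
  functor, its functoriality, the unit, and stability of all of these under restriction. The
  conclusion retains \<open>g\<close> and \<epsilon>, because later arguments compute with the
  chosen objects and counits.\<close>

lemma internal_right_adjointI:
  assumes C: "is_category C" and F: "internal_functor C A B F"
    and g: "nat_trans C (iob B) (iob A) g" and e: "nat_trans C (iob B) (imor B) \<epsilon>"
    and e_hom: "\<And>\<Gamma> b. \<Gamma> \<in> Obj C \<Longrightarrow> b \<in> sect (iob B) \<Gamma> \<Longrightarrow>
      \<epsilon> \<Gamma> b \<in> ihom B \<Gamma> (fob F \<Gamma> (g \<Gamma> b)) b"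
    and univ: "\<And>\<Gamma> a b h. \<Gamma> \<in> Obj C \<Longrightarrow> a \<in> sect (iob A) \<Gamma> \<Longrightarrow> b \<in> sect (iob B) \<Gamma> \<Longrightarrow>
      h \<in> ihom B \<Gamma> (fob F \<Gamma> a) b \<Longrightarrow>
      \<exists>!k. k \<in> ihom A \<Gamma> a (g \<Gamma> b) \<and> icomp B \<Gamma> (\<epsilon> \<Gamma> b, fmor F \<Gamma> k) = h"
  shows "\<exists>G \<eta>. fob G = g \<and> internal_adjunction C A B F G \<eta> \<epsilon>"
proof -
  note F' = internal_functorD[OF F]
  note A = F'(1) and B = F'(2)
  \<comment> \<open>The transpose of \<open>h\<close>; the description is proper by
    \<open>univ\<close>.\<close>
  define tr where "tr \<Gamma> a b h = (THE k. k \<in> ihom A \<Gamma> a (g \<Gamma> b) \<and> icomp B \<Gamma> (\<epsilon> \<Gamma> b, fmor F \<Gamma> k) = h)"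
    for \<Gamma> a b h
  have tr: "tr \<Gamma> a b h \<in> ihom A \<Gamma> a (g \<Gamma> b)" "icomp B \<Gamma> (\<epsilon> \<Gamma> b, fmor F \<Gamma> (tr \<Gamma> a b h)) = h"
    if "\<Gamma> \<in> Obj C" "a \<in> sect (iob A) \<Gamma>" "b \<in> sect (iob B) \<Gamma>" "h \<in> ihom B \<Gamma> (fob F \<Gamma> a) b" for \<Gamma> a b h
    using theI'[OF univ[OF that]] by (auto simp: tr_def)
  \<comment> \<open>Arrows into an object \<open>g \<Gamma> b\<close> are equal as soon as their
    composites with the counit agree. Every equation between arrows of \<open>A\<close> below is
    reduced to \<open>B\<close> in this way.\<close>
  have cancel: "k = k'"
    if "\<Gamma> \<in> Obj C" "b \<in> sect (iob B) \<Gamma>" "k \<in> ihom A \<Gamma> a (g \<Gamma> b)" "k' \<in> ihom A \<Gamma> a (g \<Gamma> b)"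
      "icomp B \<Gamma> (\<epsilon> \<Gamma> b, fmor F \<Gamma> k) = icomp B \<Gamma> (\<epsilon> \<Gamma> b, fmor F \<Gamma> k')" for \<Gamma> a b k k'
  proof -
    have "icomp B \<Gamma> (\<epsilon> \<Gamma> b, fmor F \<Gamma> k) \<in> ihom B \<Gamma> (fob F \<Gamma> a) b"
      using icomp_ihom[OF B that(1) e_hom F'(6)] that by blast
    from univ[OF that(1) icat_ob(1)[OF A that(1,3)] that(2) this] that show ?thesis by auto
  qed
  have gob: "g \<Gamma> b \<in> sect (iob A) \<Gamma>" if "\<Gamma> \<in> Obj C" "b \<in> sect (iob B) \<Gamma>" for \<Gamma> b
    using nat_trans_simps(1)[OF g that] .
  have fobob: "fob F \<Gamma> a \<in> sect (iob B) \<Gamma>" if "\<Gamma> \<in> Obj C" "a \<in> sect (iob A) \<Gamma>" for \<Gamma> a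
    using nat_trans_simps(1)[OF F'(3) that] .
  \<comment> \<open>Naturality of the counit leaves no choice: \<open>gm \<Gamma> m\<close> must be
    the transpose of \<open>m\<close> composed with the counit at its domain.\<close>
  define gm where "gm \<Gamma> m = tr \<Gamma> (g \<Gamma> (idom B \<Gamma> m)) (icod B \<Gamma> m)
    (icomp B \<Gamma> (m, \<epsilon> \<Gamma> (idom B \<Gamma> m)))" for \<Gamma> m
  have gm: "gm \<Gamma> m \<in> ihom A \<Gamma> (g \<Gamma> x) (g \<Gamma> y)"
      "icomp B \<Gamma> (\<epsilon> \<Gamma> y, fmor F \<Gamma> (gm \<Gamma> m)) = icomp B \<Gamma> (m, \<epsilon> \<Gamma> x)"
    if "\<Gamma> \<in> Obj C" "m \<in> ihom B \<Gamma> x y" for \<Gamma> m x y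
    using tr[OF that(1) gob[OF that(1)] _ icomp_ihom[OF B that(1) that(2) e_hom]] that
      icat_ob[OF B that] by (auto simp: gm_def ihomD[OF that(2)])
  \<comment> \<open>The unit is the transpose of an identity, so its defining equation is already
    the first triangle identity.\<close>
  define \<eta> where "\<eta> \<Gamma> a = tr \<Gamma> a (fob F \<Gamma> a) (iid B \<Gamma> (fob F \<Gamma> a))" for \<Gamma> a
  have \<eta>: "\<eta> \<Gamma> a \<in> ihom A \<Gamma> a (g \<Gamma> (fob F \<Gamma> a))"
      "icomp B \<Gamma> (\<epsilon> \<Gamma> (fob F \<Gamma> a), fmor F \<Gamma> (\<eta> \<Gamma> a)) = iid B \<Gamma> (fob F \<Gamma> a)"
    if "\<Gamma> \<in> Obj C" "a \<in> sect (iob A) \<Gamma>" for \<Gamma> a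
    unfolding \<eta>_def using tr[OF that fobob iid_ihom[OF B]] that fobob by auto
  define G where "G = \<lparr>fob = g, fmor = gm\<rparr>"
  have G: "fob G = g" "fmor G = gm" by (simp_all add: G_def)
  \<comment> \<open>Restriction commutes with forming the composite with the counit. This allows
    \<open>cancel\<close> to compare a restricted transpose with a transpose formed at the smaller
    stage.\<close>
  have push: "restr (imor B) \<tau> (icomp B (Cod C \<tau>) (\<epsilon> (Cod C \<tau>) y, fmor F (Cod C \<tau>) k)) =
      icomp B (Dom C \<tau>) (\<epsilon> (Dom C \<tau>) (restr (iob B) \<tau> y), fmor F (Dom C \<tau>) (restr (imor A) \<tau> k))"
    if t: "\<tau> \<in> Arr C" and y: "y \<in> sect (iob B) (Cod C \<tau>)" and k: "k \<in> ihom A (Cod C \<tau>) x (g (Cod C \<tau>) y)"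
    for \<tau> x y k
    using icomp_restr[OF B t e_hom[OF _ y] F'(6)[OF _ k]] nat_trans_simps(2)[OF e t refl y refl]
      nat_trans_simps(2)[OF F'(4) t refl ihomD(1)[OF k] refl] t by (simp add: category_simps[OF C])
  have gr: "restr (iob A) \<tau> (g (Cod C \<tau>) y) = g (Dom C \<tau>) (restr (iob B) \<tau> y)"
    if t: "\<tau> \<in> Arr C" and y: "y \<in> sect (iob B) (Cod C \<tau>)" for \<tau> y
    using nat_trans_simps(2)[OF g t refl y refl] by simp
  have GF: "internal_functor C B A G"
  proof (rule internal_functorI[OF B A])
    show "nat_trans C (iob B) (iob A) (fob G)" using g by (simp add: G)
  next
    fix \<Gamma> m x y assume "\<Gamma> \<in> Obj C" "m \<in> ihom B \<Gamma> x y"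
    then show "fmor G \<Gamma> m \<in> ihom A \<Gamma> (fob G \<Gamma> x) (fob G \<Gamma> y)" using gm by (simp add: G)
  next
    fix \<tau> m x y assume t: "\<tau> \<in> Arr C" and m: "m \<in> ihom B (Cod C \<tau>) x y"
    have ob: "Dom C \<tau> \<in> Obj C" "Cod C \<tau> \<in> Obj C" using t by (simp_all add: category_simps[OF C])
    note m' = icat_ob[OF B ob(2) m] and rm = ihom_restr[OF B t m] and gm' = gm[OF ob(2) m]
    show "fmor G (Dom C \<tau>) (restr (imor B) \<tau> m) = restr (imor A) \<tau> (fmor G (Cod C \<tau>) m)"
      unfolding G
    proof (rule cancel[OF ob(1)])
      show "restr (iob B) \<tau> y \<in> sect (iob B) (Dom C \<tau>)"
        using icat_ob(2)[OF B ob(1) rm] .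
      show "gm (Dom C \<tau>) (restr (imor B) \<tau> m)
          \<in> ihom A (Dom C \<tau>) (g (Dom C \<tau>) (restr (iob B) \<tau> x)) (g (Dom C \<tau>) (restr (iob B) \<tau> y))"
        using gm(1)[OF ob(1) rm] .
      show "restr (imor A) \<tau> (gm (Cod C \<tau>) m)
          \<in> ihom A (Dom C \<tau>) (g (Dom C \<tau>) (restr (iob B) \<tau> x)) (g (Dom C \<tau>) (restr (iob B) \<tau> y))"
        using ihom_restr[OF A t gm'(1)] gr[OF t m'(1)] gr[OF t m'(2)] by simp
      show "icomp B (Dom C \<tau>) (\<epsilon> (Dom C \<tau>) (restr (iob B) \<tau> y), fmor F (Dom C \<tau>) (gm (Dom C \<tau>) (restr (imor B) \<tau> m)))
        = icomp B (Dom C \<tau>) (\<epsilon> (Dom C \<tau>) (restr (iob B) \<tau> y), fmor F (Dom C \<tau>) (restr (imor A) \<tau> (gm (Cod C \<tau>) m)))"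
        unfolding gm(2)[OF ob(1) rm] push[OF t m'(2) gm'(1), symmetric] gm'(2)
        using icomp_restr[OF B t m e_hom[OF ob(2) m'(1)]] nat_trans_simps(2)[OF e t refl m'(1) refl]
        by simp
    qed
  next
    fix \<Gamma> x assume x: "\<Gamma> \<in> Obj C" "x \<in> sect (iob B) \<Gamma>"
    note i = iid_ihom[OF B x] and gx = gob[OF x]
    show "fmor G \<Gamma> (iid B \<Gamma> x) = iid A \<Gamma> (fob G \<Gamma> x)"
      unfolding G
      by (rule cancel[OF x gm(1)[OF x(1) i] iid_ihom[OF A x(1) gx]])
        (use gm(2)[OF x(1) i] F'(5)[OF x(1) gx] icomp_iid[OF B x(1) e_hom[OF x]] in simp)
  next
    fix \<Gamma> n m x y z assume \<Gamma>: "\<Gamma> \<in> Obj C" and n: "n \<in> ihom B \<Gamma> y z" and m: "m \<in> ihom B \<Gamma> x y"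
    note gn = gm[OF \<Gamma> n] and gm' = gm[OF \<Gamma> m] and nm = icomp_ihom[OF B \<Gamma> n m]
    note x = icat_ob(1)[OF B \<Gamma> m] and y = icat_ob(2)[OF B \<Gamma> m] and z = icat_ob(2)[OF B \<Gamma> n]
    show "fmor G \<Gamma> (icomp B \<Gamma> (n, m)) = icomp A \<Gamma> (fmor G \<Gamma> n, fmor G \<Gamma> m)"
      unfolding G
    \<comment> \<open>After composing with the counit, both sides become \<open>n\<close> after
      \<open>m\<close> after the counit at \<open>x\<close>.\<close>
    proof (rule cancel[OF \<Gamma> z gm(1)[OF \<Gamma> nm] icomp_ihom[OF A \<Gamma> gn(1) gm'(1)]])
      have "icomp B \<Gamma> (\<epsilon> \<Gamma> z, fmor F \<Gamma> (icomp A \<Gamma> (gm \<Gamma> n, gm \<Gamma> m)))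
          = icomp B \<Gamma> (icomp B \<Gamma> (\<epsilon> \<Gamma> z, fmor F \<Gamma> (gm \<Gamma> n)), fmor F \<Gamma> (gm \<Gamma> m))"
        unfolding F'(7)[OF \<Gamma> gn(1) gm'(1)]
        by (rule icomp_assoc[OF B \<Gamma> e_hom[OF \<Gamma> z] F'(6)[OF \<Gamma> gn(1)] F'(6)[OF \<Gamma> gm'(1)], symmetric])
      also have "\<dots> = icomp B \<Gamma> (n, icomp B \<Gamma> (\<epsilon> \<Gamma> y, fmor F \<Gamma> (gm \<Gamma> m)))"
        unfolding gn(2) by (rule icomp_assoc[OF B \<Gamma> n e_hom[OF \<Gamma> y] F'(6)[OF \<Gamma> gm'(1)]])
      also have "\<dots> = icomp B \<Gamma> (icomp B \<Gamma> (n, m), \<epsilon> \<Gamma> x)"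
        unfolding gm'(2) by (rule icomp_assoc[OF B \<Gamma> n m e_hom[OF \<Gamma> x], symmetric])
      finally show "icomp B \<Gamma> (\<epsilon> \<Gamma> z, fmor F \<Gamma> (gm \<Gamma> (icomp B \<Gamma> (n, m))))
          = icomp B \<Gamma> (\<epsilon> \<Gamma> z, fmor F \<Gamma> (icomp A \<Gamma> (gm \<Gamma> n, gm \<Gamma> m)))"
        using gm(2)[OF \<Gamma> nm] by simp
    qed
  qed
  \<comment> \<open>The naturality square is the defining equation of \<open>gm\<close>.\<close>
  have \<epsilon>N: "internal_nat_trans C B B (comp_functor F G) id_functor \<epsilon>"
    unfolding internal_nat_trans_def
  proof (intro conjI ballI e)
    fix \<Gamma> b assume "\<Gamma> \<in> Obj C" "b \<in> sect (iob B) \<Gamma>"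
    from ihomD[OF e_hom[OF this]]
    show "idom B \<Gamma> (\<epsilon> \<Gamma> b) = fob (comp_functor F G) \<Gamma> b" "icod B \<Gamma> (\<epsilon> \<Gamma> b) = fob id_functor \<Gamma> b"
      by (simp_all add: comp_functor_def id_functor_def G)
  next
    fix \<Gamma> m assume "\<Gamma> \<in> Obj C" "m \<in> sect (imor B) \<Gamma>"
    then show "icomp B \<Gamma> (\<epsilon> \<Gamma> (icod B \<Gamma> m), fmor (comp_functor F G) \<Gamma> m)
        = icomp B \<Gamma> (fmor id_functor \<Gamma> m, \<epsilon> \<Gamma> (idom B \<Gamma> m))"
      using gm(2)[of \<Gamma> m "idom B \<Gamma> m" "icod B \<Gamma> m"]
      by (simp add: comp_functor_def id_functor_def G ihom_def)
  qed
  have \<eta>_nat: "nat_trans C (iob A) (imor A) \<eta>"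
    unfolding nat_trans_def
  proof (intro conjI ballI)
    fix \<Gamma> a assume "\<Gamma> \<in> Obj C" "a \<in> sect (iob A) \<Gamma>"
    from ihomD(1)[OF \<eta>(1)[OF this]] show "\<eta> \<Gamma> a \<in> sect (imor A) \<Gamma>" .
  next
    fix \<tau> a assume t: "\<tau> \<in> Arr C" and a: "a \<in> sect (iob A) (Cod C \<tau>)"
    have ob: "Dom C \<tau> \<in> Obj C" "Cod C \<tau> \<in> Obj C" using t by (simp_all add: category_simps[OF C])
    have ra: "restr (iob A) \<tau> a \<in> sect (iob A) (Dom C \<tau>)"
      using presheaf_simps(1)[OF icat_presheaf(1)[OF A] t refl a] .
    have Fa: "fob F (Dom C \<tau>) (restr (iob A) \<tau> a) = restr (iob B) \<tau> (fob F (Cod C \<tau>) a)"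
      using nat_trans_simps(2)[OF F'(3) t refl a refl] .
    note fa = fobob[OF ob(2) a]
    show "\<eta> (Dom C \<tau>) (restr (iob A) \<tau> a) = restr (imor A) \<tau> (\<eta> (Cod C \<tau>) a)"
    proof (rule cancel[OF ob(1) fobob[OF ob(1) ra] \<eta>(1)[OF ob(1) ra]])
      show "restr (imor A) \<tau> (\<eta> (Cod C \<tau>) a) \<in> ihom A (Dom C \<tau>) (restr (iob A) \<tau> a)
          (g (Dom C \<tau>) (fob F (Dom C \<tau>) (restr (iob A) \<tau> a)))"
        using ihom_restr[OF A t \<eta>(1)[OF ob(2) a]] gr[OF t fa] by (simp add: Fa)
      show "icomp B (Dom C \<tau>) (\<epsilon> (Dom C \<tau>) (fob F (Dom C \<tau>) (restr (iob A) \<tau> a)),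
            fmor F (Dom C \<tau>) (\<eta> (Dom C \<tau>) (restr (iob A) \<tau> a)))
        = icomp B (Dom C \<tau>) (\<epsilon> (Dom C \<tau>) (fob F (Dom C \<tau>) (restr (iob A) \<tau> a)),
            fmor F (Dom C \<tau>) (restr (imor A) \<tau> (\<eta> (Cod C \<tau>) a)))"
        unfolding \<eta>(2)[OF ob(1) ra]
        unfolding Fa push[OF t fa \<eta>(1)[OF ob(2) a], symmetric] \<eta>(2)[OF ob(2) a]
          iid_restr[OF B t fa] by (rule refl)
    qed
  qed
  have \<eta>N: "internal_nat_trans C A A id_functor (comp_functor G F) \<eta>"
    unfolding internal_nat_trans_def
  proof (intro conjI ballI \<eta>_nat)
    fix \<Gamma> a assume "\<Gamma> \<in> Obj C" "a \<in> sect (iob A) \<Gamma>"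
    from ihomD[OF \<eta>(1)[OF this]]
    show "idom A \<Gamma> (\<eta> \<Gamma> a) = fob id_functor \<Gamma> a" "icod A \<Gamma> (\<eta> \<Gamma> a) = fob (comp_functor G F) \<Gamma> a"
      by (simp_all add: comp_functor_def id_functor_def G)
  next
    fix \<Gamma> m assume \<Gamma>: "\<Gamma> \<in> Obj C" and "m \<in> sect (imor A) \<Gamma>"
    then obtain x y where m: "m \<in> ihom A \<Gamma> x y" by (auto simp: ihom_def)
    note x = icat_ob(1)[OF A \<Gamma> m] and y = icat_ob(2)[OF A \<Gamma> m]
    note Fm = F'(6)[OF \<Gamma> m] and fx = fobob[OF \<Gamma> x] and fy = fobob[OF \<Gamma> y]
    note \<eta>x = \<eta>[OF \<Gamma> x] and \<eta>y = \<eta>[OF \<Gamma> y] and gFm = gm[OF \<Gamma> Fm]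
    have "icomp A \<Gamma> (\<eta> \<Gamma> y, m) = icomp A \<Gamma> (gm \<Gamma> (fmor F \<Gamma> m), \<eta> \<Gamma> x)"
    \<comment> \<open>Both sides are transposes of \<open>fmor F \<Gamma> m\<close>: on the left the
      triangle identity at \<open>y\<close> removes counit and unit, on the right the one at
      \<open>x\<close> does so once the counit has been moved past
      \<open>fmor F \<Gamma> m\<close>.\<close>
    proof (rule cancel[OF \<Gamma> fy icomp_ihom[OF A \<Gamma> \<eta>y(1) m] icomp_ihom[OF A \<Gamma> gFm(1) \<eta>x(1)]])
      have "icomp B \<Gamma> (\<epsilon> \<Gamma> (fob F \<Gamma> y), fmor F \<Gamma> (icomp A \<Gamma> (\<eta> \<Gamma> y, m)))
          = icomp B \<Gamma> (icomp B \<Gamma> (\<epsilon> \<Gamma> (fob F \<Gamma> y), fmor F \<Gamma> (\<eta> \<Gamma> y)), fmor F \<Gamma> m)"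
        unfolding F'(7)[OF \<Gamma> \<eta>y(1) m]
        by (rule icomp_assoc[OF B \<Gamma> e_hom[OF \<Gamma> fy] F'(6)[OF \<Gamma> \<eta>y(1)] Fm, symmetric])
      also have "\<dots> = icomp B \<Gamma> (fmor F \<Gamma> m, iid B \<Gamma> (fob F \<Gamma> x))"
        unfolding \<eta>y(2) using icomp_iid[OF B \<Gamma> Fm] by simp
      also have "\<dots> = icomp B \<Gamma> (fmor F \<Gamma> m, icomp B \<Gamma> (\<epsilon> \<Gamma> (fob F \<Gamma> x), fmor F \<Gamma> (\<eta> \<Gamma> x)))"
        unfolding \<eta>x(2) ..
      also have "\<dots> = icomp B \<Gamma> (icomp B \<Gamma> (fmor F \<Gamma> m, \<epsilon> \<Gamma> (fob F \<Gamma> x)), fmor F \<Gamma> (\<eta> \<Gamma> x))"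
        by (rule icomp_assoc[OF B \<Gamma> Fm e_hom[OF \<Gamma> fx] F'(6)[OF \<Gamma> \<eta>x(1)], symmetric])
      also have "\<dots> = icomp B \<Gamma> (\<epsilon> \<Gamma> (fob F \<Gamma> y),
          icomp B \<Gamma> (fmor F \<Gamma> (gm \<Gamma> (fmor F \<Gamma> m)), fmor F \<Gamma> (\<eta> \<Gamma> x)))"
        unfolding gFm(2)[symmetric]
        by (rule icomp_assoc[OF B \<Gamma> e_hom[OF \<Gamma> fy] F'(6)[OF \<Gamma> gFm(1)] F'(6)[OF \<Gamma> \<eta>x(1)]])
      finally show "icomp B \<Gamma> (\<epsilon> \<Gamma> (fob F \<Gamma> y), fmor F \<Gamma> (icomp A \<Gamma> (\<eta> \<Gamma> y, m)))
          = icomp B \<Gamma> (\<epsilon> \<Gamma> (fob F \<Gamma> y), fmor F \<Gamma> (icomp A \<Gamma> (gm \<Gamma> (fmor F \<Gamma> m), \<eta> \<Gamma> x)))"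
        unfolding F'(7)[OF \<Gamma> gFm(1) \<eta>x(1)] .
    qed
    then show "icomp A \<Gamma> (\<eta> \<Gamma> (icod A \<Gamma> m), fmor id_functor \<Gamma> m)
        = icomp A \<Gamma> (fmor (comp_functor G F) \<Gamma> m, \<eta> \<Gamma> (idom A \<Gamma> m))"
      by (simp add: comp_functor_def id_functor_def G ihomD[OF m])
  qed
  \<comment> \<open>The second triangle identity: both sides are transposes of
    \<open>\<epsilon> \<Gamma> b\<close>.\<close>
  have tri: "icomp A \<Gamma> (gm \<Gamma> (\<epsilon> \<Gamma> b), \<eta> \<Gamma> (g \<Gamma> b)) = iid A \<Gamma> (g \<Gamma> b)"
    if \<Gamma>: "\<Gamma> \<in> Obj C" and b: "b \<in> sect (iob B) \<Gamma>" for \<Gamma> b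
  proof -
    note eb = e_hom[OF \<Gamma> b] and gb = gob[OF \<Gamma> b]
    note ge = gm[OF \<Gamma> eb] and \<eta>g = \<eta>[OF \<Gamma> gb]
    show ?thesis
    proof (rule cancel[OF \<Gamma> b icomp_ihom[OF A \<Gamma> ge(1) \<eta>g(1)] iid_ihom[OF A \<Gamma> gb]])
      have "icomp B \<Gamma> (\<epsilon> \<Gamma> b, fmor F \<Gamma> (icomp A \<Gamma> (gm \<Gamma> (\<epsilon> \<Gamma> b), \<eta> \<Gamma> (g \<Gamma> b))))
          = icomp B \<Gamma> (icomp B \<Gamma> (\<epsilon> \<Gamma> b, fmor F \<Gamma> (gm \<Gamma> (\<epsilon> \<Gamma> b))), fmor F \<Gamma> (\<eta> \<Gamma> (g \<Gamma> b)))"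
        unfolding F'(7)[OF \<Gamma> ge(1) \<eta>g(1)]
        by (rule icomp_assoc[OF B \<Gamma> eb F'(6)[OF \<Gamma> ge(1)] F'(6)[OF \<Gamma> \<eta>g(1)], symmetric])
      also have "\<dots> = icomp B \<Gamma> (\<epsilon> \<Gamma> b,
          icomp B \<Gamma> (\<epsilon> \<Gamma> (fob F \<Gamma> (g \<Gamma> b)), fmor F \<Gamma> (\<eta> \<Gamma> (g \<Gamma> b))))"
        unfolding ge(2)
        by (rule icomp_assoc[OF B \<Gamma> eb e_hom[OF \<Gamma> fobob[OF \<Gamma> gb]] F'(6)[OF \<Gamma> \<eta>g(1)]])
      finally show "icomp B \<Gamma> (\<epsilon> \<Gamma> b, fmor F \<Gamma> (icomp A \<Gamma> (gm \<Gamma> (\<epsilon> \<Gamma> b), \<eta> \<Gamma> (g \<Gamma> b))))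
          = icomp B \<Gamma> (\<epsilon> \<Gamma> b, fmor F \<Gamma> (iid A \<Gamma> (g \<Gamma> b)))"
        using \<eta>g(2) F'(5)[OF \<Gamma> gb] by simp
    qed
  qed
  have "internal_adjunction C A B F G \<eta> \<epsilon>"
    unfolding internal_adjunction_def using F GF \<eta>N \<epsilon>N \<eta>(2) tri by (simp add: G)
  then show ?thesis using G(1) by blast
qed

section \<open>Product and discrete internal categories, and the functors that need right
  adjoints\<close>

lemma prod_icat_simps:
  "iob (prod_icat A B) = prod_psh (iob A) (iob B)"
  "imor (prod_icat A B) = prod_psh (imor A) (imor B)"
  "iid (prod_icat A B) \<Gamma> (x, y) = (iid A \<Gamma> x, iid B \<Gamma> y)"
  "icomp (prod_icat A B) \<Gamma> ((n, n'), (m, m')) = (icomp A \<Gamma> (n, m), icomp B \<Gamma> (n', m'))"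
  "(m, m') \<in> ihom (prod_icat A B) \<Gamma> (x, x') (y, y') \<longleftrightarrow> m \<in> ihom A \<Gamma> x y \<and> m' \<in> ihom B \<Gamma> x' y'"
  by (auto simp: prod_icat_def ihom_def prod_psh_def)

lemma prod_psh_simps:
  "sect (prod_psh P Q) \<Gamma> = sect P \<Gamma> \<times> sect Q \<Gamma>"
  "restr (prod_psh P Q) \<tau> (x, y) = (restr P \<tau> x, restr Q \<tau> y)"
  by (simp_all add: prod_psh_def)

lemma discrete_icat_simps:
  "iob (discrete_icat X) = X" "imor (discrete_icat X) = X"
  "iid (discrete_icat X) \<Gamma> x = x" "icomp (discrete_icat X) \<Gamma> (n, m) = m"
  "m \<in> ihom (discrete_icat X) \<Gamma> x y \<longleftrightarrow> m \<in> sect X \<Gamma> \<and> x = m \<and> y = m"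
  by (auto simp: discrete_icat_def ihom_def)

lemma internal_functor_bang:
  assumes "internal_category C A"
  shows "internal_functor C A (discrete_icat terminal_psh) bang_functor"
  by (rule internal_functorI[OF assms internal_category_discrete[OF is_presheaf_terminal]])
    (auto simp: bang_functor_def discrete_icat_simps terminal_psh_def nat_trans_def)

lemma internal_functor_diag:
  assumes "internal_category C A"
  shows "internal_functor C A (prod_icat A A) diag_functor"
  by (rule internal_functorI[OF assms internal_category_prod[OF assms assms]])
    (auto simp: diag_functor_def prod_icat_simps prod_psh_simps nat_trans_def)

lemma internal_functor_prod_functor:
  assumes C: "is_category C" and P: "internal_functor C (prod_icat A A) A P"
  shows "internal_functor C (prod_icat (discrete_icat (iob A)) A)
    (prod_icat (discrete_icat (iob A)) A) (prod_functor A P)"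
proof -
  note P' = internal_functorD[OF P]
  note A = P'(2)
  note D = internal_category_prod[OF internal_category_discrete[OF icat_presheaf(1)[OF A]] A]
  note s = prod_icat_simps prod_psh_simps discrete_icat_simps prod_functor_def
  show ?thesis
  proof (rule internal_functorI[OF D D])
    show "nat_trans C (iob (prod_icat (discrete_icat (iob A)) A)) (iob (prod_icat (discrete_icat (iob A)) A))
        (fob (prod_functor A P))"
      using P'(3) by (auto simp: s nat_trans_def)
  next
    fix \<Gamma> m x y assume \<Gamma>: "\<Gamma> \<in> Obj C" and "m \<in> ihom (prod_icat (discrete_icat (iob A)) A) \<Gamma> x y"
    then show "fmor (prod_functor A P) \<Gamma> m
        \<in> ihom (prod_icat (discrete_icat (iob A)) A) \<Gamma> (fob (prod_functor A P) \<Gamma> x) (fob (prod_functor A P) \<Gamma> y)"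
      using iid_ihom[OF A \<Gamma>]
      by (cases m, cases x, cases y) (auto simp: s intro!: P'(6))
  next
    fix \<tau> m x y assume t: "\<tau> \<in> Arr C"
      and "m \<in> ihom (prod_icat (discrete_icat (iob A)) A) (Cod C \<tau>) x y"
    then obtain a n where m: "m = (a, n)" "a \<in> sect (iob A) (Cod C \<tau>)" "n \<in> sect (imor A) (Cod C \<tau>)"
      by (cases m, cases x, cases y) (auto simp: s ihom_def)
    then show "fmor (prod_functor A P) (Dom C \<tau>) (restr (imor (prod_icat (discrete_icat (iob A)) A)) \<tau> m)
        = restr (imor (prod_icat (discrete_icat (iob A)) A)) \<tau> (fmor (prod_functor A P) (Cod C \<tau>) m)"
      using nat_trans_simps(2)[OF P'(4) t refl _ refl, of "(iid A (Cod C \<tau>) a, n)"]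
        iid_restr[OF A t] ihomD(1)[OF iid_ihom[OF A _ m(2)]] t
      by (simp add: s category_simps[OF C])
  next
    fix \<Gamma> x assume "\<Gamma> \<in> Obj C" "x \<in> sect (iob (prod_icat (discrete_icat (iob A)) A)) \<Gamma>"
    then show "fmor (prod_functor A P) \<Gamma> (iid (prod_icat (discrete_icat (iob A)) A) \<Gamma> x)
        = iid (prod_icat (discrete_icat (iob A)) A) \<Gamma> (fob (prod_functor A P) \<Gamma> x)"
      using P'(5)[of \<Gamma> x] by (cases x) (auto simp: s)
  next
    fix \<Gamma> n m x y z assume \<Gamma>: "\<Gamma> \<in> Obj C"
      and n: "n \<in> ihom (prod_icat (discrete_icat (iob A)) A) \<Gamma> y z"
      and m: "m \<in> ihom (prod_icat (discrete_icat (iob A)) A) \<Gamma> x y"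
    \<comment> \<open>The arrows of the discrete factor are identities, so both arrows have the same
      first component \<open>a\<close>.\<close>
    obtain a n' m' x' y' z' where nm: "n = (a, n')" "m = (a, m')" "a \<in> sect (iob A) \<Gamma>"
      "n' \<in> ihom A \<Gamma> y' z'" "m' \<in> ihom A \<Gamma> x' y'"
      using n m by (cases n, cases m, cases x, cases y, cases z) (auto simp: s)
    note i = iid_ihom[OF A \<Gamma> nm(3)]
    show "fmor (prod_functor A P) \<Gamma> (icomp (prod_icat (discrete_icat (iob A)) A) \<Gamma> (n, m))
       = icomp (prod_icat (discrete_icat (iob A)) A) \<Gamma> (fmor (prod_functor A P) \<Gamma> n, fmor (prod_functor A P) \<Gamma> m)"
      \<comment> \<open>\<open>P\<close> is applied to \<open>(id, n')\<close> and
        \<open>(id, m')\<close>, whose composite is \<open>(id, n' m')\<close> because the identity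
        on \<open>a\<close> is idempotent.\<close>
      using P'(7)[OF \<Gamma>, of "(iid A \<Gamma> a, n')" "(a, y')" "(a, z')" "(iid A \<Gamma> a, m')" "(a, x')"]
        nm i icomp_iid(1)[OF A \<Gamma> i] by (simp add: s)
  qed
qed

section \<open>Pullbacks of presheaves\<close>

lemma nat_trans_comp:
  assumes "is_category C" "nat_trans C P Q \<alpha>" "nat_trans C Q R \<beta>"
  shows "nat_trans C P R (\<lambda>\<Gamma> x. \<beta> \<Gamma> (\<alpha> \<Gamma> x))"
  using assms(2,3) category_simps(2)[OF assms(1)] by (auto simp: nat_trans_def)

text \<open>Limits of presheaves are computed at each stage, so the comparison isomorphism says that
  two sections with the same image in \<open>R\<close> come from exactly one section of
  \<open>W\<close>.\<close>

lemma is_pullbackD: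
  assumes C: "is_category C" and pb: "is_pullback C W P Q R t l r b"
  shows "nat_trans C W Q t" "nat_trans C W P l" "nat_trans C Q R r" "nat_trans C P R b"
    "\<And>\<Gamma> w. \<Gamma> \<in> Obj C \<Longrightarrow> w \<in> sect W \<Gamma> \<Longrightarrow> b \<Gamma> (l \<Gamma> w) = r \<Gamma> (t \<Gamma> w)"
    "\<And>\<Gamma> x y. \<Gamma> \<in> Obj C \<Longrightarrow> x \<in> sect P \<Gamma> \<Longrightarrow> y \<in> sect Q \<Gamma> \<Longrightarrow> b \<Gamma> x = r \<Gamma> y \<Longrightarrow>
       \<exists>!w. w \<in> sect W \<Gamma> \<and> l \<Gamma> w = x \<and> t \<Gamma> w = y"
proof -
  show "nat_trans C W Q t" "nat_trans C W P l" "nat_trans C Q R r" "nat_trans C P R b"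
    "\<And>\<Gamma> w. \<Gamma> \<in> Obj C \<Longrightarrow> w \<in> sect W \<Gamma> \<Longrightarrow> b \<Gamma> (l \<Gamma> w) = r \<Gamma> (t \<Gamma> w)"
    using pb by (simp_all add: is_pullback_def)
  from pb obtain \<beta> where \<beta>: "nat_trans C (pb_psh P Q b r) W \<beta>"
    "\<And>X w. X \<in> Obj C \<Longrightarrow> w \<in> sect W X \<Longrightarrow> \<beta> X (l X w, t X w) = w"
    "\<And>X z. X \<in> Obj C \<Longrightarrow> z \<in> sect (pb_psh P Q b r) X \<Longrightarrow> (l X (\<beta> X z), t X (\<beta> X z)) = z"
    unfolding is_pullback_def nat_iso_def by blast
  fix \<Gamma> x y assume \<Gamma>: "\<Gamma> \<in> Obj C" and "x \<in> sect P \<Gamma>" "y \<in> sect Q \<Gamma>" "b \<Gamma> x = r \<Gamma> y"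
  then have z: "(x, y) \<in> sect (pb_psh P Q b r) \<Gamma>" by (simp add: pb_psh_def)
  show "\<exists>!w. w \<in> sect W \<Gamma> \<and> l \<Gamma> w = x \<and> t \<Gamma> w = y"
    using nat_trans_simps(1)[OF \<beta>(1) \<Gamma> z] \<beta>(2)[OF \<Gamma>] \<beta>(3)[OF \<Gamma> z]
    by (intro ex1I[of _ "\<beta> \<Gamma> (x, y)"]) auto
qed

text \<open>Unique existence of sections makes the comparison map bijective at each stage, and the
  inverse of a stagewise bijective natural transformation is natural by itself.\<close>

lemma is_pullbackI:
  assumes C: "is_category C" and W: "is_presheaf C W"
    and nt: "nat_trans C W Q t" "nat_trans C W P l" "nat_trans C Q R r" "nat_trans C P R b"
    and comm: "\<And>\<Gamma> w. \<Gamma> \<in> Obj C \<Longrightarrow> w \<in> sect W \<Gamma> \<Longrightarrow> b \<Gamma> (l \<Gamma> w) = r \<Gamma> (t \<Gamma> w)"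
    and univ: "\<And>\<Gamma> x y. \<Gamma> \<in> Obj C \<Longrightarrow> x \<in> sect P \<Gamma> \<Longrightarrow> y \<in> sect Q \<Gamma> \<Longrightarrow> b \<Gamma> x = r \<Gamma> y \<Longrightarrow>
       \<exists>!w. w \<in> sect W \<Gamma> \<and> l \<Gamma> w = x \<and> t \<Gamma> w = y"
  shows "is_pullback C W P Q R t l r b"
proof -
  have nc: "nat_trans C W (pb_psh P Q b r) (\<lambda>\<Gamma> w. (l \<Gamma> w, t \<Gamma> w))"
    using nt comm unfolding nat_trans_def pb_psh_def by auto
  have "bij_betw (\<lambda>w. (l \<Gamma> w, t \<Gamma> w)) (sect W \<Gamma>) (sect (pb_psh P Q b r) \<Gamma>)"
    if \<Gamma>: "\<Gamma> \<in> Obj C" for \<Gamma>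
    unfolding bij_betw_def
  proof
    show "inj_on (\<lambda>w. (l \<Gamma> w, t \<Gamma> w)) (sect W \<Gamma>)"
    proof (rule inj_onI)
      fix w w' assume w: "w \<in> sect W \<Gamma>" "w' \<in> sect W \<Gamma>" "(l \<Gamma> w, t \<Gamma> w) = (l \<Gamma> w', t \<Gamma> w')"
      have "\<exists>!v. v \<in> sect W \<Gamma> \<and> l \<Gamma> v = l \<Gamma> w \<and> t \<Gamma> v = t \<Gamma> w"
        using \<Gamma> w by (intro univ) (simp_all add: nat_trans_simps[OF nt(1)] nat_trans_simps[OF nt(2)] comm)
      then show "w = w'" using w by auto
    qed
    show "(\<lambda>w. (l \<Gamma> w, t \<Gamma> w)) ` sect W \<Gamma> = sect (pb_psh P Q b r) \<Gamma>"
    proof (intro equalityI subsetI)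
      fix z assume "z \<in> (\<lambda>w. (l \<Gamma> w, t \<Gamma> w)) ` sect W \<Gamma>"
      then show "z \<in> sect (pb_psh P Q b r) \<Gamma>" using nat_trans_simps(1)[OF nc \<Gamma>] by auto
    next
      fix z assume "z \<in> sect (pb_psh P Q b r) \<Gamma>"
      then have "fst z \<in> sect P \<Gamma>" "snd z \<in> sect Q \<Gamma>" "b \<Gamma> (fst z) = r \<Gamma> (snd z)"
        by (auto simp: pb_psh_def)
      from ex1_implies_ex[OF univ[OF \<Gamma> this]]
      show "z \<in> (\<lambda>w. (l \<Gamma> w, t \<Gamma> w)) ` sect W \<Gamma>" by force
    qed
  qed
  then show ?thesis unfolding is_pullback_def using nt comm nat_isoI[OF C W nc] by blast
qed

text \<open>Pasting of pullback squares. It serves to specialise the squares of the dependent type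
  formers: a square over the base of constant families is put to their left.\<close>

lemma is_pullback_paste:
  assumes C: "is_category C" and W: "is_presheaf C W'"
    and pb: "is_pullback C W P Q R t l r b" and pb': "is_pullback C W' P' W P t' l' l b'"
  shows "is_pullback C W' P' Q R (\<lambda>\<Gamma> w. t \<Gamma> (t' \<Gamma> w)) l' r (\<lambda>\<Gamma> x. b \<Gamma> (b' \<Gamma> x))"
proof (rule is_pullbackI[OF C W])
  note d = is_pullbackD[OF C pb] and d' = is_pullbackD[OF C pb']
  show "nat_trans C W' Q (\<lambda>\<Gamma> w. t \<Gamma> (t' \<Gamma> w))" by (rule nat_trans_comp[OF C d'(1) d(1)])
  show "nat_trans C P' R (\<lambda>\<Gamma> x. b \<Gamma> (b' \<Gamma> x))" by (rule nat_trans_comp[OF C d'(4) d(4)])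
  show "nat_trans C W' P' l'" "nat_trans C Q R r" by (fact d'(2) d(3))+
  fix \<Gamma> assume \<Gamma>: "\<Gamma> \<in> Obj C"
  { fix w assume "w \<in> sect W' \<Gamma>"
    then show "b \<Gamma> (b' \<Gamma> (l' \<Gamma> w)) = r \<Gamma> (t \<Gamma> (t' \<Gamma> w))"
      using d(5)[OF \<Gamma>] d'(5)[OF \<Gamma>] nat_trans_simps(1)[OF d'(1) \<Gamma>] by simp }
  fix x y assume x: "x \<in> sect P' \<Gamma>" and y: "y \<in> sect Q \<Gamma>" and e: "b \<Gamma> (b' \<Gamma> x) = r \<Gamma> y"
  have bx: "b' \<Gamma> x \<in> sect P \<Gamma>" using nat_trans_simps(1)[OF d'(4) \<Gamma> x] .
  from ex1_implies_ex[OF d(6)[OF \<Gamma> bx y e]]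
  obtain v where v: "v \<in> sect W \<Gamma>" "l \<Gamma> v = b' \<Gamma> x" "t \<Gamma> v = y" by blast
  from ex1_implies_ex[OF d'(6)[OF \<Gamma> x v(1) v(2)[symmetric]]]
  obtain w where w: "w \<in> sect W' \<Gamma>" "l' \<Gamma> w = x" "t' \<Gamma> w = v" by blast
  show "\<exists>!w. w \<in> sect W' \<Gamma> \<and> l' \<Gamma> w = x \<and> t \<Gamma> (t' \<Gamma> w) = y"
  proof (rule ex1I[of _ w])
    show "w \<in> sect W' \<Gamma> \<and> l' \<Gamma> w = x \<and> t \<Gamma> (t' \<Gamma> w) = y" using w v by simp
    fix w' assume w': "w' \<in> sect W' \<Gamma> \<and> l' \<Gamma> w' = x \<and> t \<Gamma> (t' \<Gamma> w') = y"
    \<comment> \<open>Commutativity of the left square places \<open>t' \<Gamma> w'\<close> over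
      \<open>b' \<Gamma> x\<close>, so uniqueness in the right square applies.\<close>
    then have "t' \<Gamma> w' = v"
      using d(6)[OF \<Gamma> bx y e] v d'(5)[OF \<Gamma>] nat_trans_simps(1)[OF d'(1) \<Gamma>] by (metis (no_types))
    then show "w' = w" using d'(6)[OF \<Gamma> x v(1) v(2)[symmetric]] w w' by blast
  qed
qed


section \<open>The full internal subcategory\<close>

text \<open>A morphism seen as a function on generalised elements: it acts on the elements of the
  fibre at the domain of every arrow into its stage.\<close>

definition act :: "'a \<times> 'a \<times> ('m \<times> 'b \<Rightarrow> 'b) \<Rightarrow> 'm \<times> 'b \<Rightarrow> 'b" where
  "act h = snd (snd h)"

context psh_map
begin

abbreviation U where "U \<equiv> full_internal_subcategory C B A f"
abbreviation el where "el \<equiv> fibre C B A f"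

lemma U_simps: "iob U = A" "imor U = fibre_hom_psh C B A f"
  by (simp_all add: full_internal_subcategory_def)

lemmas U_icat = internal_category_full_internal_subcategory

lemma U_hom_iff:
  "h \<in> ihom U \<Gamma> a b \<longleftrightarrow> h = (a, b, act h) \<and> (a, b, act h) \<in> sect (fibre_hom_psh C B A f) \<Gamma>"
  by (cases h) (auto simp: ihom_def full_internal_subcategory_def act_def)

text \<open>The values of \<phi> off the fibre are irrelevant; \<open>restrict\<close> produces the
  extensional representative that sections of \<open>fibre_hom_psh\<close> must be.\<close>

lemma U_homI:
  assumes "a \<in> sect A \<Gamma>" "b \<in> sect A \<Gamma>"
    "\<And>\<sigma> x. (\<sigma>, x) \<in> el \<Gamma> a \<Longrightarrow> (\<sigma>, \<phi> (\<sigma>, x)) \<in> el \<Gamma> b"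
    "\<And>\<sigma> x \<tau>. (\<sigma>, x) \<in> el \<Gamma> a \<Longrightarrow> \<tau> \<in> Arr C \<Longrightarrow> Cod C \<tau> = Dom C \<sigma> \<Longrightarrow>
       \<phi> (Comp C \<sigma> \<tau>, restr B \<tau> x) = restr B \<tau> (\<phi> (\<sigma>, x))"
  shows "(a, b, restrict \<phi> (el \<Gamma> a)) \<in> ihom U \<Gamma> a b"
  unfolding U_hom_iff act_def snd_conv
  using assms by (intro conjI refl fibre_homI) (auto simp: fibre_restr)

lemma act_restrict: "z \<in> el \<Gamma> a \<Longrightarrow> act (a, b, restrict \<phi> (el \<Gamma> a)) z = \<phi> z"
  by (simp add: act_def)

text \<open>Morphisms with common ends are represented by extensional functions on the same fibre
  and are therefore determined by their values there. This is the test used for transposes and their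
  uniqueness below.\<close>

lemma U_hom_eqI:
  assumes "h \<in> ihom U \<Gamma> a b" "k \<in> ihom U \<Gamma> a b"
    "\<And>\<sigma> x. (\<sigma>, x) \<in> el \<Gamma> a \<Longrightarrow> act h (\<sigma>, x) = act k (\<sigma>, x)"
  shows "h = k"
proof -
  have "act h \<in> extensional (el \<Gamma> a)" "act k \<in> extensional (el \<Gamma> a)"
    using assms(1,2) fibre_maps_ext[OF fibre_homD(3)] unfolding U_hom_iff by blast+
  then have "act h = act k" using assms(3) by (rule fibre_maps_eqI)
  then show ?thesis using assms(1,2) unfolding U_hom_iff by metis
qed

lemma U_hom_ob:
  assumes "h \<in> ihom U \<Gamma> a b"
  shows "a \<in> sect A \<Gamma>" "b \<in> sect A \<Gamma>"
  using assms fibre_homD(1,2) unfolding U_hom_iff by blast+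

lemma act_el:
  assumes "h \<in> ihom U \<Gamma> a b" "(\<sigma>, x) \<in> el \<Gamma> a"
  shows "(\<sigma>, act h (\<sigma>, x)) \<in> el \<Gamma> b"
  using assms fibre_homD(5) unfolding U_hom_iff by blast

lemma act_natural:
  assumes "h \<in> ihom U \<Gamma> a b" "(\<sigma>, x) \<in> el \<Gamma> a" "\<tau> \<in> Arr C" "Cod C \<tau> = Dom C \<sigma>"
  shows "act h (Comp C \<sigma> \<tau>, restr B \<tau> x) = restr B \<tau> (act h (\<sigma>, x))"
  using assms fibre_mapsD(2)[OF fibre_homD(3)] unfolding U_hom_iff by blast

lemma act_comp:
  assumes "k \<in> ihom U \<Gamma> b c" "h \<in> ihom U \<Gamma> a b" "(\<sigma>, x) \<in> el \<Gamma> a"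
  shows "act (icomp U \<Gamma> (k, h)) (\<sigma>, x) = act k (\<sigma>, act h (\<sigma>, x))"
  using assms by (cases k, cases h)
    (auto simp: ihom_def full_internal_subcategory_def act_def)

lemma act_id: "(\<sigma>, x) \<in> el \<Gamma> a \<Longrightarrow> act (iid U \<Gamma> a) (\<sigma>, x) = x"
  by (simp add: full_internal_subcategory_def act_def)

lemma act_restr:
  assumes "h \<in> ihom U \<Gamma> a b" "(\<sigma>, x) \<in> el (Dom C \<tau>) (restr A \<tau> a)"
  shows "act (restr (fibre_hom_psh C B A f) \<tau> h) (\<sigma>, x) = act h (Comp C \<tau> \<sigma>, x)"
  using assms by (cases h) (auto simp: U_hom_iff act_def fibre_hom_psh_def fibre_map_restr_apply)

text \<open>An element at a later stage becomes an element over the identity once the morphism is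
  restricted along \<sigma>. Families that are natural in the stage can thus be evaluated at
  identity arrows only.\<close>

lemma act_via_id:
  assumes h: "h \<in> ihom U \<Gamma> a b" and sx: "(\<sigma>, x) \<in> el \<Gamma> a"
  shows "(Id C (Dom C \<sigma>), x) \<in> el (Dom C \<sigma>) (restr A \<sigma> a)"
    "act h (\<sigma>, x) = act (restr (fibre_hom_psh C B A f) \<sigma> h) (Id C (Dom C \<sigma>), x)"
proof -
  note s = fibreD[OF sx]
  show i: "(Id C (Dom C \<sigma>), x) \<in> el (Dom C \<sigma>) (restr A \<sigma> a)"
    using s U_hom_ob(1)[OF h] by (simp add: fibre_id simps)
  show "act h (\<sigma>, x) = act (restr (fibre_hom_psh C B A f) \<sigma> h) (Id C (Dom C \<sigma>), x)"
    using act_restr[OF h i] s by (simp add: simps)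
qed

text \<open>The universal property of the local exponential, with its values spelled out at all
  arrows and not only at identities. It turns an elementwise formula natural in the stage into a
  natural family of morphisms, as a counit has to be.\<close>

lemma U_hom_family:
  assumes Y: "is_presheaf C Y" and u: "nat_trans C Y A u" and v: "nat_trans C Y A v"
    and k: "nat_trans C (pb_psh Y B u f) B k"
    and kv: "\<And>\<Gamma> y x. \<Gamma> \<in> Obj C \<Longrightarrow> (y, x) \<in> sect (pb_psh Y B u f) \<Gamma> \<Longrightarrow> f \<Gamma> (k \<Gamma> (y, x)) = v \<Gamma> y"
  obtains h where "nat_trans C Y (fibre_hom_psh C B A f) h"
    and "\<And>\<Gamma> y. \<Gamma> \<in> Obj C \<Longrightarrow> y \<in> sect Y \<Gamma> \<Longrightarrow> h \<Gamma> y \<in> ihom U \<Gamma> (u \<Gamma> y) (v \<Gamma> y)"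
    and "\<And>\<Gamma> y \<sigma> x. \<Gamma> \<in> Obj C \<Longrightarrow> y \<in> sect Y \<Gamma> \<Longrightarrow> (\<sigma>, x) \<in> el \<Gamma> (u \<Gamma> y) \<Longrightarrow>
           act (h \<Gamma> y) (\<sigma>, x) = k (Dom C \<sigma>) (restr Y \<sigma> y, x)"
proof (rule fibre_hom_universal[OF assms], assumption, assumption)
  fix h assume h: "nat_trans C Y (fibre_hom_psh C B A f) h"
    and ends: "\<And>\<Gamma> y. \<Gamma> \<in> Obj C \<Longrightarrow> y \<in> sect Y \<Gamma> \<Longrightarrow> fst (h \<Gamma> y) = u \<Gamma> y \<and> fst (snd (h \<Gamma> y)) = v \<Gamma> y"
    and ev: "\<And>\<Gamma> y x. \<Gamma> \<in> Obj C \<Longrightarrow> (y, x) \<in> sect (pb_psh Y B u f) \<Gamma> \<Longrightarrow>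
      snd (snd (h \<Gamma> y)) (Id C \<Gamma>, x) = k \<Gamma> (y, x)"
  have hom: "h \<Gamma> y \<in> ihom U \<Gamma> (u \<Gamma> y) (v \<Gamma> y)" if y: "\<Gamma> \<in> Obj C" "y \<in> sect Y \<Gamma>" for \<Gamma> y
  proof -
    have "h \<Gamma> y = (u \<Gamma> y, v \<Gamma> y, act (h \<Gamma> y))" using ends[OF y] by (simp add: act_def prod_eq_iff)
    then show ?thesis using nat_trans_simps(1)[OF h y] unfolding U_hom_iff by simp
  qed
  have "act (h \<Gamma> y) (\<sigma>, x) = k (Dom C \<sigma>) (restr Y \<sigma> y, x)"
    if y: "\<Gamma> \<in> Obj C" "y \<in> sect Y \<Gamma>" and sx: "(\<sigma>, x) \<in> el \<Gamma> (u \<Gamma> y)" for \<Gamma> y \<sigma> x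
  proof -
    note s = fibreD[OF sx]
    \<comment> \<open>Naturality of \<open>h\<close> identifies its restriction along \<sigma> with
      its value at the restricted index, where the evaluation at the identity is known.\<close>
    have "act (h \<Gamma> y) (\<sigma>, x) = act (h (Dom C \<sigma>) (restr Y \<sigma> y)) (Id C (Dom C \<sigma>), x)"
      using act_via_id(2)[OF hom[OF y] sx] nat_trans_simps(2)[OF h s(1,2) y(2) refl] by simp
    also have "\<dots> = k (Dom C \<sigma>) (restr Y \<sigma> y, x)"
      unfolding act_def using y s
      by (intro ev) (auto simp: pb_psh_def simps presheaf_simps[OF Y] nat_trans_simps[OF u])
    finally show ?thesis .
  qed
  with h hom show thesis by (rule that)
qed

text \<open>The pullback says that the fibre over the code \<open>e\<close> has exactly one element
  at each stage. Hence there is exactly one morphism into \<open>e\<close> from any object, and the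
  counit, taking values in a one-element category, carries no information.\<close>

lemma U_terminal:
  assumes pb: "is_pullback C terminal_psh terminal_psh B A s (\<lambda>\<Gamma> x. x) f e"
  shows "has_internal_terminal C U"
proof -
  note d = is_pullbackD[OF C pb]
  have T: "() \<in> sect terminal_psh \<Gamma>" for \<Gamma> by (simp add: terminal_psh_def)
  have e: "e \<Gamma> () \<in> sect A \<Gamma>" if "\<Gamma> \<in> Obj C" for \<Gamma>
    using nat_trans_simps(1)[OF d(4) that T] .
  have er: "restr A \<tau> (e \<Gamma> ()) = e (Dom C \<tau>) ()" if "\<tau> \<in> Arr C" "Cod C \<tau> = \<Gamma>" for \<tau> \<Gamma>
    using nat_trans_simps(2)[OF d(4) that T refl] by (simp add: terminal_psh_def)
  have s: "s \<Gamma> () \<in> sect B \<Gamma>" "f \<Gamma> (s \<Gamma> ()) = e \<Gamma> ()" if "\<Gamma> \<in> Obj C" for \<Gamma>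
    using nat_trans_simps(1)[OF d(1) that T] d(5)[OF that T] by simp_all
  have sr: "restr B \<tau> (s \<Gamma> ()) = s (Dom C \<tau>) ()" if "\<tau> \<in> Arr C" "Cod C \<tau> = \<Gamma>" for \<tau> \<Gamma>
    using nat_trans_simps(2)[OF d(1) that T refl] by (simp add: terminal_psh_def)
  have s_unique: "x = s (Dom C \<sigma>) ()" if "(\<sigma>, x) \<in> el \<Gamma> (e \<Gamma> ())" for \<Gamma> \<sigma> x
    using d(6)[OF _ T, of "Dom C \<sigma>" x] fibreD[OF that] er by (auto simp: simps)
  have el_s: "(\<sigma>, s (Dom C \<sigma>) ()) \<in> el \<Gamma> (e \<Gamma> ())" if "\<sigma> \<in> Arr C" "Cod C \<sigma> = \<Gamma>" for \<sigma> \<Gamma>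
    using that by (intro fibreI) (simp_all add: s er simps)
  have "\<exists>G \<eta>. fob G = e \<and>
      internal_adjunction C U (discrete_icat terminal_psh) bang_functor G \<eta> (\<lambda>\<Gamma> x. ())"
  proof (rule internal_right_adjointI[OF C internal_functor_bang[OF U_icat]])
    show "nat_trans C (iob (discrete_icat terminal_psh)) (iob U) e"
      using d(4) by (simp add: discrete_icat_simps U_simps)
    show "nat_trans C (iob (discrete_icat terminal_psh)) (imor (discrete_icat terminal_psh)) (\<lambda>\<Gamma> x. ())"
      by (simp add: discrete_icat_simps nat_trans_def terminal_psh_def)
  next
    fix \<Gamma> a b h assume \<Gamma>: "\<Gamma> \<in> Obj C" and a: "a \<in> sect (iob U) \<Gamma>"
    \<comment> \<open>The constant function with value the unique element \<open>s\<close>, taken at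
      the stage of the argument.\<close>
    define k where "k = (a, e \<Gamma> (), restrict (\<lambda>(\<sigma>, x). s (Dom C \<sigma>) ()) (el \<Gamma> a))"
    have k: "k \<in> ihom U \<Gamma> a (e \<Gamma> ())"
      unfolding k_def
    proof (rule U_homI)
      fix \<sigma> x assume "(\<sigma>, x) \<in> el \<Gamma> a"
      note sx = fibreD[OF this]
      show "(\<sigma>, case (\<sigma>, x) of (\<sigma>, x) \<Rightarrow> s (Dom C \<sigma>) ()) \<in> el \<Gamma> (e \<Gamma> ())"
        using el_s sx by simp
      fix \<tau> assume "\<tau> \<in> Arr C" "Cod C \<tau> = Dom C \<sigma>"
      then show "(case (Comp C \<sigma> \<tau>, restr B \<tau> x) of (\<sigma>, x) \<Rightarrow> s (Dom C \<sigma>) ())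
          = restr B \<tau> (case (\<sigma>, x) of (\<sigma>, x) \<Rightarrow> s (Dom C \<sigma>) ())"
        using sx sr by (simp add: simps)
    qed (use a e[OF \<Gamma>] in \<open>simp_all add: U_simps\<close>)
    show "\<exists>!k. k \<in> ihom U \<Gamma> a (e \<Gamma> b) \<and>
        icomp (discrete_icat terminal_psh) \<Gamma> ((), fmor bang_functor \<Gamma> k) = h"
    proof (rule ex1I[of _ k])
      show "k \<in> ihom U \<Gamma> a (e \<Gamma> b) \<and>
          icomp (discrete_icat terminal_psh) \<Gamma> ((), fmor bang_functor \<Gamma> k) = h"
        using k by simp
    next
      fix k' assume "k' \<in> ihom U \<Gamma> a (e \<Gamma> b) \<and>
          icomp (discrete_icat terminal_psh) \<Gamma> ((), fmor bang_functor \<Gamma> k') = h"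
      then have k': "k' \<in> ihom U \<Gamma> a (e \<Gamma> ())" by simp
      show "k' = k"
      proof (rule U_hom_eqI[OF k' k])
        fix \<sigma> x assume "(\<sigma>, x) \<in> el \<Gamma> a"
        from s_unique[OF act_el[OF k' this]] s_unique[OF act_el[OF k this]]
        show "act k' (\<sigma>, x) = act k (\<sigma>, x)" by simp
      qed
    qed
  next
    fix \<Gamma> b
    show "() \<in> ihom (discrete_icat terminal_psh) \<Gamma> (fob bang_functor \<Gamma> (e \<Gamma> b)) b"
      by (simp add: discrete_icat_simps T)
  qed
  then show ?thesis unfolding has_internal_terminal_def internal_right_adjoint_def by blast
qed

end

section \<open>Internal products and exponentials\<close>

text \<open>\<open>S (a, b)\<close> represents the product of the fibres over \<open>a\<close> and \<open>b\<close>, with pairing \<open>pr\<close>.\<close>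

locale psh_map_prod = psh_map +
  fixes S pr
  assumes pb_prod: "is_pullback C (prod_psh B B) (prod_psh A A) B A pr
    (\<lambda>\<Gamma>. map_prod (f \<Gamma>) (f \<Gamma>)) f S"
begin

section \<open>Codes for binary products: pairing, unpairing and maps out of a product\<close>

lemmas S_nat = is_pullbackD(4)[OF C pb_prod]

lemma S_ob: "\<Gamma> \<in> Obj C \<Longrightarrow> a \<in> sect A \<Gamma> \<Longrightarrow> b \<in> sect A \<Gamma> \<Longrightarrow> S \<Gamma> (a, b) \<in> sect A \<Gamma>"
  using nat_trans_simps(1)[OF S_nat] by (simp add: prod_psh_simps)

lemma S_restr:
  assumes "\<tau> \<in> Arr C" "Cod C \<tau> = \<Gamma>" "a \<in> sect A \<Gamma>" "b \<in> sect A \<Gamma>"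
  shows "restr A \<tau> (S \<Gamma> (a, b)) = S (Dom C \<tau>) (restr A \<tau> a, restr A \<tau> b)"
  using nat_trans_simps(2)[OF S_nat assms(1,2) _ refl, of "(a, b)"] assms by (simp add: prod_psh_simps)

lemma pr_restr:
  assumes "\<tau> \<in> Arr C" "Cod C \<tau> = \<Gamma>" "x \<in> sect B \<Gamma>" "y \<in> sect B \<Gamma>"
  shows "restr B \<tau> (pr \<Gamma> (x, y)) = pr (Dom C \<tau>) (restr B \<tau> x, restr B \<tau> y)"
  using nat_trans_simps(2)[OF is_pullbackD(1)[OF C pb_prod] assms(1,2) _ refl, of "(x, y)"] assms
  by (simp add: prod_psh_simps)

lemma pr_el:
  assumes x: "(\<sigma>, x) \<in> el \<Gamma> a" and y: "(\<sigma>, y) \<in> el \<Gamma> b" and ab: "a \<in> sect A \<Gamma>" "b \<in> sect A \<Gamma>"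
  shows "(\<sigma>, pr (Dom C \<sigma>) (x, y)) \<in> el \<Gamma> (S \<Gamma> (a, b))"
proof -
  note x' = fibreD[OF x] and y' = fibreD[OF y]
  have o: "Dom C \<sigma> \<in> Obj C" and xy: "(x, y) \<in> sect (prod_psh B B) (Dom C \<sigma>)"
    using x' y' by (simp_all add: simps prod_psh_simps)
  show ?thesis
    using x' y' nat_trans_simps(1)[OF is_pullbackD(1)[OF C pb_prod] o xy]
      is_pullbackD(5)[OF C pb_prod o xy] S_restr[OF x'(1,2) ab]
    by (intro fibreI) simp_all
qed

text \<open>The inverse of pairing relative to a pair of types. \<open>ab\<close> is an argument
  because \<open>S\<close> may give the same code to different pairs, and then \<open>z\<close>
  alone does not determine its components.\<close>

definition unpair where
  "unpair \<Gamma> ab z = (THE w. w \<in> sect (prod_psh B B) \<Gamma> \<and> map_prod (f \<Gamma>) (f \<Gamma>) w = ab \<and> pr \<Gamma> w = z)"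

lemma unpair_pr:
  assumes x: "(\<sigma>, x) \<in> el \<Gamma> a" and y: "(\<sigma>, y) \<in> el \<Gamma> b" and ab: "a \<in> sect A \<Gamma>" "b \<in> sect A \<Gamma>"
  shows "unpair (Dom C \<sigma>) (restr A \<sigma> a, restr A \<sigma> b) (pr (Dom C \<sigma>) (x, y)) = (x, y)"
proof -
  note x' = fibreD[OF x] and y' = fibreD[OF y]
  note z = fibreD[OF pr_el[OF assms]]
  have "\<exists>!w. w \<in> sect (prod_psh B B) (Dom C \<sigma>) \<and>
      map_prod (f (Dom C \<sigma>)) (f (Dom C \<sigma>)) w = (restr A \<sigma> a, restr A \<sigma> b) \<and>
      pr (Dom C \<sigma>) w = pr (Dom C \<sigma>) (x, y)"
    by (rule is_pullbackD(6)[OF C pb_prod])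
      (use x' y' z ab S_restr[OF x'(1,2) ab] in \<open>simp_all add: prod_psh_simps simps\<close>)
  then show ?thesis
    unfolding unpair_def by (rule the1_equality) (use x' y' in \<open>simp add: prod_psh_simps\<close>)
qed

text \<open>The existence half of the pullback at the stage \<open>Dom C \<sigma>\<close>, where the
  code of the product has first been moved by \<open>S_restr\<close>.\<close>

lemma el_prodE:
  assumes z: "(\<sigma>, z) \<in> el \<Gamma> (S \<Gamma> (a, b))" and ab: "a \<in> sect A \<Gamma>" "b \<in> sect A \<Gamma>"
  obtains x y where "(\<sigma>, x) \<in> el \<Gamma> a" "(\<sigma>, y) \<in> el \<Gamma> b" "z = pr (Dom C \<sigma>) (x, y)"
proof -
  note z' = fibreD[OF z]
  have "\<exists>!w. w \<in> sect (prod_psh B B) (Dom C \<sigma>) \<and>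
      map_prod (f (Dom C \<sigma>)) (f (Dom C \<sigma>)) w = (restr A \<sigma> a, restr A \<sigma> b) \<and> pr (Dom C \<sigma>) w = z"
    by (rule is_pullbackD(6)[OF C pb_prod])
      (use z' ab S_restr[OF z'(1,2) ab] in \<open>simp_all add: prod_psh_simps simps\<close>)
  then obtain w where "w \<in> sect (prod_psh B B) (Dom C \<sigma>)"
    "map_prod (f (Dom C \<sigma>)) (f (Dom C \<sigma>)) w = (restr A \<sigma> a, restr A \<sigma> b)" "pr (Dom C \<sigma>) w = z"
    by blast
  then show thesis
    using z' by (intro that[of "fst w" "snd w"] fibreI) (auto simp: prod_psh_simps)
qed

text \<open>Elements over \<open>S (a, b)\<close> are exactly pairs, so a natural function of two
  elements is the same as a family of morphisms out of the product. The two projections and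
  evaluation are all obtained from this.\<close>

lemma prod_hom_family:
  assumes Y: "is_presheaf C Y" and u: "nat_trans C Y A u" and u': "nat_trans C Y A u'"
    and v: "nat_trans C Y A v"
    and k: "\<And>\<Gamma> y s t. \<Gamma> \<in> Obj C \<Longrightarrow> y \<in> sect Y \<Gamma> \<Longrightarrow> s \<in> sect B \<Gamma> \<Longrightarrow> f \<Gamma> s = u \<Gamma> y \<Longrightarrow>
      t \<in> sect B \<Gamma> \<Longrightarrow> f \<Gamma> t = u' \<Gamma> y \<Longrightarrow> k \<Gamma> y s t \<in> sect B \<Gamma> \<and> f \<Gamma> (k \<Gamma> y s t) = v \<Gamma> y"
    and kr: "\<And>\<tau> \<Gamma> y s t. \<tau> \<in> Arr C \<Longrightarrow> Cod C \<tau> = \<Gamma> \<Longrightarrow> y \<in> sect Y \<Gamma> \<Longrightarrow> s \<in> sect B \<Gamma> \<Longrightarrow> f \<Gamma> s = u \<Gamma> y \<Longrightarrow>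
      t \<in> sect B \<Gamma> \<Longrightarrow> f \<Gamma> t = u' \<Gamma> y \<Longrightarrow>
      restr B \<tau> (k \<Gamma> y s t) = k (Dom C \<tau>) (restr Y \<tau> y) (restr B \<tau> s) (restr B \<tau> t)"
  obtains h where "nat_trans C Y (fibre_hom_psh C B A f) h"
    and "\<And>\<Gamma> y. \<Gamma> \<in> Obj C \<Longrightarrow> y \<in> sect Y \<Gamma> \<Longrightarrow> h \<Gamma> y \<in> ihom U \<Gamma> (S \<Gamma> (u \<Gamma> y, u' \<Gamma> y)) (v \<Gamma> y)"
    and "\<And>\<Gamma> y \<sigma> s t. \<Gamma> \<in> Obj C \<Longrightarrow> y \<in> sect Y \<Gamma> \<Longrightarrow> (\<sigma>, s) \<in> el \<Gamma> (u \<Gamma> y) \<Longrightarrow>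
      (\<sigma>, t) \<in> el \<Gamma> (u' \<Gamma> y) \<Longrightarrow>
      act (h \<Gamma> y) (\<sigma>, pr (Dom C \<sigma>) (s, t)) = k (Dom C \<sigma>) (restr Y \<sigma> y) s t"
proof -
  note ys = simps presheaf_simps[OF Y] nat_trans_simps[OF u] nat_trans_simps[OF u'] nat_trans_simps[OF v]
  define w where "w \<Gamma> y = S \<Gamma> (u \<Gamma> y, u' \<Gamma> y)" for \<Gamma> y
  have w: "nat_trans C Y A w"
    by (rule nat_transI) (simp_all add: w_def ys S_ob S_restr)
  \<comment> \<open>\<open>k\<close> after unpairing, as a map out of the fibre product of
    \<open>Y\<close> with \<open>B\<close> over the product codes.\<close>
  define q where "q \<Gamma> = (\<lambda>(y, z). let st = unpair \<Gamma> (u \<Gamma> y, u' \<Gamma> y) z in k \<Gamma> y (fst st) (snd st))" for \<Gamma>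
  have q: "q \<Gamma> (y, pr \<Gamma> (s, t)) = k \<Gamma> y s t"
    if "\<Gamma> \<in> Obj C" "y \<in> sect Y \<Gamma>" "s \<in> sect B \<Gamma>" "f \<Gamma> s = u \<Gamma> y" "t \<in> sect B \<Gamma>" "f \<Gamma> t = u' \<Gamma> y" for \<Gamma> y s t
    using that unpair_pr[of "Id C \<Gamma>" s \<Gamma> "u \<Gamma> y" t "u' \<Gamma> y"] by (simp add: q_def fibre_id ys)
  have split: "\<exists>s t. z = pr \<Gamma> (s, t) \<and> s \<in> sect B \<Gamma> \<and> f \<Gamma> s = u \<Gamma> y \<and> t \<in> sect B \<Gamma> \<and> f \<Gamma> t = u' \<Gamma> y"
    if \<Gamma>: "\<Gamma> \<in> Obj C" and yz: "(y, z) \<in> sect (pb_psh Y B w f) \<Gamma>" for \<Gamma> y z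
  proof -
    have y: "y \<in> sect Y \<Gamma>" and z: "(Id C \<Gamma>, z) \<in> el \<Gamma> (S \<Gamma> (u \<Gamma> y, u' \<Gamma> y))"
      using \<Gamma> yz by (auto simp: pb_psh_def fibre_id S_ob ys w_def)
    obtain s t where "(Id C \<Gamma>, s) \<in> el \<Gamma> (u \<Gamma> y)" "(Id C \<Gamma>, t) \<in> el \<Gamma> (u' \<Gamma> y)"
      "z = pr (Dom C (Id C \<Gamma>)) (s, t)"
      by (rule el_prodE[OF z]) (use \<Gamma> y in \<open>simp_all add: ys\<close>)
    then show ?thesis using \<Gamma> y by (auto simp: fibre_id ys)
  qed
  have q_val: "q \<Gamma> (y, z) \<in> sect B \<Gamma> \<and> f \<Gamma> (q \<Gamma> (y, z)) = v \<Gamma> y"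
    if \<Gamma>: "\<Gamma> \<in> Obj C" and yz: "(y, z) \<in> sect (pb_psh Y B w f) \<Gamma>" for \<Gamma> y z
  proof -
    have y: "y \<in> sect Y \<Gamma>" using yz by (simp add: pb_psh_def)
    obtain s t where st: "z = pr \<Gamma> (s, t)" "s \<in> sect B \<Gamma>" "f \<Gamma> s = u \<Gamma> y" "t \<in> sect B \<Gamma>" "f \<Gamma> t = u' \<Gamma> y"
      using split[OF \<Gamma> yz] by blast
    show ?thesis using k[OF \<Gamma> y st(2-)] q[OF \<Gamma> y st(2-)] st(1) by simp
  qed
  have q_nat: "nat_trans C (pb_psh Y B w f) B q"
  proof (rule nat_transI)
    fix \<Gamma> yz assume "\<Gamma> \<in> Obj C" "yz \<in> sect (pb_psh Y B w f) \<Gamma>"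
    then show "q \<Gamma> yz \<in> sect B \<Gamma>" using q_val by (cases yz) simp
  next
    fix \<tau> yz assume t: "\<tau> \<in> Arr C" and yz: "yz \<in> sect (pb_psh Y B w f) (Cod C \<tau>)"
    obtain y z where yz': "yz = (y, z)" by (cases yz)
    have y: "y \<in> sect Y (Cod C \<tau>)" using yz by (simp add: pb_psh_def yz')
    have o: "Cod C \<tau> \<in> Obj C" "Dom C \<tau> \<in> Obj C" using t by (simp_all add: ys)
    obtain s t' where st: "z = pr (Cod C \<tau>) (s, t')" "s \<in> sect B (Cod C \<tau>)" "f (Cod C \<tau>) s = u (Cod C \<tau>) y"
      "t' \<in> sect B (Cod C \<tau>)" "f (Cod C \<tau>) t' = u' (Cod C \<tau>) y"
      using split[OF o(1) yz[unfolded yz']] by blast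
    \<comment> \<open>Since pairing is natural, restricting an element of the product restricts its
      components; naturality of \<open>q\<close> is thus inherited from \<open>k\<close>.\<close>
    have "restr (pb_psh Y B w f) \<tau> yz = (restr Y \<tau> y, pr (Dom C \<tau>) (restr B \<tau> s, restr B \<tau> t'))"
      using t st pr_restr[OF t refl st(2,4)] by (simp add: pb_psh_def yz')
    moreover have "q (Dom C \<tau>) (restr Y \<tau> y, pr (Dom C \<tau>) (restr B \<tau> s, restr B \<tau> t'))
        = k (Dom C \<tau>) (restr Y \<tau> y) (restr B \<tau> s) (restr B \<tau> t')"
      using t y st o by (intro q) (simp_all add: ys)
    ultimately show "q (Dom C \<tau>) (restr (pb_psh Y B w f) \<tau> yz) = restr B \<tau> (q (Cod C \<tau>) yz)"
      using kr[OF t refl y st(2-)] q[OF o(1) y st(2-)] by (simp add: yz' st(1))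
  qed
  show thesis
  proof (rule U_hom_family[OF Y w v q_nat])
    fix \<Gamma> y z assume "\<Gamma> \<in> Obj C" "(y, z) \<in> sect (pb_psh Y B w f) \<Gamma>"
    then show "f \<Gamma> (q \<Gamma> (y, z)) = v \<Gamma> y" using q_val by blast
  next
    fix h assume h: "nat_trans C Y (fibre_hom_psh C B A f) h"
      and hom: "\<And>\<Gamma> y. \<Gamma> \<in> Obj C \<Longrightarrow> y \<in> sect Y \<Gamma> \<Longrightarrow> h \<Gamma> y \<in> ihom U \<Gamma> (w \<Gamma> y) (v \<Gamma> y)"
      and ev: "\<And>\<Gamma> y \<sigma> x. \<Gamma> \<in> Obj C \<Longrightarrow> y \<in> sect Y \<Gamma> \<Longrightarrow> (\<sigma>, x) \<in> el \<Gamma> (w \<Gamma> y) \<Longrightarrow>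
           act (h \<Gamma> y) (\<sigma>, x) = q (Dom C \<sigma>) (restr Y \<sigma> y, x)"
    have "act (h \<Gamma> y) (\<sigma>, pr (Dom C \<sigma>) (s, t)) = k (Dom C \<sigma>) (restr Y \<sigma> y) s t"
      if y: "\<Gamma> \<in> Obj C" "y \<in> sect Y \<Gamma>" and s: "(\<sigma>, s) \<in> el \<Gamma> (u \<Gamma> y)" and t: "(\<sigma>, t) \<in> el \<Gamma> (u' \<Gamma> y)"
      for \<Gamma> y \<sigma> s t
    proof -
      have "(\<sigma>, pr (Dom C \<sigma>) (s, t)) \<in> el \<Gamma> (w \<Gamma> y)"
        unfolding w_def using y by (intro pr_el[OF s t]) (simp_all add: ys)
      from ev[OF y this] show ?thesis
        using fibreD[OF s] fibreD[OF t] y by (simp add: q ys)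
    qed
    with h hom show thesis unfolding w_def by (rule that)
  qed
qed

text \<open>Besides the adjoint, the lemma records how its arrow part acts on pairs. The exponential
  functor is stated in terms of that arrow part, which the adjunction determines only
  indirectly.\<close>

lemma U_product:
  obtains P where "internal_product C U P" "internal_functor C (prod_icat U U) U P" "fob P = S"
    and "\<And>\<Gamma> h k a a' b b' \<sigma> x y. \<Gamma> \<in> Obj C \<Longrightarrow> h \<in> ihom U \<Gamma> a a' \<Longrightarrow> k \<in> ihom U \<Gamma> b b' \<Longrightarrow>
      (\<sigma>, x) \<in> el \<Gamma> a \<Longrightarrow> (\<sigma>, y) \<in> el \<Gamma> b \<Longrightarrow>
      act (fmor P \<Gamma> (h, k)) (\<sigma>, pr (Dom C \<sigma>) (x, y))
        = pr (Dom C \<sigma>) (act h (\<sigma>, x), act k (\<sigma>, y))"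
proof -
  have fsts: "nat_trans C (prod_psh A A) A (\<lambda>\<Gamma>. fst)" "nat_trans C (prod_psh A A) A (\<lambda>\<Gamma>. snd)"
    by (auto simp: nat_trans_def prod_psh_simps)
  note Y = is_presheaf_prod[OF A A]
  obtain p1 where p1: "nat_trans C (prod_psh A A) (fibre_hom_psh C B A f) p1"
    "\<And>\<Gamma> y. \<Gamma> \<in> Obj C \<Longrightarrow> y \<in> sect (prod_psh A A) \<Gamma> \<Longrightarrow> p1 \<Gamma> y \<in> ihom U \<Gamma> (S \<Gamma> (fst y, snd y)) (fst y)"
    "\<And>\<Gamma> y \<sigma> s t. \<Gamma> \<in> Obj C \<Longrightarrow> y \<in> sect (prod_psh A A) \<Gamma> \<Longrightarrow> (\<sigma>, s) \<in> el \<Gamma> (fst y) \<Longrightarrow>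
      (\<sigma>, t) \<in> el \<Gamma> (snd y) \<Longrightarrow> act (p1 \<Gamma> y) (\<sigma>, pr (Dom C \<sigma>) (s, t)) = s"
    by (rule prod_hom_family[OF Y fsts fsts(1), of "\<lambda>\<Gamma> y s t. s"]) (assumption | simp)+
  obtain p2 where p2: "nat_trans C (prod_psh A A) (fibre_hom_psh C B A f) p2"
    "\<And>\<Gamma> y. \<Gamma> \<in> Obj C \<Longrightarrow> y \<in> sect (prod_psh A A) \<Gamma> \<Longrightarrow> p2 \<Gamma> y \<in> ihom U \<Gamma> (S \<Gamma> (fst y, snd y)) (snd y)"
    "\<And>\<Gamma> y \<sigma> s t. \<Gamma> \<in> Obj C \<Longrightarrow> y \<in> sect (prod_psh A A) \<Gamma> \<Longrightarrow> (\<sigma>, s) \<in> el \<Gamma> (fst y) \<Longrightarrow>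
      (\<sigma>, t) \<in> el \<Gamma> (snd y) \<Longrightarrow> act (p2 \<Gamma> y) (\<sigma>, pr (Dom C \<sigma>) (s, t)) = t"
    by (rule prod_hom_family[OF Y fsts fsts(2), of "\<lambda>\<Gamma> y s t. t"]) (assumption | simp)+
  have hom: "p1 \<Gamma> (a, b) \<in> ihom U \<Gamma> (S \<Gamma> (a, b)) a" "p2 \<Gamma> (a, b) \<in> ihom U \<Gamma> (S \<Gamma> (a, b)) b"
    if "\<Gamma> \<in> Obj C" "a \<in> sect A \<Gamma>" "b \<in> sect A \<Gamma>" for \<Gamma> a b
    using that p1(2)[of \<Gamma> "(a, b)"] p2(2)[of \<Gamma> "(a, b)"] by (simp_all add: prod_psh_simps)
  have act1: "act (p1 \<Gamma> (a, b)) (\<sigma>, pr (Dom C \<sigma>) (x, y)) = x"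
    and act2: "act (p2 \<Gamma> (a, b)) (\<sigma>, pr (Dom C \<sigma>) (x, y)) = y"
    if "\<Gamma> \<in> Obj C" "a \<in> sect A \<Gamma>" "b \<in> sect A \<Gamma>" "(\<sigma>, x) \<in> el \<Gamma> a" "(\<sigma>, y) \<in> el \<Gamma> b" for \<Gamma> a b \<sigma> x y
    using that p1(3)[of \<Gamma> "(a, b)"] p2(3)[of \<Gamma> "(a, b)"] by (simp_all add: prod_psh_simps)
  \<comment> \<open>Surjective pairing, read off the pullback; it yields uniqueness of transposes
    and later the action of \<open>P\<close>.\<close>
  have surj: "z = pr (Dom C \<sigma>) (act (p1 \<Gamma> (a, b)) (\<sigma>, z), act (p2 \<Gamma> (a, b)) (\<sigma>, z))"
    if \<Gamma>: "\<Gamma> \<in> Obj C" and ab: "a \<in> sect A \<Gamma>" "b \<in> sect A \<Gamma>" and z: "(\<sigma>, z) \<in> el \<Gamma> (S \<Gamma> (a, b))"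
    for \<Gamma> a b \<sigma> z
  proof -
    obtain x y where "(\<sigma>, x) \<in> el \<Gamma> a" "(\<sigma>, y) \<in> el \<Gamma> b" "z = pr (Dom C \<sigma>) (x, y)"
      by (rule el_prodE[OF z ab])
    then show ?thesis using act1 act2 \<Gamma> ab by simp
  qed
  let ?e = "\<lambda>\<Gamma> y. (p1 \<Gamma> y, p2 \<Gamma> y)"
  note s = prod_icat_simps prod_psh_simps U_simps diag_functor_def
  have "\<exists>P \<eta>. fob P = S \<and> internal_adjunction C U (prod_icat U U) diag_functor P \<eta> ?e"
  proof (rule internal_right_adjointI[OF C internal_functor_diag[OF U_icat]])
    show "nat_trans C (iob (prod_icat U U)) (iob U) S" using S_nat by (simp add: s)
    show "nat_trans C (iob (prod_icat U U)) (imor (prod_icat U U)) ?e"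
      using p1(1) p2(1) by (simp add: s nat_trans_def)
  next
    fix \<Gamma> b assume "\<Gamma> \<in> Obj C" "b \<in> sect (iob (prod_icat U U)) \<Gamma>"
    then show "?e \<Gamma> b \<in> ihom (prod_icat U U) \<Gamma> (fob diag_functor \<Gamma> (S \<Gamma> b)) b"
      using hom by (cases b) (simp add: s)
  next
    fix \<Gamma> c b h assume \<Gamma>: "\<Gamma> \<in> Obj C" and c: "c \<in> sect (iob U) \<Gamma>"
      and "b \<in> sect (iob (prod_icat U U)) \<Gamma>" "h \<in> ihom (prod_icat U U) \<Gamma> (fob diag_functor \<Gamma> c) b"
    then obtain a a' h1 h2 where b: "b = (a, a')" "a \<in> sect A \<Gamma>" "a' \<in> sect A \<Gamma>"
      and h: "h = (h1, h2)" "h1 \<in> ihom U \<Gamma> c a" "h2 \<in> ihom U \<Gamma> c a'"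
      by (cases b, cases h) (auto simp: s)
    \<comment> \<open>The pairing of \<open>h1\<close> and \<open>h2\<close>, formed elementwise;
      \<open>fst z\<close> is the arrow whose domain is the stage of the element.\<close>
    define k where "k = (c, S \<Gamma> (a, a'),
      restrict (\<lambda>z. pr (Dom C (fst z)) (act h1 z, act h2 z)) (el \<Gamma> c))"
    have k: "k \<in> ihom U \<Gamma> c (S \<Gamma> (a, a'))"
      unfolding k_def
    proof (rule U_homI)
      fix \<sigma> x assume x: "(\<sigma>, x) \<in> el \<Gamma> c"
      note a1 = act_el[OF h(2) x] and a2 = act_el[OF h(3) x]
      show "(\<sigma>, pr (Dom C (fst (\<sigma>, x))) (act h1 (\<sigma>, x), act h2 (\<sigma>, x))) \<in> el \<Gamma> (S \<Gamma> (a, a'))"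
        using pr_el[OF a1 a2 b(2,3)] by simp
      fix \<tau> assume t: "\<tau> \<in> Arr C" "Cod C \<tau> = Dom C \<sigma>"
      show "pr (Dom C (fst (Comp C \<sigma> \<tau>, restr B \<tau> x)))
            (act h1 (Comp C \<sigma> \<tau>, restr B \<tau> x), act h2 (Comp C \<sigma> \<tau>, restr B \<tau> x))
          = restr B \<tau> (pr (Dom C (fst (\<sigma>, x))) (act h1 (\<sigma>, x), act h2 (\<sigma>, x)))"
        using act_natural[OF h(2) x t] act_natural[OF h(3) x t] fibreD[OF a1] fibreD[OF a2] t
        by (simp add: pr_restr simps)
    qed (use c b S_ob[OF \<Gamma>] in \<open>simp_all add: s\<close>)
    have k_act: "act k (\<sigma>, x) = pr (Dom C \<sigma>) (act h1 (\<sigma>, x), act h2 (\<sigma>, x))" if "(\<sigma>, x) \<in> el \<Gamma> c" for \<sigma> x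
      unfolding k_def using that by (simp add: act_restrict)
    note p = hom[OF \<Gamma> b(2,3)]
    show "\<exists>!k. k \<in> ihom U \<Gamma> c (S \<Gamma> b) \<and> icomp (prod_icat U U) \<Gamma> (?e \<Gamma> b, fmor diag_functor \<Gamma> k) = h"
    proof (rule ex1I[of _ k])
      have "icomp U \<Gamma> (p1 \<Gamma> (a, a'), k) = h1"
      proof (rule U_hom_eqI[OF icomp_ihom[OF U_icat \<Gamma> p(1) k] h(2)])
        fix \<sigma> x assume x: "(\<sigma>, x) \<in> el \<Gamma> c"
        show "act (icomp U \<Gamma> (p1 \<Gamma> (a, a'), k)) (\<sigma>, x) = act h1 (\<sigma>, x)"
          using act_comp[OF p(1) k x] k_act[OF x] act1[OF \<Gamma> b(2,3) act_el[OF h(2) x] act_el[OF h(3) x]]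
          by simp
      qed
      moreover have "icomp U \<Gamma> (p2 \<Gamma> (a, a'), k) = h2"
      proof (rule U_hom_eqI[OF icomp_ihom[OF U_icat \<Gamma> p(2) k] h(3)])
        fix \<sigma> x assume x: "(\<sigma>, x) \<in> el \<Gamma> c"
        show "act (icomp U \<Gamma> (p2 \<Gamma> (a, a'), k)) (\<sigma>, x) = act h2 (\<sigma>, x)"
          using act_comp[OF p(2) k x] k_act[OF x] act2[OF \<Gamma> b(2,3) act_el[OF h(2) x] act_el[OF h(3) x]]
          by simp
      qed
      ultimately show "k \<in> ihom U \<Gamma> c (S \<Gamma> b) \<and>
          icomp (prod_icat U U) \<Gamma> (?e \<Gamma> b, fmor diag_functor \<Gamma> k) = h"
        using k by (simp add: s b h)
    next
      fix k' assume "k' \<in> ihom U \<Gamma> c (S \<Gamma> b) \<and>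
          icomp (prod_icat U U) \<Gamma> (?e \<Gamma> b, fmor diag_functor \<Gamma> k') = h"
      then have k': "k' \<in> ihom U \<Gamma> c (S \<Gamma> (a, a'))"
        and e: "icomp U \<Gamma> (p1 \<Gamma> (a, a'), k') = h1" "icomp U \<Gamma> (p2 \<Gamma> (a, a'), k') = h2"
        by (simp_all add: s b h)
      show "k' = k"
      \<comment> \<open>Both projections of \<open>k'\<close> are prescribed, and
        \<open>surj\<close> reassembles its values from them.\<close>
      proof (rule U_hom_eqI[OF k' k])
        fix \<sigma> x assume x: "(\<sigma>, x) \<in> el \<Gamma> c"
        show "act k' (\<sigma>, x) = act k (\<sigma>, x)"
          using surj[OF \<Gamma> b(2,3) act_el[OF k' x]] act_comp[OF p(1) k' x] act_comp[OF p(2) k' x] e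
          by (simp add: k_act[OF x])
      qed
    qed
  qed
  then obtain P \<eta> where P: "fob P = S" "internal_adjunction C U (prod_icat U U) diag_functor P \<eta> ?e"
    by blast
  have PF: "internal_functor C (prod_icat U U) U P"
    and N: "internal_nat_trans C (prod_icat U U) (prod_icat U U) (comp_functor diag_functor P) id_functor ?e"
    using P(2) by (simp_all add: internal_adjunction_def)
  have "act (fmor P \<Gamma> (h, k)) (\<sigma>, pr (Dom C \<sigma>) (x, y)) = pr (Dom C \<sigma>) (act h (\<sigma>, x), act k (\<sigma>, y))"
    if \<Gamma>: "\<Gamma> \<in> Obj C" and h: "h \<in> ihom U \<Gamma> a a'" and k: "k \<in> ihom U \<Gamma> b b'"
      and x: "(\<sigma>, x) \<in> el \<Gamma> a" and y: "(\<sigma>, y) \<in> el \<Gamma> b" for \<Gamma> h k a a' b b' \<sigma> x y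
  proof -
    have hk: "(h, k) \<in> ihom (prod_icat U U) \<Gamma> (a, b) (a', b')" using h k by (simp add: s)
    from internal_functorD(6)[OF PF \<Gamma> hk]
    have Phk: "fmor P \<Gamma> (h, k) \<in> ihom U \<Gamma> (S \<Gamma> (a, b)) (S \<Gamma> (a', b'))" by (simp add: P(1))
    note o = U_hom_ob[OF h] U_hom_ob[OF k]
    \<comment> \<open>The only available handle on \<open>fmor P\<close>: naturality of the counit
      says that its projections are \<open>h\<close> and \<open>k\<close> composed with the
      projections. With \<open>surj\<close> this fixes its values.\<close>
    have e: "icomp U \<Gamma> (p1 \<Gamma> (a', b'), fmor P \<Gamma> (h, k)) = icomp U \<Gamma> (h, p1 \<Gamma> (a, b))"
      "icomp U \<Gamma> (p2 \<Gamma> (a', b'), fmor P \<Gamma> (h, k)) = icomp U \<Gamma> (k, p2 \<Gamma> (a, b))"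
    proof -
      note internal_nat_transD[OF N \<Gamma> hk]
      then show "icomp U \<Gamma> (p1 \<Gamma> (a', b'), fmor P \<Gamma> (h, k)) = icomp U \<Gamma> (h, p1 \<Gamma> (a, b))"
        "icomp U \<Gamma> (p2 \<Gamma> (a', b'), fmor P \<Gamma> (h, k)) = icomp U \<Gamma> (k, p2 \<Gamma> (a, b))"
        by (simp_all add: s comp_functor_def id_functor_def)
    qed
    note z = pr_el[OF x y o(1,3)]
    note p = hom[OF \<Gamma> o(1,3)] and p' = hom[OF \<Gamma> o(2,4)]
    have "act (p1 \<Gamma> (a', b')) (\<sigma>, act (fmor P \<Gamma> (h, k)) (\<sigma>, pr (Dom C \<sigma>) (x, y))) = act h (\<sigma>, x)"
      "act (p2 \<Gamma> (a', b')) (\<sigma>, act (fmor P \<Gamma> (h, k)) (\<sigma>, pr (Dom C \<sigma>) (x, y))) = act k (\<sigma>, y)"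
      using act_comp[OF p'(1) Phk z] act_comp[OF p'(2) Phk z] act_comp[OF h p(1) z] act_comp[OF k p(2) z]
        act1[OF \<Gamma> o(1,3) x y] act2[OF \<Gamma> o(1,3) x y] e by simp_all
    with surj[OF \<Gamma> o(2,4) act_el[OF Phk z]] show ?thesis by simp
  qed
  moreover have "internal_product C U P"
    unfolding internal_product_def internal_right_adjoint_def using P(2) by blast
  ultimately show thesis using PF P(1) that by blast
qed

end

text \<open>\<open>E (a, b)\<close> represents the exponential of the fibres over \<open>a\<close> and \<open>b\<close>, with abstraction \<open>lam\<close>.\<close>

locale psh_map_exp = psh_map_prod +
  fixes E lam
  assumes pb_exp: "is_pullback C (fibre_hom_psh C B A f) (prod_psh A A) B A lam
    (\<lambda>\<Gamma> (a, b, \<phi>). (a, b)) f E"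
begin

section \<open>Codes for exponentials: abstraction, application and evaluation\<close>

lemmas E_nat = is_pullbackD(4)[OF C pb_exp]

lemma E_ob: "\<Gamma> \<in> Obj C \<Longrightarrow> a \<in> sect A \<Gamma> \<Longrightarrow> b \<in> sect A \<Gamma> \<Longrightarrow> E \<Gamma> (a, b) \<in> sect A \<Gamma>"
  using nat_trans_simps(1)[OF E_nat] by (simp add: prod_psh_simps)

lemma E_restr:
  assumes "\<tau> \<in> Arr C" "Cod C \<tau> = \<Gamma>" "a \<in> sect A \<Gamma>" "b \<in> sect A \<Gamma>"
  shows "restr A \<tau> (E \<Gamma> (a, b)) = E (Dom C \<tau>) (restr A \<tau> a, restr A \<tau> b)"
  using nat_trans_simps(2)[OF E_nat assms(1,2) _ refl, of "(a, b)"] assms by (simp add: prod_psh_simps)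

text \<open>Expresses the ends of a morphism through the left leg of the square
  \<open>pb_exp\<close>, the form in which the pullback property can be applied.\<close>

lemma U_hom_ends:
  "h \<in> ihom U \<Gamma> a b \<longleftrightarrow> h \<in> sect (fibre_hom_psh C B A f) \<Gamma> \<and> (case h of (a, b, \<phi>) \<Rightarrow> (a, b)) = (a, b)"
  by (auto simp: ihom_def full_internal_subcategory_def split: prod.splits)

lemma lam_B:
  assumes "\<Gamma> \<in> Obj C" "h \<in> ihom U \<Gamma> a b"
  shows "lam \<Gamma> h \<in> sect B \<Gamma>" "f \<Gamma> (lam \<Gamma> h) = E \<Gamma> (a, b)"
  using assms nat_trans_simps(1)[OF is_pullbackD(1)[OF C pb_exp]] is_pullbackD(5)[OF C pb_exp, of \<Gamma> h]
  by (auto simp: U_hom_ends)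

lemma lam_restr:
  assumes "\<tau> \<in> Arr C" "Cod C \<tau> = \<Gamma>" "h \<in> ihom U \<Gamma> a b"
  shows "restr B \<tau> (lam \<Gamma> h) = lam (Dom C \<tau>) (restr (fibre_hom_psh C B A f) \<tau> h)"
  using nat_trans_simps(2)[OF is_pullbackD(1)[OF C pb_exp] assms(1,2) _ refl, of h] assms(3)
  by (simp add: U_hom_ends)

lemma U_hom_restr:
  assumes "\<tau> \<in> Arr C" "Cod C \<tau> = \<Gamma>" "h \<in> ihom U \<Gamma> a b"
  shows "restr (fibre_hom_psh C B A f) \<tau> h \<in> ihom U (Dom C \<tau>) (restr A \<tau> a) (restr A \<tau> b)"
  using ihom_restr[OF U_icat assms(1), of h a b] assms(2,3) by (simp add: U_simps)

text \<open>Existence says that every term of a function type is an abstraction, uniqueness that its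
  body is determined.\<close>

lemma lam_unique:
  assumes "\<Gamma> \<in> Obj C" "t \<in> sect B \<Gamma>" "f \<Gamma> t = E \<Gamma> (a, b)" "a \<in> sect A \<Gamma>" "b \<in> sect A \<Gamma>"
  shows "\<exists>!h. h \<in> ihom U \<Gamma> a b \<and> lam \<Gamma> h = t"
  using is_pullbackD(6)[OF C pb_exp assms(1), of "(a, b)" t] assms
  by (simp add: U_hom_ends prod_psh_simps conj_assoc)

text \<open>The decoding inverse to \<open>lam\<close>. As with \<open>unpair\<close>, the pair of
  types is needed because \<open>E\<close> may identify codes.\<close>

definition app where
  "app \<Gamma> ab t = (THE h. h \<in> ihom U \<Gamma> (fst ab) (snd ab) \<and> lam \<Gamma> h = t)"

lemma app_hom:
  assumes "\<Gamma> \<in> Obj C" "t \<in> sect B \<Gamma>" "f \<Gamma> t = E \<Gamma> (a, b)" "a \<in> sect A \<Gamma>" "b \<in> sect A \<Gamma>"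
  shows "app \<Gamma> (a, b) t \<in> ihom U \<Gamma> a b" "lam \<Gamma> (app \<Gamma> (a, b) t) = t"
  using theI'[OF lam_unique[OF assms]] by (auto simp: app_def)

lemma app_lam:
  assumes "\<Gamma> \<in> Obj C" "h \<in> ihom U \<Gamma> a b"
  shows "app \<Gamma> (a, b) (lam \<Gamma> h) = h"
  unfolding app_def fst_conv snd_conv
  by (rule the1_equality[OF lam_unique[OF assms(1) lam_B[OF assms] U_hom_ob[OF assms(2)]]])
    (simp add: assms(2))

text \<open>\<open>lam\<close> is natural and \<open>app\<close> is its inverse on each hom set, so
  naturality carries over by uniqueness of the decoded morphism.\<close>

lemma app_restr:
  assumes \<tau>: "\<tau> \<in> Arr C" "Cod C \<tau> = \<Gamma>"
    and t: "t \<in> sect B \<Gamma>" "f \<Gamma> t = E \<Gamma> (a, b)" and ab: "a \<in> sect A \<Gamma>" "b \<in> sect A \<Gamma>"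
  shows "app (Dom C \<tau>) (restr A \<tau> a, restr A \<tau> b) (restr B \<tau> t)
    = restr (fibre_hom_psh C B A f) \<tau> (app \<Gamma> (a, b) t)"
proof -
  have o: "\<Gamma> \<in> Obj C" "Dom C \<tau> \<in> Obj C" using \<tau> by (auto simp: simps)
  note h = app_hom[OF o(1) t ab]
  show ?thesis
    using app_lam[OF o(2) U_hom_restr[OF \<tau> h(1)]] lam_restr[OF \<tau> h(1)] h(2) by simp
qed

lemma U_evaluation:
  obtains ev where "nat_trans C (prod_psh A A) (fibre_hom_psh C B A f) ev"
    and "\<And>\<Gamma> a b. \<Gamma> \<in> Obj C \<Longrightarrow> a \<in> sect A \<Gamma> \<Longrightarrow> b \<in> sect A \<Gamma> \<Longrightarrow>
      ev \<Gamma> (a, b) \<in> ihom U \<Gamma> (S \<Gamma> (a, E \<Gamma> (a, b))) b"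
    and "\<And>\<Gamma> a b \<sigma> x h. \<Gamma> \<in> Obj C \<Longrightarrow> a \<in> sect A \<Gamma> \<Longrightarrow> b \<in> sect A \<Gamma> \<Longrightarrow> (\<sigma>, x) \<in> el \<Gamma> a \<Longrightarrow>
      h \<in> ihom U (Dom C \<sigma>) (restr A \<sigma> a) (restr A \<sigma> b) \<Longrightarrow>
      act (ev \<Gamma> (a, b)) (\<sigma>, pr (Dom C \<sigma>) (x, lam (Dom C \<sigma>) h)) = act h (Id C (Dom C \<sigma>), x)"
proof -
  have fsts: "nat_trans C (prod_psh A A) A (\<lambda>\<Gamma>. fst)" "nat_trans C (prod_psh A A) A (\<lambda>\<Gamma>. snd)"
    by (auto simp: nat_trans_def prod_psh_simps)
  \<comment> \<open>At stage \<Gamma> an argument \<open>s\<close> is the generalised element over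
    the identity; evaluation decodes \<open>t\<close> and applies it there.\<close>
  let ?k = "\<lambda>\<Gamma> y s t. act (app \<Gamma> y t) (Id C \<Gamma>, s)"
  show thesis
  proof (rule prod_hom_family[OF is_presheaf_prod[OF A A] fsts(1) E_nat fsts(2), of ?k], goal_cases)
    case (1 \<Gamma> y s t)
    obtain a b where y: "y = (a, b)" "a \<in> sect A \<Gamma>" "b \<in> sect A \<Gamma>"
      using 1(2) by (cases y) (auto simp: prod_psh_simps)
    have "(Id C \<Gamma>, s) \<in> el \<Gamma> a" using 1 y by (simp add: fibre_id)
    from act_el[OF app_hom(1)[OF 1(1,5) 1(6)[unfolded y(1)] y(2,3)] this]
    show ?case using 1(1) y by (simp add: fibre_id)
  next
    case (2 \<tau> \<Gamma> y s t)
    obtain a b where y: "y = (a, b)" "a \<in> sect A \<Gamma>" "b \<in> sect A \<Gamma>"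
      using 2(3) by (cases y) (auto simp: prod_psh_simps)
    have o: "\<Gamma> \<in> Obj C" "Dom C \<tau> \<in> Obj C" using 2(1,2) by (auto simp: simps)
    note t = 2(6) 2(7)[unfolded y(1)]
    note h = app_hom(1)[OF o(1) t y(2,3)]
    have s: "(Id C \<Gamma>, s) \<in> el \<Gamma> a" using 2(4,5) y o by (simp add: fibre_id)
    have rs: "(Id C (Dom C \<tau>), restr B \<tau> s) \<in> el (Dom C \<tau>) (restr A \<tau> a)"
      using 2(1,2,4,5) y o by (simp add: fibre_id simps)
    show ?case
      using act_natural[OF h s 2(1)] act_restr[OF h rs] app_restr[OF 2(1,2) t y(2,3)] 2(1,2) o y
      by (simp add: prod_psh_simps simps)
  next
    case (3 ev)
    show ?case
    proof (rule that[OF 3(1)], goal_cases)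
      case (1 \<Gamma> a b)
      then show ?case using 3(2)[of \<Gamma> "(a, b)"] by (simp add: prod_psh_simps)
    next
      case (2 \<Gamma> a b \<sigma> x h)
      note s = fibreD[OF 2(4)]
      have o: "Dom C \<sigma> \<in> Obj C" using s by (simp add: simps)
      have "(\<sigma>, lam (Dom C \<sigma>) h) \<in> el \<Gamma> (E \<Gamma> (a, b))"
        using s lam_B[OF o 2(5)] E_restr[OF s(1,2) 2(2,3)] by (intro fibreI) simp_all
      then have "act (ev \<Gamma> (a, b)) (\<sigma>, pr (Dom C \<sigma>) (x, lam (Dom C \<sigma>) h))
          = ?k (Dom C \<sigma>) (restr A \<sigma> a, restr A \<sigma> b) x (lam (Dom C \<sigma>) h)"
        using 3(3)[of \<Gamma> "(a, b)" \<sigma> x] 2(1-4) by (simp add: prod_psh_simps)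
      then show ?case using app_lam[OF o 2(5)] by simp
    qed
  qed
qed

text \<open>The exponential transpose of \<open>h\<close> sends \<open>y\<close> to the abstraction of \<open>curry_at h y\<close>.\<close>

definition curry_at where
  "curry_at \<Gamma> a b h = (\<lambda>(\<sigma>, y). (restr A \<sigma> a, restr A \<sigma> b,
     restrict (\<lambda>(\<tau>, x). act h (Comp C \<sigma> \<tau>, pr (Dom C \<tau>) (x, restr B \<tau> y)))
       (el (Dom C \<sigma>) (restr A \<sigma> a))))"

text \<open>The body at stage \<tau> pairs \<open>x\<close> with \<open>y\<close> restricted along
  \<tau>. Compatibility of pairing with restriction makes this a morphism, and the third equation
  says that currying is natural in the argument \<open>y\<close>, which is what makes the transpose
  a morphism of \<open>U\<close>.\<close>

lemma curry_at:
  assumes h: "h \<in> ihom U \<Gamma> (S \<Gamma> (a, c)) b" and a: "a \<in> sect A \<Gamma>" and c: "c \<in> sect A \<Gamma>"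
    and y: "(\<sigma>, y) \<in> el \<Gamma> c"
  shows "curry_at \<Gamma> a b h (\<sigma>, y) \<in> ihom U (Dom C \<sigma>) (restr A \<sigma> a) (restr A \<sigma> b)"
    "(\<tau>, x) \<in> el (Dom C \<sigma>) (restr A \<sigma> a) \<Longrightarrow>
      act (curry_at \<Gamma> a b h (\<sigma>, y)) (\<tau>, x) = act h (Comp C \<sigma> \<tau>, pr (Dom C \<tau>) (x, restr B \<tau> y))"
    "\<tau> \<in> Arr C \<Longrightarrow> Cod C \<tau> = Dom C \<sigma> \<Longrightarrow> restr (fibre_hom_psh C B A f) \<tau> (curry_at \<Gamma> a b h (\<sigma>, y))
      = curry_at \<Gamma> a b h (Comp C \<sigma> \<tau>, restr B \<tau> y)"
proof -
  note s = fibreD[OF y] and b = U_hom_ob(2)[OF h]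
  have mem: "(Comp C \<sigma> \<tau>, x) \<in> el \<Gamma> a" "(Comp C \<sigma> \<tau>, restr B \<tau> y) \<in> el \<Gamma> c"
    "(Comp C \<sigma> \<tau>, pr (Dom C \<tau>) (x, restr B \<tau> y)) \<in> el \<Gamma> (S \<Gamma> (a, c))"
    if x: "(\<tau>, x) \<in> el (Dom C \<sigma>) (restr A \<sigma> a)" for \<tau> x
  proof -
    note t = fibreD[OF x]
    show ca: "(Comp C \<sigma> \<tau>, x) \<in> el \<Gamma> a" by (rule fibre_reindex[OF s(1,2) a x])
    show cc: "(Comp C \<sigma> \<tau>, restr B \<tau> y) \<in> el \<Gamma> c" by (rule fibre_restr[OF y t(1,2) c])
    show "(Comp C \<sigma> \<tau>, pr (Dom C \<tau>) (x, restr B \<tau> y)) \<in> el \<Gamma> (S \<Gamma> (a, c))"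
      using pr_el[OF ca cc a c] s t by (simp add: simps)
  qed
  have hom: "curry_at \<Gamma> a b h (\<sigma>, y) \<in> ihom U (Dom C \<sigma>) (restr A \<sigma> a) (restr A \<sigma> b)"
    unfolding curry_at_def prod.case
  proof (rule U_homI)
    show "restr A \<sigma> a \<in> sect A (Dom C \<sigma>)" "restr A \<sigma> b \<in> sect A (Dom C \<sigma>)"
      using s a b by (simp_all add: simps)
    fix \<tau> x assume x: "(\<tau>, x) \<in> el (Dom C \<sigma>) (restr A \<sigma> a)"
    note t = fibreD[OF x]
    show "(\<tau>, case (\<tau>, x) of (\<tau>, x) \<Rightarrow> act h (Comp C \<sigma> \<tau>, pr (Dom C \<tau>) (x, restr B \<tau> y)))
        \<in> el (Dom C \<sigma>) (restr A \<sigma> b)"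
      using fibreD[OF act_el[OF h mem(3)[OF x]]] s t b by (simp add: simps fibre_def)
    fix \<rho> assume r: "\<rho> \<in> Arr C" "Cod C \<rho> = Dom C \<tau>"
    have "act h (Comp C (Comp C \<sigma> \<tau>) \<rho>, restr B \<rho> (pr (Dom C \<tau>) (x, restr B \<tau> y)))
        = restr B \<rho> (act h (Comp C \<sigma> \<tau>, pr (Dom C \<tau>) (x, restr B \<tau> y)))"
      using r s t by (intro act_natural[OF h mem(3)[OF x]]) (simp_all add: simps)
    then show "(case (Comp C \<tau> \<rho>, restr B \<rho> x) of
          (\<tau>, x) \<Rightarrow> act h (Comp C \<sigma> \<tau>, pr (Dom C \<tau>) (x, restr B \<tau> y)))
        = restr B \<rho> (case (\<tau>, x) of (\<tau>, x) \<Rightarrow> act h (Comp C \<sigma> \<tau>, pr (Dom C \<tau>) (x, restr B \<tau> y)))"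
      using r s t by (simp add: simps pr_restr)
  qed
  then show "curry_at \<Gamma> a b h (\<sigma>, y) \<in> ihom U (Dom C \<sigma>) (restr A \<sigma> a) (restr A \<sigma> b)" .
  show "act (curry_at \<Gamma> a b h (\<sigma>, y)) (\<tau>, x) = act h (Comp C \<sigma> \<tau>, pr (Dom C \<tau>) (x, restr B \<tau> y))"
    if "(\<tau>, x) \<in> el (Dom C \<sigma>) (restr A \<sigma> a)"
    using that by (simp add: curry_at_def act_restrict)
  assume t: "\<tau> \<in> Arr C" "Cod C \<tau> = Dom C \<sigma>"
  \<comment> \<open>The two sides are extensional functions on syntactically different fibres; these
    have to be identified before the functions can be compared.\<close>
  have eqs: "el (Dom C (Comp C \<sigma> \<tau>)) (restr A (Comp C \<sigma> \<tau>) a) = el (Dom C \<tau>) (restr A \<tau> (restr A \<sigma> a))"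
    using s t a by (simp add: simps)
  have ra: "restr A \<sigma> a \<in> sect A (Dom C \<sigma>)" using s a by (simp add: simps)
  show "restr (fibre_hom_psh C B A f) \<tau> (curry_at \<Gamma> a b h (\<sigma>, y))
      = curry_at \<Gamma> a b h (Comp C \<sigma> \<tau>, restr B \<tau> y)"
  proof -
    have "fibre_map_restr C B A f \<tau> (restr A \<sigma> a)
        (restrict (\<lambda>(\<tau>, x). act h (Comp C \<sigma> \<tau>, pr (Dom C \<tau>) (x, restr B \<tau> y))) (el (Dom C \<sigma>) (restr A \<sigma> a)))
      = restrict (\<lambda>(\<rho>, x). act h (Comp C (Comp C \<sigma> \<tau>) \<rho>, pr (Dom C \<rho>) (x, restr B \<rho> (restr B \<tau> y))))
        (el (Dom C \<tau>) (restr A \<tau> (restr A \<sigma> a)))"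
    proof (rule fibre_maps_eqI[OF fibre_map_restr_ext])
      fix \<rho> x assume x: "(\<rho>, x) \<in> el (Dom C \<tau>) (restr A \<tau> (restr A \<sigma> a))"
      note r = fibreD[OF x]
      from fibre_reindex[OF t ra x] r s t x
      show "fibre_map_restr C B A f \<tau> (restr A \<sigma> a)
        (restrict (\<lambda>(\<tau>, x). act h (Comp C \<sigma> \<tau>, pr (Dom C \<tau>) (x, restr B \<tau> y)))
          (el (Dom C \<sigma>) (restr A \<sigma> a))) (\<rho>, x)
        = restrict (\<lambda>(\<rho>, x). act h (Comp C (Comp C \<sigma> \<tau>) \<rho>, pr (Dom C \<rho>) (x, restr B \<rho> (restr B \<tau> y))))
          (el (Dom C \<tau>) (restr A \<tau> (restr A \<sigma> a))) (\<rho>, x)"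
        by (simp add: fibre_map_restr_apply simps)
    qed simp
    then show ?thesis
      unfolding curry_at_def prod.case eqs using s t a b by (simp add: fibre_hom_psh_def simps)
  qed
qed

text \<open>Evaluation, paired with the unchanged index in the discrete factor, is the counit. A
  transpose exists by currying, and it is unique because every term over \<open>E (a, b)\<close> is
  an abstraction whose body can be recovered by evaluating it.\<close>

lemma U_exponentials:
  assumes P: "internal_functor C (prod_icat U U) U P" "fob P = S"
    and actP: "\<And>\<Gamma> h k a a' b b' \<sigma> x y. \<Gamma> \<in> Obj C \<Longrightarrow> h \<in> ihom U \<Gamma> a a' \<Longrightarrow> k \<in> ihom U \<Gamma> b b' \<Longrightarrow>
      (\<sigma>, x) \<in> el \<Gamma> a \<Longrightarrow> (\<sigma>, y) \<in> el \<Gamma> b \<Longrightarrow>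
      act (fmor P \<Gamma> (h, k)) (\<sigma>, pr (Dom C \<sigma>) (x, y)) = pr (Dom C \<sigma>) (act h (\<sigma>, x), act k (\<sigma>, y))"
  shows "has_internal_exponentials C U P"
proof -
  obtain ev where ev: "nat_trans C (prod_psh A A) (fibre_hom_psh C B A f) ev"
    and ev_hom: "\<And>\<Gamma> a b. \<Gamma> \<in> Obj C \<Longrightarrow> a \<in> sect A \<Gamma> \<Longrightarrow> b \<in> sect A \<Gamma> \<Longrightarrow>
      ev \<Gamma> (a, b) \<in> ihom U \<Gamma> (S \<Gamma> (a, E \<Gamma> (a, b))) b"
    and ev_act: "\<And>\<Gamma> a b \<sigma> x h. \<Gamma> \<in> Obj C \<Longrightarrow> a \<in> sect A \<Gamma> \<Longrightarrow> b \<in> sect A \<Gamma> \<Longrightarrow> (\<sigma>, x) \<in> el \<Gamma> a \<Longrightarrow>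
      h \<in> ihom U (Dom C \<sigma>) (restr A \<sigma> a) (restr A \<sigma> b) \<Longrightarrow>
      act (ev \<Gamma> (a, b)) (\<sigma>, pr (Dom C \<sigma>) (x, lam (Dom C \<sigma>) h)) = act h (Id C (Dom C \<sigma>), x)"
    by (rule U_evaluation) blast
  let ?D = "prod_icat (discrete_icat (iob U)) U"
  let ?F = "prod_functor U P"
  let ?g = "\<lambda>\<Gamma> (a, b). (a, E \<Gamma> (a, b))"
  let ?e = "\<lambda>\<Gamma> (a, b). (a, ev \<Gamma> (a, b))"
  let ?P = "\<lambda>\<Gamma> a k. fmor P \<Gamma> (iid U \<Gamma> a, k)"
  note s = prod_icat_simps discrete_icat_simps prod_psh_simps U_simps prod_functor_def
  have Pk: "?P \<Gamma> a k \<in> ihom U \<Gamma> (S \<Gamma> (a, c)) (S \<Gamma> (a, d))"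
    if "\<Gamma> \<in> Obj C" "a \<in> sect A \<Gamma>" "k \<in> ihom U \<Gamma> c d" for \<Gamma> a c d k
    using internal_functorD(6)[OF P(1) that(1), of "(iid U \<Gamma> a, k)" "(a, c)" "(a, d)"]
      iid_ihom[OF U_icat that(1), of a] that by (simp add: s P(2))
  \<comment> \<open>The beta law for an arbitrary \<open>k\<close>: if \<open>k\<close> sends
    \<open>y\<close> to the abstraction of \<open>n\<close>, then the untransposed morphism sends
    the pair of \<open>x\<close> and \<open>y\<close> to \<open>n\<close> applied to
    \<open>x\<close>.\<close>
  have beta: "act (icomp U \<Gamma> (ev \<Gamma> (a, b), ?P \<Gamma> a k)) (\<sigma>, pr (Dom C \<sigma>) (x, y)) = act n (Id C (Dom C \<sigma>), x)"
    if \<Gamma>: "\<Gamma> \<in> Obj C" and a: "a \<in> sect A \<Gamma>" and b: "b \<in> sect A \<Gamma>"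
      and k: "k \<in> ihom U \<Gamma> c (E \<Gamma> (a, b))"
      and x: "(\<sigma>, x) \<in> el \<Gamma> a" and y: "(\<sigma>, y) \<in> el \<Gamma> c"
      and n: "n \<in> ihom U (Dom C \<sigma>) (restr A \<sigma> a) (restr A \<sigma> b)" "act k (\<sigma>, y) = lam (Dom C \<sigma>) n"
    for \<Gamma> a b c k \<sigma> x y n
  proof -
    note i = iid_ihom[OF U_icat \<Gamma>, of a, unfolded U_simps, OF a]
    have "act (?P \<Gamma> a k) (\<sigma>, pr (Dom C \<sigma>) (x, y)) = pr (Dom C \<sigma>) (x, lam (Dom C \<sigma>) n)"
      using actP[OF \<Gamma> i k x y] act_id[OF x] n(2) by simp
    then show ?thesis
      using act_comp[OF ev_hom[OF \<Gamma> a b] Pk[OF \<Gamma> a k] pr_el[OF x y a U_hom_ob(1)[OF k]]]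
        ev_act[OF \<Gamma> a b x n(1)] by simp
  qed
  have "\<exists>G \<eta>. fob G = ?g \<and> internal_adjunction C ?D ?D ?F G \<eta> ?e"
  proof (rule internal_right_adjointI[OF C internal_functor_prod_functor[OF C P(1)]])
    show "nat_trans C (iob ?D) (iob ?D) ?g" using E_nat by (auto simp: s nat_trans_def)
    show "nat_trans C (iob ?D) (imor ?D) ?e" using ev by (auto simp: s nat_trans_def)
  next
    fix \<Gamma> b assume "\<Gamma> \<in> Obj C" "b \<in> sect (iob ?D) \<Gamma>"
    then show "?e \<Gamma> b \<in> ihom ?D \<Gamma> (fob ?F \<Gamma> (?g \<Gamma> b)) b"
      using ev_hom by (cases b) (simp add: s P(2))
  next
    fix \<Gamma> p q m assume \<Gamma>: "\<Gamma> \<in> Obj C" and pq: "p \<in> sect (iob ?D) \<Gamma>" "q \<in> sect (iob ?D) \<Gamma>"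
      and m': "m \<in> ihom ?D \<Gamma> (fob ?F \<Gamma> p) q"
    obtain a c where p: "p = (a, c)" by (cases p)
    obtain a' b where q': "q = (a', b)" by (cases q)
    obtain a'' h where m'': "m = (a'', h)" by (cases m)
    have a: "a \<in> sect A \<Gamma>" and b: "b \<in> sect A \<Gamma>" and c: "c \<in> sect A \<Gamma>"
      using pq by (simp_all add: s p q')
    \<comment> \<open>An arrow of the discrete factor is an identity, so its existence forces
      \<open>a' = a\<close> and \<open>a'' = a\<close>.\<close>
    have h: "h \<in> ihom U \<Gamma> (S \<Gamma> (a, c)) b" and q: "q = (a, b)" and m: "m = (a, h)"
      using m' by (auto simp: s P(2) p q' m'')
    note cur = curry_at[OF h a c]
    \<comment> \<open>The exponential transpose, sending \<open>y\<close> to the abstraction of the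
      morphism that \<open>h\<close> gives when \<open>y\<close> is held fixed.\<close>
    define k where "k = (c, E \<Gamma> (a, b),
      restrict (\<lambda>z. lam (Dom C (fst z)) (curry_at \<Gamma> a b h z)) (el \<Gamma> c))"
    have k: "k \<in> ihom U \<Gamma> c (E \<Gamma> (a, b))"
      unfolding k_def
    proof (rule U_homI[OF c E_ob[OF \<Gamma> a b]])
      fix \<sigma> y assume y: "(\<sigma>, y) \<in> el \<Gamma> c"
      note t = fibreD[OF y]
      have o: "Dom C \<sigma> \<in> Obj C" using t by (simp add: simps)
      show "(\<sigma>, lam (Dom C (fst (\<sigma>, y))) (curry_at \<Gamma> a b h (\<sigma>, y))) \<in> el \<Gamma> (E \<Gamma> (a, b))"
        using t lam_B[OF o cur(1)[OF y]] E_restr[OF t(1,2) a b] by (intro fibreI) simp_all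
      fix \<tau> assume r: "\<tau> \<in> Arr C" "Cod C \<tau> = Dom C \<sigma>"
      show "lam (Dom C (fst (Comp C \<sigma> \<tau>, restr B \<tau> y))) (curry_at \<Gamma> a b h (Comp C \<sigma> \<tau>, restr B \<tau> y))
          = restr B \<tau> (lam (Dom C (fst (\<sigma>, y))) (curry_at \<Gamma> a b h (\<sigma>, y)))"
        using lam_restr[OF r cur(1)[OF y]] cur(3)[OF y r] t r by (simp add: simps)
    qed
    have k_act: "act k (\<sigma>, y) = lam (Dom C \<sigma>) (curry_at \<Gamma> a b h (\<sigma>, y))" if "(\<sigma>, y) \<in> el \<Gamma> c" for \<sigma> y
      unfolding k_def using that by (simp add: act_restrict)
    have beta_k: "icomp U \<Gamma> (ev \<Gamma> (a, b), ?P \<Gamma> a k) = h"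
    proof (rule U_hom_eqI[OF icomp_ihom[OF U_icat \<Gamma> ev_hom[OF \<Gamma> a b] Pk[OF \<Gamma> a k]] h])
      fix \<sigma> z assume z: "(\<sigma>, z) \<in> el \<Gamma> (S \<Gamma> (a, c))"
      obtain x y where x: "(\<sigma>, x) \<in> el \<Gamma> a" and y: "(\<sigma>, y) \<in> el \<Gamma> c" and zxy: "z = pr (Dom C \<sigma>) (x, y)"
        by (rule el_prodE[OF z a c])
      note t = fibreD[OF x] fibreD[OF y]
      have "(Id C (Dom C \<sigma>), x) \<in> el (Dom C \<sigma>) (restr A \<sigma> a)"
        using t a by (simp add: fibre_id simps)
      from cur(2)[OF y this] beta[OF \<Gamma> a b k x y cur(1)[OF y] k_act[OF y]]
      show "act (icomp U \<Gamma> (ev \<Gamma> (a, b), ?P \<Gamma> a k)) (\<sigma>, z) = act h (\<sigma>, z)"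
        using t by (simp add: zxy simps)
    qed
    have uniq: "k' = k"
      if k': "k' \<in> ihom U \<Gamma> c (E \<Gamma> (a, b))" and e: "icomp U \<Gamma> (ev \<Gamma> (a, b), ?P \<Gamma> a k') = h" for k'
    proof (rule U_hom_eqI[OF k' k])
      fix \<sigma> y assume y: "(\<sigma>, y) \<in> el \<Gamma> c"
      note t = fibreD[OF y] fibreD[OF act_el[OF k' y]]
      have o: "Dom C \<sigma> \<in> Obj C" using t by (simp add: simps)
      have ra: "restr A \<sigma> a \<in> sect A (Dom C \<sigma>)" "restr A \<sigma> b \<in> sect A (Dom C \<sigma>)"
        using t a b by (simp_all add: simps)
      have "f (Dom C \<sigma>) (act k' (\<sigma>, y)) = E (Dom C \<sigma>) (restr A \<sigma> a, restr A \<sigma> b)"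
        using t(8) E_restr[OF t(1,2) a b] by simp
      from ex1_implies_ex[OF lam_unique[OF o t(7) this ra]]
      \<comment> \<open>The value of a competing transpose is itself an abstraction; it remains to
        show that its body \<open>n\<close> is the curried one.\<close>
      obtain n where n: "n \<in> ihom U (Dom C \<sigma>) (restr A \<sigma> a) (restr A \<sigma> b)" "lam (Dom C \<sigma>) n = act k' (\<sigma>, y)"
        by blast
      have "n = curry_at \<Gamma> a b h (\<sigma>, y)"
      proof (rule U_hom_eqI[OF n(1) cur(1)[OF y]])
        fix \<tau> x assume x: "(\<tau>, x) \<in> el (Dom C \<sigma>) (restr A \<sigma> a)"
        note r = fibreD[OF x]
        have cx: "(Comp C \<sigma> \<tau>, x) \<in> el \<Gamma> a" by (rule fibre_reindex[OF t(1,2) a x])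
        have cy: "(Comp C \<sigma> \<tau>, restr B \<tau> y) \<in> el \<Gamma> c" by (rule fibre_restr[OF y r(1,2) c])
        have D: "Dom C (Comp C \<sigma> \<tau>) = Dom C \<tau>" using t r by (simp add: simps)
        have rn: "restr (fibre_hom_psh C B A f) \<tau> n
            \<in> ihom U (Dom C (Comp C \<sigma> \<tau>)) (restr A (Comp C \<sigma> \<tau>) a) (restr A (Comp C \<sigma> \<tau>) b)"
          using U_hom_restr[OF r(1,2) n(1)] t r a b by (simp add: simps)
        \<comment> \<open>To evaluate \<open>n\<close> at \<open>(\<tau>, x)\<close>, everything is
          restricted along \<tau>, where \<open>beta\<close> applies to the restricted body.
          \<open>act_via_id\<close> then returns to \<open>n\<close>.\<close>
        have "act k' (Comp C \<sigma> \<tau>, restr B \<tau> y) = lam (Dom C (Comp C \<sigma> \<tau>)) (restr (fibre_hom_psh C B A f) \<tau> n)"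
          using act_natural[OF k' y r(1,2)] lam_restr[OF r(1,2) n(1)] n(2) D by simp
        from beta[OF \<Gamma> a b k' cx cy rn this]
        have "act h (Comp C \<sigma> \<tau>, pr (Dom C \<tau>) (x, restr B \<tau> y))
            = act (restr (fibre_hom_psh C B A f) \<tau> n) (Id C (Dom C \<tau>), x)"
          by (simp add: e D)
        also have "\<dots> = act n (\<tau>, x)" using act_via_id(2)[OF n(1) x] by simp
        finally show "act n (\<tau>, x) = act (curry_at \<Gamma> a b h (\<sigma>, y)) (\<tau>, x)"
          using cur(2)[OF y x] by simp
      qed
      then show "act k' (\<sigma>, y) = act k (\<sigma>, y)" using n(2) k_act[OF y] by simp
    qed
    show "\<exists>!k. k \<in> ihom ?D \<Gamma> p (?g \<Gamma> q) \<and> icomp ?D \<Gamma> (?e \<Gamma> q, fmor ?F \<Gamma> k) = m"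
    proof (rule ex1I[of _ "(a, k)"])
      show "(a, k) \<in> ihom ?D \<Gamma> p (?g \<Gamma> q) \<and> icomp ?D \<Gamma> (?e \<Gamma> q, fmor ?F \<Gamma> (a, k)) = m"
        using a k beta_k by (simp add: s p q m)
    next
      fix l assume l: "l \<in> ihom ?D \<Gamma> p (?g \<Gamma> q) \<and> icomp ?D \<Gamma> (?e \<Gamma> q, fmor ?F \<Gamma> l) = m"
      obtain d k' where l': "l = (d, k')" by (cases l)
      \<comment> \<open>The index component of a competing transpose is again forced by
        discreteness, so only the second component is compared.\<close>
      have d: "a = d" and k': "k' \<in> ihom U \<Gamma> c (E \<Gamma> (a, b))"
        using conjunct1[OF l] unfolding p q l' by (auto simp: s)
      have "icomp U \<Gamma> (ev \<Gamma> (a, b), ?P \<Gamma> a k') = h"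
        using conjunct2[OF l] unfolding q m l' d[symmetric] by (simp add: s)
      from uniq[OF k' this] show "l = (a, k)" using l' d by simp
    qed
  qed
  then show ?thesis unfolding has_internal_exponentials_def internal_right_adjoint_def by blast
qed

end

text \<open>The whole argument reduced to three closure conditions on a map of presheaves: codes for
  the one-element fibre, for binary products of fibres and for exponentials of fibres.\<close>

lemma (in psh_map) full_internal_subcategory_cartesian_closed:
  assumes unit: "is_pullback C terminal_psh terminal_psh B A s (\<lambda>\<Gamma> x. x) f e"
    and prod: "is_pullback C (prod_psh B B) (prod_psh A A) B A pr (\<lambda>\<Gamma>. map_prod (f \<Gamma>) (f \<Gamma>)) f S"
    and exp: "is_pullback C (fibre_hom_psh C B A f) (prod_psh A A) B A lam (\<lambda>\<Gamma> (a, b, \<phi>). (a, b)) f E"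
  shows "internally_cartesian_closed C (full_internal_subcategory C B A f)"
proof -
  interpret psh_map_exp C B A f S pr E lam
    using prod exp by unfold_locales
  obtain P where P: "internal_product C U P" "internal_functor C (prod_icat U U) U P" "fob P = S"
    "\<And>\<Gamma> h k a a' b b' \<sigma> x y. \<Gamma> \<in> Obj C \<Longrightarrow> h \<in> ihom U \<Gamma> a a' \<Longrightarrow> k \<in> ihom U \<Gamma> b b' \<Longrightarrow>
      (\<sigma>, x) \<in> el \<Gamma> a \<Longrightarrow> (\<sigma>, y) \<in> el \<Gamma> b \<Longrightarrow>
      act (fmor P \<Gamma> (h, k)) (\<sigma>, pr (Dom C \<sigma>) (x, y))
        = pr (Dom C \<sigma>) (act h (\<sigma>, x), act k (\<sigma>, y))"
    using U_product by blast
  have "has_internal_exponentials C U P" using P(2-4) by (rule U_exponentials)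
  then show ?thesis
    unfolding internally_cartesian_closed_def using U_icat U_terminal[OF unit] P(1) by blast
qed

section \<open>Simple types in a natural model\<close>

context psh_map
begin

text \<open>Weakening of the type \<open>b\<close> along \<open>a\<close>. The value at
  \<open>(\<sigma>, x)\<close> ignores \<open>x\<close>, but \<open>b\<close> must still be
  restricted to the stage at which \<open>x\<close> lives.\<close>

definition const_fam where
  "const_fam \<Gamma> = (\<lambda>(a, b). (a, restrict (\<lambda>(\<sigma>, x). restr A \<sigma> b) (el \<Gamma> a)))"

lemma nat_trans_const_fam: "nat_trans C (prod_psh A A) (poly_psh C B A f A) const_fam"
proof (rule nat_transI)
  fix \<Gamma> ab assume "\<Gamma> \<in> Obj C" "ab \<in> sect (prod_psh A A) \<Gamma>"
  then obtain a b where ab: "ab = (a, b)" "a \<in> sect A \<Gamma>" "b \<in> sect A \<Gamma>"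
    by (cases ab) (auto simp: prod_psh_simps)
  have "restrict (\<lambda>(\<sigma>, x). restr A \<sigma> b) (el \<Gamma> a) \<in> fibre_maps C B A f A \<Gamma> a"
  proof (rule fibre_mapsI)
    fix \<sigma> x assume x: "(\<sigma>, x) \<in> el \<Gamma> a"
    note s = fibreD[OF x]
    show "restrict (\<lambda>(\<sigma>, x). restr A \<sigma> b) (el \<Gamma> a) (\<sigma>, x) \<in> sect A (Dom C \<sigma>)"
      using s x ab by (simp add: simps)
    fix \<tau> assume t: "\<tau> \<in> Arr C" "Cod C \<tau> = Dom C \<sigma>"
    show "restrict (\<lambda>(\<sigma>, x). restr A \<sigma> b) (el \<Gamma> a) (Comp C \<sigma> \<tau>, restr B \<tau> x)
        = restr A \<tau> (restrict (\<lambda>(\<sigma>, x). restr A \<sigma> b) (el \<Gamma> a) (\<sigma>, x))"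
      using s t x ab fibre_restr[OF x t] by (simp add: simps)
  qed simp
  then show "const_fam \<Gamma> ab \<in> sect (poly_psh C B A f A) \<Gamma>"
    using ab by (simp add: const_fam_def poly_psh_def)
next
  fix \<tau> ab assume t: "\<tau> \<in> Arr C" and "ab \<in> sect (prod_psh A A) (Cod C \<tau>)"
  then obtain a b where ab: "ab = (a, b)" "a \<in> sect A (Cod C \<tau>)" "b \<in> sect A (Cod C \<tau>)"
    by (cases ab) (auto simp: prod_psh_simps)
  have "restrict (\<lambda>(\<sigma>, x). restr A \<sigma> (restr A \<tau> b)) (el (Dom C \<tau>) (restr A \<tau> a))
      = fibre_map_restr C B A f \<tau> a (restrict (\<lambda>(\<sigma>, x). restr A \<sigma> b) (el (Cod C \<tau>) a))"
  proof (rule fibre_maps_eqI[OF _ fibre_map_restr_ext])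
    fix \<sigma> x assume x: "(\<sigma>, x) \<in> el (Dom C \<tau>) (restr A \<tau> a)"
    from fibreD[OF x] fibre_reindex[OF t refl ab(2) x] x t ab
    show "restrict (\<lambda>(\<sigma>, x). restr A \<sigma> (restr A \<tau> b)) (el (Dom C \<tau>) (restr A \<tau> a)) (\<sigma>, x)
      = fibre_map_restr C B A f \<tau> a (restrict (\<lambda>(\<sigma>, x). restr A \<sigma> b) (el (Cod C \<tau>) a)) (\<sigma>, x)"
      by (simp add: fibre_map_restr_apply simps)
  qed simp
  then show "const_fam (Dom C \<tau>) (restr (prod_psh A A) \<tau> ab)
      = restr (poly_psh C B A f A) \<tau> (const_fam (Cod C \<tau>) ab)"
    by (simp add: const_fam_def poly_psh_def prod_psh_simps ab)
qed

end

section \<open>Dependent type formers at constant families\<close>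

context
  fixes M :: "('o, 'm, 'u, 'd) natural_model"
  assumes M: "is_natural_model M"
begin

interpretation psh_map "ctx M" "Tm M" "Ty M" "ty_of M"
  using M by unfold_locales (simp_all add: is_natural_model_def)

text \<open>Over the identity arrow a constant family returns \<open>b\<close> itself, so the typing
  condition on the second component of a dependent pair becomes that of a simple pair.\<close>

lemma const_fam_apply:
  assumes "\<Gamma> \<in> Obj (ctx M)" "x \<in> sect (Tm M) \<Gamma>" "b \<in> sect (Ty M) \<Gamma>"
  shows "snd (const_fam \<Gamma> (ty_of M \<Gamma> x, b)) (Id (ctx M) \<Gamma>, x) = b"
  using assms by (simp add: const_fam_def fibre_id simps)

text \<open>Over a constant family a quadruple of types and terms is determined by the two terms,
  whose types can be read off. Hence the pairs of terms form the pullback of \<open>pair_psh\<close>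
  along \<open>const_fam\<close>, and pasting with the square for sums gives the product
  codes.\<close>

lemma simple_sum_types:
  assumes "admits_sum_types M"
  obtains S pr where "is_pullback (ctx M) (prod_psh (Tm M) (Tm M)) (prod_psh (Ty M) (Ty M)) (Tm M) (Ty M)
    pr (\<lambda>\<Gamma>. map_prod (ty_of M \<Gamma>) (ty_of M \<Gamma>)) (ty_of M) S"
proof -
  obtain Sig pair where sig: "is_pullback (ctx M) (pair_psh M) (fam_psh M (Ty M)) (Tm M) (Ty M)
        pair (\<lambda>\<Gamma>. fst) (ty_of M) Sig"
    using assms by (auto simp: admits_sum_types_def)
  note W = is_presheaf_prod[OF B B]
  have ty2: "nat_trans (ctx M) (prod_psh (Tm M) (Tm M)) (prod_psh (Ty M) (Ty M))
      (\<lambda>\<Gamma>. map_prod (ty_of M \<Gamma>) (ty_of M \<Gamma>))"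
    by (rule nat_transI) (auto simp: prod_psh_simps simps)
  have c: "const_fam \<Gamma> (ty_of M \<Gamma> x, ty_of M \<Gamma> y) \<in> sect (fam_psh M (Ty M)) \<Gamma>"
    if "\<Gamma> \<in> Obj (ctx M)" "x \<in> sect (Tm M) \<Gamma>" "y \<in> sect (Tm M) \<Gamma>" for \<Gamma> x y
    using that nat_trans_simps(1)[OF nat_trans_const_fam] by (simp add: prod_psh_simps simps)
  have "is_pullback (ctx M) (prod_psh (Tm M) (Tm M)) (prod_psh (Ty M) (Ty M))
      (pair_psh M) (fam_psh M (Ty M)) (\<lambda>\<Gamma> (x, y). (const_fam \<Gamma> (ty_of M \<Gamma> x, ty_of M \<Gamma> y), x, y))
      (\<lambda>\<Gamma>. map_prod (ty_of M \<Gamma>) (ty_of M \<Gamma>)) (\<lambda>\<Gamma>. fst) const_fam"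
  proof (rule is_pullbackI[OF C W _ ty2 is_pullbackD(2)[OF C sig] nat_trans_const_fam])
    show "nat_trans (ctx M) (prod_psh (Tm M) (Tm M)) (pair_psh M)
        (\<lambda>\<Gamma> (x, y). (const_fam \<Gamma> (ty_of M \<Gamma> x, ty_of M \<Gamma> y), x, y))"
    proof (rule nat_transI)
      fix \<Gamma> w assume \<Gamma>: "\<Gamma> \<in> Obj (ctx M)" and "w \<in> sect (prod_psh (Tm M) (Tm M)) \<Gamma>"
      then obtain x y where w: "w = (x, y)" "x \<in> sect (Tm M) \<Gamma>" "y \<in> sect (Tm M) \<Gamma>"
        by (cases w) (auto simp: prod_psh_simps)
      show "(\<lambda>(x, y). (const_fam \<Gamma> (ty_of M \<Gamma> x, ty_of M \<Gamma> y), x, y)) w \<in> sect (pair_psh M) \<Gamma>"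
        using \<Gamma> w c[OF \<Gamma> w(2,3)] const_fam_apply[OF \<Gamma> w(2), of "ty_of M \<Gamma> y"]
        by (simp add: pair_psh_def const_fam_def simps)
    next
      fix \<tau> w assume t: "\<tau> \<in> Arr (ctx M)" and "w \<in> sect (prod_psh (Tm M) (Tm M)) (Cod (ctx M) \<tau>)"
      then obtain x y where w: "w = (x, y)" "x \<in> sect (Tm M) (Cod (ctx M) \<tau>)" "y \<in> sect (Tm M) (Cod (ctx M) \<tau>)"
        by (cases w) (auto simp: prod_psh_simps)
      show "(\<lambda>(x, y). (const_fam (Dom (ctx M) \<tau>) (ty_of M (Dom (ctx M) \<tau>) x, ty_of M (Dom (ctx M) \<tau>) y), x, y))
            (restr (prod_psh (Tm M) (Tm M)) \<tau> w)
          = restr (pair_psh M) \<tau> ((\<lambda>(x, y). (const_fam (Cod (ctx M) \<tau>)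
              (ty_of M (Cod (ctx M) \<tau>) x, ty_of M (Cod (ctx M) \<tau>) y), x, y)) w)"
        using w t nat_trans_simps(2)[OF nat_trans_const_fam t refl _ refl,
            of "(ty_of M (Cod (ctx M) \<tau>) x, ty_of M (Cod (ctx M) \<tau>) y)"]
        by (simp add: pair_psh_def prod_psh_simps simps)
    qed
  next
    fix \<Gamma> w assume "\<Gamma> \<in> Obj (ctx M)" "w \<in> sect (prod_psh (Tm M) (Tm M)) \<Gamma>"
    then show "const_fam \<Gamma> (map_prod (ty_of M \<Gamma>) (ty_of M \<Gamma>) w)
        = fst ((\<lambda>(x, y). (const_fam \<Gamma> (ty_of M \<Gamma> x, ty_of M \<Gamma> y), x, y)) w)"
      by (cases w) simp
  next
    fix \<Gamma> ab z assume \<Gamma>: "\<Gamma> \<in> Obj (ctx M)" and ab: "ab \<in> sect (prod_psh (Ty M) (Ty M)) \<Gamma>"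
      and z: "z \<in> sect (pair_psh M) \<Gamma>" and e: "const_fam \<Gamma> ab = fst z"
    obtain a b where ab': "ab = (a, b)" "a \<in> sect (Ty M) \<Gamma>" "b \<in> sect (Ty M) \<Gamma>"
      using ab by (cases ab) (auto simp: prod_psh_simps)
    obtain x y where z': "z = (const_fam \<Gamma> (a, b), x, y)" using e ab' by (cases z) auto
    have x: "x \<in> sect (Tm M) \<Gamma>" "ty_of M \<Gamma> x = a" and y: "y \<in> sect (Tm M) \<Gamma>"
      and "ty_of M \<Gamma> y = snd (const_fam \<Gamma> (a, b)) (Id (ctx M) \<Gamma>, x)"
      using z by (auto simp: z' pair_psh_def const_fam_def)
    \<comment> \<open>The dependent typing condition evaluates the family at the identity arrow and
      the first term, where a constant family gives back \<open>b\<close>.\<close>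
    then have "ty_of M \<Gamma> y = b" using const_fam_apply[OF \<Gamma> x(1) ab'(3)] by simp
    then show "\<exists>!w. w \<in> sect (prod_psh (Tm M) (Tm M)) \<Gamma> \<and> map_prod (ty_of M \<Gamma>) (ty_of M \<Gamma>) w = ab \<and>
        (\<lambda>(x, y). (const_fam \<Gamma> (ty_of M \<Gamma> x, ty_of M \<Gamma> y), x, y)) w = z"
      using x y by (intro ex1I[of _ "(x, y)"]) (auto simp: prod_psh_simps z' ab')
  qed
  from is_pullback_paste[OF C W sig this] show thesis by (rule that)
qed

text \<open>A family of terms indexed by the fibre over \<open>a\<close> whose types are constantly
  \<open>b\<close> is precisely a map from that fibre to the fibre over \<open>b\<close>. So the
  object of morphisms is the pullback of \<open>fam_ty_of\<close> along \<open>const_fam\<close>,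
  and pasting gives the exponential codes.\<close>

lemma simple_product_types:
  assumes "admits_product_types M"
  obtains E lam where "is_pullback (ctx M) (fibre_hom_psh (ctx M) (Tm M) (Ty M) (ty_of M))
    (prod_psh (Ty M) (Ty M)) (Tm M) (Ty M) lam (\<lambda>\<Gamma> (a, b, \<phi>). (a, b)) (ty_of M) E"
proof -
  let ?H = "fibre_hom_psh (ctx M) (Tm M) (Ty M) (ty_of M)"
  obtain Pi lam where pi: "is_pullback (ctx M) (fam_psh M (Tm M)) (fam_psh M (Ty M)) (Tm M) (Ty M)
        lam (fam_ty_of M) (ty_of M) Pi"
    using assms by (auto simp: admits_product_types_def)
  \<comment> \<open>Both families are restricted to the same fibre, so equality of the functions is
    equality at each of its elements.\<close>
  have over: "const_fam \<Gamma> (a, b) = fam_ty_of M \<Gamma> (a, \<phi>) \<longleftrightarrow>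
      (\<forall>(\<sigma>, x) \<in> el \<Gamma> a. ty_of M (Dom (ctx M) \<sigma>) (\<phi> (\<sigma>, x)) = restr (Ty M) \<sigma> b)" for \<Gamma> a b \<phi>
    by (auto simp: const_fam_def fam_ty_of_def restrict_def fun_eq_iff)
  \<comment> \<open>With \<open>over\<close>, the condition defining \<open>fibre_hom_psh\<close> is
    literally the condition for the fibre product.\<close>
  have mem: "(a, b, \<phi>) \<in> sect ?H \<Gamma> \<longleftrightarrow> a \<in> sect (Ty M) \<Gamma> \<and> b \<in> sect (Ty M) \<Gamma> \<and>
      (a, \<phi>) \<in> sect (fam_psh M (Tm M)) \<Gamma> \<and> const_fam \<Gamma> (a, b) = fam_ty_of M \<Gamma> (a, \<phi>)" for \<Gamma> a b \<phi>
    unfolding over by (auto simp: fibre_hom_psh_def poly_psh_def)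
  have "is_pullback (ctx M) ?H (prod_psh (Ty M) (Ty M)) (fam_psh M (Tm M)) (fam_psh M (Ty M))
      (\<lambda>\<Gamma> (a, b, \<phi>). (a, \<phi>)) (\<lambda>\<Gamma> (a, b, \<phi>). (a, b)) (fam_ty_of M) const_fam"
  proof (rule is_pullbackI[OF C is_presheaf_fibre_hom _ _ is_pullbackD(2)[OF C pi] nat_trans_const_fam])
    show "nat_trans (ctx M) ?H (fam_psh M (Tm M)) (\<lambda>\<Gamma> (a, b, \<phi>). (a, \<phi>))"
      unfolding nat_trans_def by (auto simp: fibre_hom_psh_def poly_psh_def)
    show "nat_trans (ctx M) ?H (prod_psh (Ty M) (Ty M)) (\<lambda>\<Gamma> (a, b, \<phi>). (a, b))"
      unfolding nat_trans_def by (auto simp: fibre_hom_psh_def prod_psh_simps)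
  next
    fix \<Gamma> w assume "\<Gamma> \<in> Obj (ctx M)" "w \<in> sect ?H \<Gamma>"
    then show "const_fam \<Gamma> (case w of (a, b, \<phi>) \<Rightarrow> (a, b)) = fam_ty_of M \<Gamma> (case w of (a, b, \<phi>) \<Rightarrow> (a, \<phi>))"
      by (cases w) (simp add: mem)
  next
    fix \<Gamma> ab t assume \<Gamma>: "\<Gamma> \<in> Obj (ctx M)" and ab: "ab \<in> sect (prod_psh (Ty M) (Ty M)) \<Gamma>"
      and t: "t \<in> sect (fam_psh M (Tm M)) \<Gamma>" and e: "const_fam \<Gamma> ab = fam_ty_of M \<Gamma> t"
    obtain a b \<phi> where ab': "ab = (a, b)" "t = (a, \<phi>)"
      using e by (cases ab, cases t) (auto simp: const_fam_def fam_ty_of_def)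
    show "\<exists>!w. w \<in> sect ?H \<Gamma> \<and> (case w of (a, b, \<phi>) \<Rightarrow> (a, b)) = ab \<and>
        (case w of (a, b, \<phi>) \<Rightarrow> (a, \<phi>)) = t"
      by (rule ex1I[of _ "(a, b, \<phi>)"]) (use ab t e in \<open>auto simp: mem ab' prod_psh_simps\<close>)
  qed
  from is_pullback_paste[OF C is_presheaf_fibre_hom pi this] show thesis by (rule that)
qed

end

theorem theorem3p1p10:
  fixes M :: "('o, 'm, 'u, 'd) natural_model"
  assumes "is_natural_model M"
    and "admits_unit_type M"
    and "admits_sum_types M"
    and "admits_product_types M"
  shows "internally_cartesian_closed (ctx M)
           (full_internal_subcategory (ctx M) (Tm M) (Ty M) (ty_of M))"
proof -
  interpret psh_map "ctx M" "Tm M" "Ty M" "ty_of M"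
    using assms(1) by unfold_locales (simp_all add: is_natural_model_def)
  obtain one star where unit: "is_pullback (ctx M) terminal_psh terminal_psh (Tm M) (Ty M)
        star (\<lambda>\<Gamma> x. x) (ty_of M) one"
    using assms(2) by (auto simp: admits_unit_type_def)
  show ?thesis
    by (rule simple_sum_types[OF assms(1,3)], rule simple_product_types[OF assms(1,4)],
        rule full_internal_subcategory_cartesian_closed[OF unit])
qed

end
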